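(* Consider the ideal sequence $(\theta^k)$ generated by the box-constrained GS--L-BFGS-B algorithm (gradient sampling with a damped, safeguarded L-BFGS metric) described in the context. Assume exact inner values (of $\psi$) and ordinary gradients (of $\psi$), $\epsilon_k,\omega_k\downarrow0$, $L_k\to\infty$, and $0<\underline bI\preceq M_k\preceq\overline bI$. Suppose the finite hulls $\widehat\partial_k:=\operatorname{co}\mathcal G_k$ are gradient-consistent: along every subsequence $\theta^{k_r}\to\bar\theta$, $$\operatorname{dist}_{\rm H}\bigl(\widehat\partial_{k_r},\partial_C\psi(\bar\theta)\bigr)\longrightarrow0,$$ where $\operatorname{dist}_{\rm H}$ is the Hausdorff distance. Then $\theta^k\in C$, $\psi(\theta^k)$ is nonincreasing, and every accumulation point $\bar\theta$ satisfies $$0\in\partial_C\psi(\bar\theta)+N_C(\bar\theta).$$ Equivalently, for $\bar\Lambda=\underline\Lambda+D_B\bar\theta$, $0\in\partial_C\phi(\bar\Lambda)+N_B(\bar\Lambda)$. If $\phi_B:=\min_{\Lambda\in B}\phi(\Lambda)>0$, this is also Clarke stationarity for maximizing $\rho^\star=1/\phi$ on $B$, i.e. $0\in\partial_C(-\rho^\star)(\bar\Lambda)+N_B(\bar\Lambda)$.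
   Context: Objective. Polynomial system: $\dot{\mathbf x}=\mathbf p(\mathbf x)$ with $\mathbf p\in\mathbb{R}[\mathbf x]^n$, $\mathbf p(\mathbf 0)=\mathbf 0$, and the standing assumption that the Jacobian $J_x(\mathbf p)|_{\mathbf 0}$ is Hurwitz (all eigenvalues have negative real part). $\lVert\cdot\rVert$ is the spectral norm for matrices and the Euclidean norm for vectors. Fixed lift: $m\ge1$, $N=n+m$, $\mathbf g=(g_1,\dots,g_m)$ with each $g_i$ a monomial in $\mathbf x$ of degree at least $2$; $\Phi(\mathbf x)=(\mathbf x,\mathbf g(\mathbf x))\in\mathbb{R}^N$; coordinates $\mathbf w=(\mathbf x,\mathbf y)$. The lift is inner-quadratic: for each $i$ a factorization $g_i=a_ib_i$ is fixed, with $a_i,b_i\in\{x_1,\dots,x_n,y_1,\dots,y_{i-1}\}$ (the identity holding after substituting $\mathbf y=\mathbf g(\mathbf x)$). Stabilizers: $h_i=y_i-a_ib_i$. Reference extension: $\mathbf F_0(\mathbf w)=A_0\mathbf w+H_0(\mathbf w\otimes\mathbf w)$ on $\mathbb{R}^N$, satisfying $\mathbf F_0(\Phi(\mathbf x))=J_x(\Phi)(\mathbf x)\mathbf p(\mathbf x)$ for all $\mathbf x$. Stabilized family: for $\Lambda\in\mathbb{R}^m$, $\mathbf F_\Lambda=\mathbf F_0-\sum_i\lambda_i\mathbf e_{n+i}h_i=A(\Lambda)\mathbf w+H(\Lambda)(\mathbf w\otimes\mathbf w)$ with $A(\Lambda)=A_0-\sum_i\lambda_i\mathbf e_{n+i}\mathbf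 e_{n+i}^{\top}$, $H(\Lambda)=H_0+\sum_i\lambda_i\mathbf e_{n+i}s_i^{\top}$, where $s_i^{\top}(\mathbf w\otimes\mathbf w)=a_ib_i$. Let $\mathcal F=\{\Lambda:A(\Lambda)\text{ Hurwitz}\}$. Gauge: let $\mathcal K=\{K\in\mathbb{R}^{N\times N^2}:K(\mathbf w\otimes\mathbf w)=0\ \forall\mathbf w\}$, of dimension $d=\frac12N^2(N-1)$, with fixed basis $\{K_k\}$; $H(\Lambda,\mu)=H(\Lambda)+\sum_k\mu_kK_k$, $\mu\in\mathbb{R}^d$. For $\Lambda\in\mathcal F$, $P(\Lambda)\succ0$ is the unique solution of $A(\Lambda)^{\top}P+PA(\Lambda)=-I_N$, $P=P_f^{\top}P_f$; with blocks $(M_i)_{rj}:=(H(\Lambda,\mu))_{r,(i-1)N+j}$, $G(\Lambda,\mu)\in\mathbb{R}^{N^2\times N}$ is the vertical stacking of $M_i^{\top}P+PM_i$, $i=1,\dots,N$, and $J(\Lambda,\mu):=(P_f^{\top}\otimes I_N)^{-1}G(\Lambda,\mu)$. Put $\phi(\Lambda)=\min_{\mu\in\mathbb{R}^d}\lVert J(\Lambda,\mu)\rVert$; this is locally Lipschitz on $\mathcal F$. Box and scaling. $B=[\underline\Lambda,\overline\Lambda]\subset\mathcal F$ is a nondegenerate closed box ($\underline\lambda_i<\overline\lambda_i$ for all $i$) and $\mathcal U$ is open with $B\Subset\mathcal U\Subset\mathcal F$ (compact containments). $D_B:=\operatorname{diag}(\overline\Lambda-\underline\Lambda)$, $C:=[0,1]^m$,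 $\mathcal U_B:=D_B^{-1}(\mathcal U-\underline\Lambda)$, and $\psi(\theta):=\phi(\underline\Lambda+D_B\theta)$ on $\mathcal U_B$. $\partial_C$ is the Clarke subdifferential, $\partial_Cf(x)=\bigcap_{\epsilon>0}\operatorname{cl\,co}\{\nabla f(z):\lVert z-x\rVert\le\epsilon,\ f\text{ differentiable at }z\}$ (with $z$ in the open domain considered); for a closed convex set $S$ and $x\in S$, $N_S(x)=\{v:v^{\top}(y-x)\le0\ \forall y\in S\}$. Algorithm. Inputs: $\theta^0\in C$; $c,\beta,\kappa\in(0,1)$; bundle sizes $p_k\ge m+1$; radii $\epsilon_k$; tolerances $\omega_k$; backtracking caps $L_k$; constants $0<\underline b\le\overline b$; a finite L-BFGS memory cap. For $k=0,1,\dots$: 0. If $\psi(\theta^k)=0$ is verified exactly, stop and return the corresponding global Lyapunov certificate. 1. (Sampling.) Draw $z_{kj}=\theta^k+\epsilon_k\xi_{kj}$ with $\xi_{kj}\sim\operatorname{Unif}(\mathbb B_1)$, $\mathbb B_1$ the unit ball of $\mathbb{R}^m$, retaining only samples in $\mathcal U_B$ at which the derivative is accepted (in the ideal algorithm: at which the ordinary gradient $\nabla\psi$ is available), until $p_k\ge m+1$ are obtained. Put $\mathcal G_k=\{g_{kj}=\nabla\psi(z_{kj})\}_{j=1}^{p_k}$. The points $z_{kj}$ need not lie in $C$, and the center $\theta^k$ is not a bundle atom. 2. (Metric.) Update and safeguard $M_k$ from the most recent serious-step secant pair: $s$ is the most recent accepted displacement and $r$ is the change from the preceding QP-dual aggregate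 (defined in step 3) to the next bundle mean (the average of the next bundle's gradients). Only the most recent pairs, up to the memory cap, are retained. For a pair $(s,r)$ and $M\succ0$ the Powell-damped BFGS update is $$M^+=M-\frac{Mss^{\top}M}{s^{\top}Ms}+\frac{\widetilde r\widetilde r^{\top}}{s^{\top}\widetilde r},\qquad \widetilde r=\vartheta r+(1-\vartheta)Ms,$$ with $\vartheta=1$ if $s^{\top}r\ge\kappa s^{\top}Ms$ and $\vartheta=\dfrac{(1-\kappa)s^{\top}Ms}{s^{\top}Ms-s^{\top}r}$ if $s^{\top}r<\kappa s^{\top}Ms$. Spectral clipping of the matrix rebuilt from the retained pairs enforces $\underline bI\preceq M_k\preceq\overline bI$. 3. (Bundle QP.) Let $d_k$ be the unique optimal $d$ in $$\min_{d\in\mathbb{R}^m,\,\zeta\in\mathbb{R}}\ \zeta+\tfrac12d^{\top}M_kd\quad\text{s.t.}\quad g_{kj}^{\top}d\le\zeta\ (j=1,\dots,p_k),\quad-\theta^k\le d\le\mathbf 1-\theta^k,$$ and $\chi_k:=(d_k^{\top}M_kd_k)^{1/2}$. The QP-dual aggregate is $\bar g_k=\sum_j\alpha_{kj}g_{kj}$, where $\alpha_k$ (nonnegative, summing to one) is the multiplier of the inequalities $g_{kj}^{\top}d\le\zeta$. 4. If $\chi_k\le\omega_k$: set $\theta^{k+1}=\theta^k$, reduce $(\epsilon_k,\omega_k)$, and reset the metric. 5. If $\chi_k>\omega_k$: let $\ell_k$ be the smallest $\ell\in\{0,\dots,L_k-1\}$ with $\psi(\theta^k+\beta^\ell d_k)\le\psi(\theta^k)-c\beta^\ell\chi_k^2$.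 If it exists (serious step), set $\theta^{k+1}=\theta^k+\beta^{\ell_k}d_k$ and retain the secant data of the step. Otherwise (null step), set $\theta^{k+1}=\theta^k$, reduce $\epsilon_k$, and reset the metric. The algorithm also stores the evaluated points that pass an independent numerical certificate check and finally returns the stored one with smallest recomputed $\lVert J\rVert$; this bookkeeping does not affect the iterates $\theta^k$. *)

theory Defs
  imports "HOL-Analysis.Analysis"
begin

section \<open>Matrices\<close>

text \<open>
  \<open>\<real>\<^sup>n\<close>, \<open>\<real>\<^sup>m\<close>, \<open>\<real>\<^sup>N\<close>, \<open>\<real>\<^sup>N\<^sup>2\<close> are \<open>real ^ 'n\<close>, \<open>real ^ 'm\<close>, \<open>real ^ ('n + 'm)\<close>,
  \<open>real ^ (('n + 'm) \<times> ('n + 'm))\<close>: the sum type indexes \<open>w = (x, y)\<close>, and the pair \<open>(i, j)\<close>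
  stands for the flat index \<open>(i - 1) N + j\<close>.
\<close>

text \<open>\<open>norm\<close> on matrices is the Frobenius norm, so the spectral norm is taken from \<open>onorm\<close>.\<close>
definition spectral_norm :: "real^'c^'r \<Rightarrow> real" where
  "spectral_norm A = onorm (\<lambda>v. A *v v)"

definition hurwitz :: "real^'k^'k \<Rightarrow> bool" where
  "hurwitz A \<longleftrightarrow>
     (\<forall>(z::complex) (v::complex^'k).
        v \<noteq> 0 \<and> (\<chi> i j. complex_of_real (A $ i $ j)) *v v = z *s v \<longrightarrow> Re z < 0)"

definition kron_vec :: "real^'a \<Rightarrow> real^'b \<Rightarrow> real^('a \<times> 'b)" where
  "kron_vec v w = (\<chi> ij. v $ fst ij * w $ snd ij)"

definition kron_mat :: "real^'c^'a \<Rightarrow> real^'d^'b \<Rightarrow> real^('c \<times> 'd)^('a \<times> 'b)" where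
  "kron_mat A B = (\<chi> i j. A $ fst i $ fst j * B $ snd i $ snd j)"

definition diag_mat :: "real^'k \<Rightarrow> real^'k^'k" where
  "diag_mat v = (\<chi> i j. if i = j then v $ i else 0)"

definition outer_prod :: "real^'a \<Rightarrow> real^'b \<Rightarrow> real^'b^'a" where
  "outer_prod u v = (\<chi> i j. u $ i * v $ j)"

definition pos_def :: "real^'k^'k \<Rightarrow> bool" where
  "pos_def A \<longleftrightarrow> transpose A = A \<and> (\<forall>v. v \<noteq> 0 \<longrightarrow> v \<bullet> (A *v v) > 0)"

definition loewner_le :: "real^'k^'k \<Rightarrow> real^'k^'k \<Rightarrow> bool" where
  "loewner_le A B \<longleftrightarrow>
     transpose A = A \<and> transpose B = B \<and> (\<forall>v. v \<bullet> (A *v v) \<le> v \<bullet> (B *v v))"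


section \<open>Nonsmooth analysis\<close>

definition gradient :: "(real^'m \<Rightarrow> real) \<Rightarrow> real^'m \<Rightarrow> real^'m" where
  "gradient f z = (THE g. GDERIV f z :> g)"

text \<open>\<open>U\<close> is the open domain of \<open>f\<close>; off \<open>U\<close> the (total) function \<open>f\<close> is irrelevant.\<close>
definition clarke_subdiff :: "(real^'m) set \<Rightarrow> (real^'m \<Rightarrow> real) \<Rightarrow> real^'m \<Rightarrow> (real^'m) set" where
  "clarke_subdiff U f x =
     (\<Inter>\<epsilon>\<in>{0<..}. closure (convex hull
        {gradient f z | z. z \<in> U \<and> norm (z - x) \<le> \<epsilon> \<and> f differentiable (at z)}))"

definition normal_cone :: "(real^'m) set \<Rightarrow> real^'m \<Rightarrow> (real^'m) set" where
  "normal_cone S x = {v. \<forall>y\<in>S. v \<bullet> (y - x) \<le> 0}"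

text \<open>Meaningful for nonempty bounded sets, where both suprema are of bounded nonempty sets.\<close>
definition hausdorff_dist :: "(real^'m) set \<Rightarrow> (real^'m) set \<Rightarrow> real" where
  "hausdorff_dist S T = max (SUP s\<in>S. infdist s T) (SUP t\<in>T. infdist t S)"

definition accumulation_point :: "(nat \<Rightarrow> real^'m) \<Rightarrow> real^'m \<Rightarrow> bool" where
  "accumulation_point x a \<longleftrightarrow> (\<exists>r. strict_mono (r :: nat \<Rightarrow> nat) \<and> (\<lambda>i. x (r i)) \<longlonglongrightarrow> a)"


section \<open>The lifted system and the objective\<close>

text \<open>
  \<open>g_exp i j\<close> is the exponent of \<open>x\<^sub>j\<close> in the monomial \<open>g\<^sub>i\<close>. The factors \<open>a\<^sub>i\<close>, \<open>b\<^sub>i\<close> are given by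
  the indices \<open>fac_a i\<close>, \<open>fac_b i\<close> of the coordinates of \<open>w\<close> they equal. \<open>chol \<Lambda>\<close> is the chosen
  factor \<open>P\<^sub>f\<close> of \<open>P(\<Lambda>)\<close>; it is not assumed triangular.
\<close>
record ('n::finite, 'm::finite, 'd::finite) lifted_system =
  vfield :: "real^'n \<Rightarrow> real^'n"
  g_exp :: "'m \<Rightarrow> 'n \<Rightarrow> nat"
  fac_a :: "'m \<Rightarrow> 'n + 'm"
  fac_b :: "'m \<Rightarrow> 'n + 'm"
  A_ref :: "real^('n + 'm)^('n + 'm)"
  H_ref :: "real^(('n + 'm) \<times> ('n + 'm))^('n + 'm)"
  s_row :: "'m \<Rightarrow> real^(('n + 'm) \<times> ('n + 'm))"
  gauge_basis :: "'d \<Rightarrow> real^(('n + 'm) \<times> ('n + 'm))^('n + 'm)"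
  chol :: "real^'m \<Rightarrow> real^('n + 'm)^('n + 'm)"

definition lift_g :: "('n::finite, 'm::finite, 'd::finite) lifted_system \<Rightarrow> real^'n \<Rightarrow> real^'m" where
  "lift_g S x = (\<chi> i. \<Prod>j\<in>UNIV. x $ j ^ g_exp S i j)"

definition lift_map ::
  "('n::finite, 'm::finite, 'd::finite) lifted_system \<Rightarrow> real^'n \<Rightarrow> real^('n + 'm)" where
  "lift_map S x = (\<chi> l. case l of Inl j \<Rightarrow> x $ j | Inr i \<Rightarrow> lift_g S x $ i)"

definition F_ref ::
  "('n::finite, 'm::finite, 'd::finite) lifted_system \<Rightarrow> real^('n + 'm) \<Rightarrow> real^('n + 'm)" where
  "F_ref S w = A_ref S *v w + H_ref S *v kron_vec w w"

definition stabilizer ::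
  "('n::finite, 'm::finite, 'd::finite) lifted_system \<Rightarrow> 'm \<Rightarrow> real^('n + 'm) \<Rightarrow> real" where
  "stabilizer S i w = w $ Inr i - w $ fac_a S i * w $ fac_b S i"

definition F_stab ::
  "('n::finite, 'm::finite, 'd::finite) lifted_system \<Rightarrow> real^'m \<Rightarrow> real^('n + 'm) \<Rightarrow> real^('n + 'm)"
  where
  "F_stab S \<Lambda> w = F_ref S w - (\<Sum>i\<in>UNIV. (\<Lambda> $ i * stabilizer S i w) *\<^sub>R axis (Inr i) 1)"

definition A_stab ::
  "('n::finite, 'm::finite, 'd::finite) lifted_system \<Rightarrow> real^'m \<Rightarrow> real^('n + 'm)^('n + 'm)" where
  "A_stab S \<Lambda> =
     A_ref S - (\<Sum>i\<in>UNIV. \<Lambda> $ i *\<^sub>R outer_prod (axis (Inr i) 1) (axis (Inr i) 1))"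

definition H_stab ::
  "('n::finite, 'm::finite, 'd::finite) lifted_system \<Rightarrow> real^'m
    \<Rightarrow> real^(('n + 'm) \<times> ('n + 'm))^('n + 'm)" where
  "H_stab S \<Lambda> = H_ref S + (\<Sum>i\<in>UNIV. \<Lambda> $ i *\<^sub>R outer_prod (axis (Inr i) 1) (s_row S i))"

definition gauge_space :: "(real^('k \<times> 'k)^'k) set" where
  "gauge_space = {K. \<forall>w. K *v kron_vec w w = 0}"

definition H_gauge ::
  "('n::finite, 'm::finite, 'd::finite) lifted_system \<Rightarrow> real^'m \<Rightarrow> real^'d
    \<Rightarrow> real^(('n + 'm) \<times> ('n + 'm))^('n + 'm)" where
  "H_gauge S \<Lambda> \<mu> = H_stab S \<Lambda> + (\<Sum>k\<in>UNIV. \<mu> $ k *\<^sub>R gauge_basis S k)"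

definition feasible :: "('n::finite, 'm::finite, 'd::finite) lifted_system \<Rightarrow> (real^'m) set" where
  "feasible S = {\<Lambda>. hurwitz (A_stab S \<Lambda>)}"

definition lyap_P ::
  "('n::finite, 'm::finite, 'd::finite) lifted_system \<Rightarrow> real^'m \<Rightarrow> real^('n + 'm)^('n + 'm)" where
  "lyap_P S \<Lambda> =
     (THE P. pos_def P \<and> transpose (A_stab S \<Lambda>) ** P + P ** A_stab S \<Lambda> = - mat 1)"

text \<open>
  The type \<open>'m\<close> is linearly ordered to express that \<open>a\<^sub>i\<close>, \<open>b\<^sub>i\<close> only involve \<open>y\<^sub>k\<close> with \<open>k < i\<close>.
  The index type \<open>'d\<close> of the gauge basis has \<open>dim gauge_space\<close> elements because the family
  \<open>gauge_basis S\<close> is required to be a basis.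
\<close>
definition lifted_system_ok ::
  "('n::finite, 'm::{finite,linorder}, 'd::finite) lifted_system \<Rightarrow> bool" where
  "lifted_system_ok S \<longleftrightarrow>
     polynomial_function (vfield S) \<and> vfield S 0 = 0 \<and> hurwitz (jacobian (vfield S) (at 0)) \<and>
     (\<forall>i. (\<Sum>j\<in>UNIV. g_exp S i j) \<ge> 2) \<and>
     (\<forall>i. fac_a S i \<in> range Inl \<union> Inr ` {..<i} \<and> fac_b S i \<in> range Inl \<union> Inr ` {..<i}) \<and>
     (\<forall>i x. lift_g S x $ i = lift_map S x $ fac_a S i * lift_map S x $ fac_b S i) \<and>
     (\<forall>x. F_ref S (lift_map S x) = jacobian (lift_map S) (at x) *v vfield S x) \<and>
     (\<forall>i w. s_row S i \<bullet> kron_vec w w = w $ fac_a S i * w $ fac_b S i) \<and>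
     inj (gauge_basis S) \<and> independent (range (gauge_basis S)) \<and>
     span (range (gauge_basis S)) = gauge_space \<and>
     (\<forall>\<Lambda>\<in>feasible S. transpose (chol S \<Lambda>) ** chol S \<Lambda> = lyap_P S \<Lambda>)"

lemma outer_prod_mult_vec: "outer_prod u v *v z = (v \<bullet> z) *\<^sub>R u"
  by (simp add: vec_eq_iff outer_prod_def matrix_vector_mult_def inner_vec_def sum_distrib_left
      mult_ac)

lemma sum_scaleR_mult_vec:
  fixes B :: "'i \<Rightarrow> real^'y^'x"
  assumes "finite I"
  shows "(\<Sum>i\<in>I. c i *\<^sub>R B i) *v z = (\<Sum>i\<in>I. c i *\<^sub>R (B i *v z))"
  using assms
  by (induction I rule: finite_induct)
    (simp_all add: matrix_vector_mult_add_rdistrib scaleR_matrix_vector_assoc)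

lemma F_stab_eq:
  assumes "lifted_system_ok S"
  shows "F_stab S \<Lambda> w = A_stab S \<Lambda> *v w + H_stab S \<Lambda> *v kron_vec w w"
proof -
  have s_row: "s_row S i \<bullet> kron_vec w w = w $ fac_a S i * w $ fac_b S i" for i
    using assms by (simp add: lifted_system_ok_def)
  show ?thesis
    by (simp add: F_stab_def F_ref_def A_stab_def H_stab_def stabilizer_def s_row
        outer_prod_mult_vec sum_scaleR_mult_vec
        matrix_vector_mult_add_rdistrib matrix_vector_mult_diff_rdistrib inner_axis'
        right_diff_distrib scaleR_left_diff_distrib sum_subtractf)
qed

definition G_mat ::
  "('n::finite, 'm::finite, 'd::finite) lifted_system \<Rightarrow> real^'m \<Rightarrow> real^'d
    \<Rightarrow> real^('n + 'm)^(('n + 'm) \<times> ('n + 'm))" where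
  "G_mat S \<Lambda> \<mu> =
     (let P = lyap_P S \<Lambda>;
          M = (\<lambda>i. (\<chi> r j. H_gauge S \<Lambda> \<mu> $ r $ (i, j)) :: real^('n + 'm)^('n + 'm))
      in \<chi> ir. (transpose (M (fst ir)) ** P + P ** M (fst ir)) $ snd ir)"

definition J_mat ::
  "('n::finite, 'm::finite, 'd::finite) lifted_system \<Rightarrow> real^'m \<Rightarrow> real^'d
    \<Rightarrow> real^('n + 'm)^(('n + 'm) \<times> ('n + 'm))" where
  "J_mat S \<Lambda> \<mu> = matrix_inv (kron_mat (transpose (chol S \<Lambda>)) (mat 1)) ** G_mat S \<Lambda> \<mu>"

text \<open>The infimum is attained on \<open>feasible S\<close>, since \<open>J_mat S \<Lambda> \<mu>\<close> is affine in \<open>\<mu>\<close>.\<close>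
definition phi :: "('n::finite, 'm::finite, 'd::finite) lifted_system \<Rightarrow> real^'m \<Rightarrow> real" where
  "phi S \<Lambda> = (INF \<mu>. spectral_norm (J_mat S \<Lambda> \<mu>))"

definition rho_star :: "('n::finite, 'm::finite, 'd::finite) lifted_system \<Rightarrow> real^'m \<Rightarrow> real" where
  "rho_star S \<Lambda> = 1 / phi S \<Lambda>"

definition unscale :: "real^'m \<Rightarrow> real^'m \<Rightarrow> real^'m \<Rightarrow> real^'m" where
  "unscale lo hi \<theta> = lo + diag_mat (hi - lo) *v \<theta>"

definition unit_box :: "(real^'m) set" where
  "unit_box = cbox 0 1"

definition scaled_domain :: "real^'m \<Rightarrow> real^'m \<Rightarrow> (real^'m) set \<Rightarrow> (real^'m) set" where
  "scaled_domain lo hi U = {\<theta>. unscale lo hi \<theta> \<in> U}"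

definition psi ::
  "('n::finite, 'm::finite, 'd::finite) lifted_system \<Rightarrow> real^'m \<Rightarrow> real^'m \<Rightarrow> real^'m \<Rightarrow> real" where
  "psi S lo hi \<theta> = phi S (unscale lo hi \<theta>)"


section \<open>The algorithm\<close>

record ('m::finite) gs_input =
  start :: "real^'m"
  armijo_c :: real
  backtrack :: real
  damping :: real
  bundle_size :: "nat \<Rightarrow> nat"
  radius :: "nat \<Rightarrow> real"
  tol :: "nat \<Rightarrow> real"
  ls_cap :: "nat \<Rightarrow> nat"
  metric_lo :: real
  metric_hi :: real
  mem_cap :: nat

text \<open>
  One realization of the algorithm, indexed by the iteration number \<open>k\<close> and, for \<open>sample\<close> and
  \<open>mult\<close>, by the bundle index \<open>j < bundle_size k\<close>. \<open>certified k\<close> says that \<open>\<psi>(\<theta>\<^sup>k) = 0\<close>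
  was verified, which stops the algorithm; entries from the first such \<open>k\<close> on (except \<open>iterate k\<close>) are meaningless.
  \<open>seed k\<close> is the matrix from which the metric of iteration \<open>k\<close> is rebuilt.
\<close>
record ('m::finite) gs_trace =
  iterate :: "nat \<Rightarrow> real^'m"
  certified :: "nat \<Rightarrow> bool"
  sample :: "nat \<Rightarrow> nat \<Rightarrow> real^'m"
  seed :: "nat \<Rightarrow> real^'m^'m"
  metric :: "nat \<Rightarrow> real^'m^'m"
  dir :: "nat \<Rightarrow> real^'m"
  level :: "nat \<Rightarrow> real"
  mult :: "nat \<Rightarrow> nat \<Rightarrow> real"

definition gs_input_ok :: "('m::finite) gs_input \<Rightarrow> bool" where
  "gs_input_ok I \<longleftrightarrow>
     start I \<in> unit_box \<and>
     0 < armijo_c I \<and> armijo_c I < 1 \<and> 0 < backtrack I \<and> backtrack I < 1 \<and>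
     0 < damping I \<and> damping I < 1 \<and>
     (\<forall>k. bundle_size I k \<ge> CARD('m) + 1) \<and> (\<forall>k. radius I k > 0) \<and> (\<forall>k. tol I k > 0) \<and>
     0 < metric_lo I \<and> metric_lo I \<le> metric_hi I"

definition reached :: "('m::finite) gs_trace \<Rightarrow> nat \<Rightarrow> bool" where
  "reached R k \<longleftrightarrow> (\<forall>j<k. \<not> certified R j)"

definition bundle_grad :: "(real^'m \<Rightarrow> real) \<Rightarrow> ('m::finite) gs_trace \<Rightarrow> nat \<Rightarrow> nat \<Rightarrow> real^'m" where
  "bundle_grad f R k j = gradient f (sample R k j)"

definition bundle_set ::
  "(real^'m \<Rightarrow> real) \<Rightarrow> ('m::finite) gs_input \<Rightarrow> 'm gs_trace \<Rightarrow> nat \<Rightarrow> (real^'m) set" where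
  "bundle_set f I R k = bundle_grad f R k ` {..<bundle_size I k}"

definition bundle_mean ::
  "(real^'m \<Rightarrow> real) \<Rightarrow> ('m::finite) gs_input \<Rightarrow> 'm gs_trace \<Rightarrow> nat \<Rightarrow> real^'m" where
  "bundle_mean f I R k =
     (1 / real (bundle_size I k)) *\<^sub>R (\<Sum>j<bundle_size I k. bundle_grad f R k j)"

definition aggregate ::
  "(real^'m \<Rightarrow> real) \<Rightarrow> ('m::finite) gs_input \<Rightarrow> 'm gs_trace \<Rightarrow> nat \<Rightarrow> real^'m" where
  "aggregate f I R k = (\<Sum>j<bundle_size I k. mult R k j *\<^sub>R bundle_grad f R k j)"

definition chi :: "('m::finite) gs_trace \<Rightarrow> nat \<Rightarrow> real" where
  "chi R k = sqrt (dir R k \<bullet> (metric R k *v dir R k))"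

definition armijo_at ::
  "(real^'m \<Rightarrow> real) \<Rightarrow> ('m::finite) gs_input \<Rightarrow> 'm gs_trace \<Rightarrow> nat \<Rightarrow> nat \<Rightarrow> bool" where
  "armijo_at f I R k l \<longleftrightarrow>
     l < ls_cap I k \<and>
     f (iterate R k + backtrack I ^ l *\<^sub>R dir R k)
       \<le> f (iterate R k) - armijo_c I * backtrack I ^ l * (chi R k)\<^sup>2"

definition serious ::
  "(real^'m \<Rightarrow> real) \<Rightarrow> ('m::finite) gs_input \<Rightarrow> 'm gs_trace \<Rightarrow> nat \<Rightarrow> bool" where
  "serious f I R k \<longleftrightarrow> chi R k > tol I k \<and> (\<exists>l. armijo_at f I R k l)"

text \<open>
  \<open>z = \<theta>\<^sup>k + \<epsilon>\<^sub>k \<xi>\<close> with \<open>\<xi>\<close> in the unit ball. No use is made of the distribution of \<open>\<xi>\<close>: every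
  realization of the retained samples is allowed.
\<close>
definition sampling_step ::
  "(real^'m \<Rightarrow> real) \<Rightarrow> (real^'m) set \<Rightarrow> ('m::finite) gs_input \<Rightarrow> 'm gs_trace \<Rightarrow> nat \<Rightarrow> bool" where
  "sampling_step f U I R k \<longleftrightarrow>
     (\<forall>j<bundle_size I k.
        (\<exists>\<xi>\<in>cball 0 1. sample R k j = iterate R k + radius I k *\<^sub>R \<xi>) \<and>
        sample R k j \<in> U \<and> f differentiable (at (sample R k j)))"

definition powell_bfgs :: "real \<Rightarrow> (real^'m) \<times> (real^'m) \<Rightarrow> real^'m^'m \<Rightarrow> real^'m^'m" where
  "powell_bfgs \<kappa> sr M =
     (let s = fst sr; r = snd sr;
          q = s \<bullet> (M *v s);
          t = (if s \<bullet> r \<ge> \<kappa> * q then 1 else (1 - \<kappa>) * q / (q - s \<bullet> r));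
          r' = t *\<^sub>R r + (1 - t) *\<^sub>R (M *v s)
      in M - (1 / q) *\<^sub>R (M ** outer_prod s s ** M) + (1 / (s \<bullet> r')) *\<^sub>R outer_prod r' r')"

definition spectral_clip :: "real \<Rightarrow> real \<Rightarrow> real^'m^'m \<Rightarrow> real^'m^'m \<Rightarrow> bool" where
  "spectral_clip l u M M' \<longleftrightarrow>
     (\<exists>Q \<sigma>. orthogonal_matrix Q \<and> M = Q ** diag_mat \<sigma> ** transpose Q \<and>
        M' = Q ** diag_mat (\<chi> i. max l (min u (\<sigma> $ i))) ** transpose Q)"

text \<open>
  Secant pairs in memory when the metric of iteration \<open>k\<close> is built, newest first. The pair of a
  serious step \<open>k\<close> needs the bundle of iteration \<open>k + 1\<close>; any other step resets the metric.
\<close>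
primrec secant_mem ::
  "(real^'m \<Rightarrow> real) \<Rightarrow> ('m::finite) gs_input \<Rightarrow> 'm gs_trace \<Rightarrow> nat \<Rightarrow> ((real^'m) \<times> (real^'m)) list"
  where
  "secant_mem f I R 0 = []"
| "secant_mem f I R (Suc k) =
     (if serious f I R k
      then take (mem_cap I)
             ((iterate R (Suc k) - iterate R k, bundle_mean f I R (Suc k) - aggregate f I R k)
               # secant_mem f I R k)
      else [])"

definition metric_step ::
  "(real^'m \<Rightarrow> real) \<Rightarrow> ('m::finite) gs_input \<Rightarrow> 'm gs_trace \<Rightarrow> nat \<Rightarrow> bool" where
  "metric_step f I R k \<longleftrightarrow>
     pos_def (seed R k) \<and>
     spectral_clip (metric_lo I) (metric_hi I)
       (foldr (powell_bfgs (damping I)) (secant_mem f I R k) (seed R k)) (metric R k)"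

definition qp_feasible ::
  "(real^'m \<Rightarrow> real) \<Rightarrow> ('m::finite) gs_input \<Rightarrow> 'm gs_trace \<Rightarrow> nat \<Rightarrow> (real^'m) \<times> real \<Rightarrow> bool" where
  "qp_feasible f I R k = (\<lambda>(d, \<zeta>).
     (\<forall>j<bundle_size I k. bundle_grad f R k j \<bullet> d \<le> \<zeta>) \<and>
     - iterate R k \<le> d \<and> d \<le> 1 - iterate R k)"

text \<open>The KKT conditions of the QP; \<open>u\<close> and \<open>v\<close> are the multipliers of the two box constraints.\<close>
definition qp_multiplier ::
  "(real^'m \<Rightarrow> real) \<Rightarrow> ('m::finite) gs_input \<Rightarrow> 'm gs_trace \<Rightarrow> nat \<Rightarrow> bool" where
  "qp_multiplier f I R k \<longleftrightarrow>
     (\<forall>j<bundle_size I k. mult R k j \<ge> 0 \<and>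
        mult R k j * (bundle_grad f R k j \<bullet> dir R k - level R k) = 0) \<and>
     (\<Sum>j<bundle_size I k. mult R k j) = 1 \<and>
     (\<exists>u v. u \<ge> 0 \<and> v \<ge> 0 \<and>
        (\<forall>i. u $ i * (dir R k $ i + iterate R k $ i) = 0 \<and>
             v $ i * (dir R k $ i - (1 - iterate R k $ i)) = 0) \<and>
        metric R k *v dir R k + aggregate f I R k - u + v = 0)"

definition qp_step ::
  "(real^'m \<Rightarrow> real) \<Rightarrow> ('m::finite) gs_input \<Rightarrow> 'm gs_trace \<Rightarrow> nat \<Rightarrow> bool" where
  "qp_step f I R k \<longleftrightarrow>
     is_arg_min (\<lambda>(d, \<zeta>). \<zeta> + 1/2 * (d \<bullet> (metric R k *v d))) (qp_feasible f I R k)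
       (dir R k, level R k) \<and>
     qp_multiplier f I R k"

definition update_step ::
  "(real^'m \<Rightarrow> real) \<Rightarrow> ('m::finite) gs_input \<Rightarrow> 'm gs_trace \<Rightarrow> nat \<Rightarrow> bool" where
  "update_step f I R k \<longleftrightarrow>
     (if chi R k \<le> tol I k then
        iterate R (Suc k) = iterate R k \<and>
        radius I (Suc k) < radius I k \<and> tol I (Suc k) < tol I k
      else if \<exists>l. armijo_at f I R k l then
        iterate R (Suc k) = iterate R k + backtrack I ^ (LEAST l. armijo_at f I R k l) *\<^sub>R dir R k
      else
        iterate R (Suc k) = iterate R k \<and> radius I (Suc k) < radius I k)"

text \<open>The algorithm for the objective \<open>f\<close> on the open domain \<open>U \<supseteq> unit_box\<close>.\<close>
definition gs_run ::
  "(real^'m \<Rightarrow> real) \<Rightarrow> (real^'m) set \<Rightarrow> ('m::finite) gs_input \<Rightarrow> 'm gs_trace \<Rightarrow> bool" where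
  "gs_run f U I R \<longleftrightarrow>
     iterate R 0 = start I \<and>
     (\<forall>k. reached R k \<and> certified R k \<longrightarrow> f (iterate R k) = 0) \<and>
     (\<forall>k. reached R k \<and> \<not> certified R k \<longrightarrow>
        sampling_step f U I R k \<and> metric_step f I R k \<and> qp_step f I R k \<and> update_step f I R k)"

definition gradient_consistent ::
  "(real^'m \<Rightarrow> real) \<Rightarrow> (real^'m) set \<Rightarrow> ('m::finite) gs_input \<Rightarrow> 'm gs_trace \<Rightarrow> bool" where
  "gradient_consistent f U I R \<longleftrightarrow>
     (\<forall>(r :: nat \<Rightarrow> nat) \<theta>. strict_mono r \<and> (\<lambda>i. iterate R (r i)) \<longlonglongrightarrow> \<theta> \<longrightarrow>
        (\<lambda>i. hausdorff_dist (convex hull (bundle_set f I R (r i))) (clarke_subdiff U f \<theta>)) \<longlonglongrightarrow> 0)"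

end

theory Submission
  imports Defs "HOL-Computational_Algebra.Fundamental_Theorem_Algebra"
begin

text \<open>
  Near a point that is not stationary the method would have to decrease the objective by a fixed amount
  at every visit, but the values decrease monotonically and, by continuity, converge along the visits.

  Let \<open>d\<close> be the solution of the quadratic program at \<open>\<theta>\<^sup>k\<close> and \<open>\<chi>\<^sup>2 = d\<^sup>T M\<^sub>k d\<close>. Its optimality conditions say
  that \<open>- (M\<^sub>k d + g)\<close> is normal to the box at \<open>\<theta>\<^sup>k + d\<close> for the aggregate \<open>g\<close>, and that every \<open>h\<close> in the hull of
  the bundle has \<open>h\<^sup>T d \<le> - \<chi>\<^sup>2\<close> (\<open>hull_dot_dir_le\<close>). Along a sequence \<open>\<theta>\<^sup>k \<rightarrow> \<theta>\<close> pass to a subsequence along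
  which \<open>\<chi>\<close> converges. If the limit is \<open>0\<close>, then \<open>d \<rightarrow> 0\<close>, gradient consistency puts the limit of the
  aggregates into the subdifferential at \<open>\<theta>\<close>, and the optimality conditions pass to the limit
  (\<open>stationary_if_chi_vanishes\<close>). If the limit is positive, gradient consistency makes \<open>g\<^sup>T d\<close> at most about
  \<open>- \<chi>\<^sup>2\<close> for every \<open>g\<close> in the subdifferential at \<open>\<theta>\<close>. A mean value inequality then turns this into actual decrease for
  all steps below a fixed length, so the line search accepts after boundedly many backtrackings and the
  value drops by a fixed amount infinitely often, a contradiction (\<open>chi_not_bounded_below\<close>).

  Two analytic facts carry this argument. The first is the mean value inequality
  \<open>clarke_subdiff_increment\<close>. Since the subdifferential is made of gradients at points of
  differentiability, it can control increments only if there are enough such points, and this is Rademacher's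
  theorem (\<open>rademacher\<close>). It is proved from the one-dimensional case by Fubini, and the linearity of the
  directional derivative in the direction comes from integrating difference quotients over boxes.

  The second is that the objective is locally Lipschitz (\<open>phi_locally_lipschitz\<close>). The solution of the
  Lyapunov equation depends on \<open>\<Lambda>\<close> in a Lipschitz way because the Lyapunov operator of a Hurwitz matrix is
  injective (\<open>lyap_op_kernel\<close>); it is positive definite because this can be checked at the end of the path from
  \<open>A\<close> to \<open>- I\<close> and cannot be lost along it (\<open>lyap_solution_pos_def\<close>). Minimizers in the gauge variable may be
  unbounded, so they are not compared directly. Instead, the gauge space is invariant under multiplication by \<open>P\<close>, so
  that the admissible matrices \<open>G\<close> at two parameters differ by a fixed translation (\<open>G_mat_transfer\<close>), and the norm
  of \<open>J\<close> is expressed by a quadratic form in \<open>P\<close> itself, instead of its factor (\<open>J_norm_le_iff\<close>).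

  The equivalences between the three formulations of stationarity are chain rules for gradients that survive
  the passage to closed convex hulls and to limits (\<open>clarke_subdiff_transform\<close>).
\<close>

section \<open>Lipschitz functions on the line\<close>

text \<open>An expanding Lipschitz function \<open>F\<close> is a bijection with Lipschitz inverse, and the image of Lebesgue
  measure under the inverse gives \<open>{a..b}\<close> the mass \<open>F b - F a\<close>. Since \<open>F\<close> maps null sets to null sets, this
  measure has a density by the theorem of Radon and Nikodym.\<close>

lemma expanding_density:
  fixes F :: "real \<Rightarrow> real"
  assumes expand: "\<And>a b. a \<le> b \<Longrightarrow> b - a \<le> F b - F a"
    and lip: "\<And>a b. \<bar>F a - F b\<bar> \<le> C * \<bar>a - b\<bar>"
  obtains h where "\<And>a b. a \<le> b \<Longrightarrow> (h has_integral (F b - F a)) {a..b}"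
proof -
  have mono: "F a \<le> F b \<longleftrightarrow> a \<le> b" for a b
    using expand[of a b] expand[of b a] by linarith
  have inj: "inj F"
    by (rule injI) (metis mono order_antisym order_refl)
  have "0 \<le> C"
    using lip[of 0 1] by simp
  have cont: "continuous_on S F" for S
    using lip \<open>0 \<le> C\<close>
    by (intro lipschitz_on_continuous_on[of C] lipschitz_onI) (auto simp: dist_real_def)
  have surj: "surj F"
  proof (unfold surj_def, rule allI)
    fix y
    define r where "r = \<bar>y - F 0\<bar>"
    have "F (-r) \<le> y" "y \<le> F r"
      using expand[of 0 r] expand[of "-r" 0] by (auto simp: r_def)
    then show "\<exists>x. y = F x"
      using IVT'[of F "-r" y r] cont by (force simp: r_def)
  qed
  define k where "k = inv F"
  have kF [simp]: "k (F x) = x" and Fk [simp]: "F (k y) = y" for x y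
    using inj surj by (simp_all add: k_def surj_f_inv_f)
  have k_lip: "\<bar>k y - k z\<bar> \<le> 1 * \<bar>y - z\<bar>" for y z
    using expand[of "k y" "k z"] expand[of "k z" "k y"] by (simp add: abs_if) linarith
  have "continuous_on UNIV k"
    using k_lip by (intro lipschitz_on_continuous_on[of 1] lipschitz_onI) (auto simp: dist_real_def)
  then have k_meas [measurable]: "k \<in> borel_measurable borel"
    by (rule borel_measurable_continuous_onI)
  define \<mu> where "\<mu> = distr lborel borel k"
  have vimage: "k -` A = F ` A" for A
    by force
  have icc: "F ` {a..b} = {F a..F b}" for a b
  proof -
    have "x \<in> F ` {a..b}" if "F a \<le> x" "x \<le> F b" for x
      using that mono[of a "k x"] mono[of "k x" b] by (auto intro!: image_eqI[of _ _ "k x"])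
    then show ?thesis by (auto simp: mono)
  qed
  have emeasure_\<mu>: "emeasure \<mu> {a..b} = F b - F a" if "a \<le> b" for a b
    using that by (simp add: \<mu>_def emeasure_distr vimage icc mono)
  have "absolutely_continuous lborel \<mu>"
    unfolding absolutely_continuous_def
  proof
    fix A :: "real set" assume A: "A \<in> null_sets lborel"
    then have "negligible A"
      by (simp add: negligible_iff_null_sets null_sets_completionI)
    then have "negligible (F ` A)"
      by (rule negligible_locally_Lipschitz_image[rotated])
         (use lip in \<open>auto intro!: exI[of _ UNIV] exI[of _ C]\<close>)
    moreover have "k -` A \<in> sets borel"
      using measurable_sets[OF k_meas, of A] A by auto
    ultimately have "emeasure lborel (k -` A) = 0"
      unfolding vimage negligible_iff_null_sets
      by (auto simp: null_sets_def emeasure_completion)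
    then show "A \<in> null_sets \<mu>"
      using A by (auto simp: null_sets_def \<mu>_def emeasure_distr)
  qed
  then obtain e where e [measurable]: "e \<in> borel_measurable lborel" and dens: "density lborel e = \<mu>"
    using sigma_finite_measure.Radon_Nikodym[OF lborel.sigma_finite_measure_axioms, of \<mu>] by (auto simp: \<mu>_def)
  define h where "h = (\<lambda>x. enn2real (e x))"
  have "(h has_integral (F b - F a)) {a..b}" if "a \<le> b" for a b
  proof -
    have eq: "(\<integral>\<^sup>+x. e x * indicator {a..b} x \<partial>lborel) = F b - F a"
      using emeasure_\<mu>[OF that] by (simp add: dens[symmetric] emeasure_density)
    then have "AE x in lborel. e x * indicator {a..b} x \<noteq> \<infinity>"
      by (intro nn_integral_PInf_AE) auto
    then have "(\<integral>\<^sup>+x. ennreal (h x * indicator {a..b} x) \<partial>lborel) = F b - F a"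
      unfolding eq[symmetric]
      by (intro nn_integral_cong_AE, eventually_elim)
         (auto simp: h_def indicator_def less_top)
    then have "((\<lambda>x. h x * indicator {a..b} x) has_integral (F b - F a)) UNIV"
      by (intro nn_integral_has_integral) (use that in \<open>auto simp: h_def mono\<close>)
    then show ?thesis
      by (subst has_integral_restrict_UNIV[symmetric])
         (simp add: indicator_def of_bool_def if_distrib cong: if_cong)
  qed
  then show thesis by (rule that)
qed

text \<open>Adding a steep linear function makes \<open>g\<close> expanding.\<close>

lemma lipschitz_real_density:
  fixes g :: "real \<Rightarrow> real"
  assumes "L-lipschitz_on UNIV g"
  obtains h where "\<And>a b. a \<le> b \<Longrightarrow> (h has_integral (g b - g a)) {a..b}"
proof -
  have lip: "\<bar>g a - g b\<bar> \<le> L * \<bar>a - b\<bar>" for a b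
    using lipschitz_onD[OF assms, of a b] by (simp add: dist_real_def)
  have L: "0 \<le> L" using assms by (rule lipschitz_on_nonneg)
  define F where "F = (\<lambda>t. g t + (L + 1) * t)"
  have "b - a \<le> F b - F a" if "a \<le> b" for a b
    using lip[of a b] that by (simp add: F_def algebra_simps)
  moreover have "\<bar>F a - F b\<bar> \<le> (2 * L + 1) * \<bar>a - b\<bar>" for a b
  proof -
    have "F a - F b = (g a - g b) + (L + 1) * (a - b)" by (simp add: F_def algebra_simps)
    also have "\<bar>\<dots>\<bar> \<le> L * \<bar>a - b\<bar> + (L + 1) * \<bar>a - b\<bar>"
      using abs_triangle_ineq[of "g a - g b" "(L + 1) * (a - b)"] lip[of a b] L
      by (simp add: abs_mult)
    finally show ?thesis by (simp add: algebra_simps)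
  qed
  ultimately obtain h where h: "\<And>a b. a \<le> b \<Longrightarrow> (h has_integral (F b - F a)) {a..b}"
    using expanding_density by blast
  have "((\<lambda>x. h x - (L + 1)) has_integral (g b - g a)) {a..b}" if "a \<le> b" for a b
  proof -
    have "((\<lambda>x. h x - (L + 1)) has_integral (F b - F a - (L + 1) * (b - a))) {a..b}"
      using has_integral_const_real[of "L + 1" a b] that
      by (intro has_integral_diff h) (simp_all add: mult.commute)
    then show ?thesis by (simp add: F_def algebra_simps)
  qed
  then show thesis by (rule that)
qed

text \<open>Lebesgue's differentiation theorem for intervals whose left end point is \<open>x\<close>. The left derivative is
  obtained below by reflection.\<close>

lemma right_derivative_of_integral:
  fixes h :: "real \<Rightarrow> real"
  assumes int: "\<And>a b. a \<le> b \<Longrightarrow> (h has_integral (g b - g a)) {a..b}"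
  obtains N where "negligible N"
    "\<And>x. x \<notin> N \<Longrightarrow> ((\<lambda>t. (g (x + t) - g x) / t) \<longlongrightarrow> h x) (at_right 0)"
proof -
  have "h integrable_on cbox a b" for a b
    using int[of a b] by (cases "a \<le> b") (auto simp: integrable_on_def)
  then obtain N where N: "negligible N"
    and lim: "\<And>x e. \<lbrakk>x \<notin> N; 0 < e\<rbrakk> \<Longrightarrow> \<exists>d>0. \<forall>s. 0 < s \<and> s < d \<longrightarrow>
        norm (integral (cbox x (x + s *\<^sub>R One)) h /\<^sub>R s ^ DIM(real) - h x) < e"
    using integrable_ccontinuous_explicit by blast
  have "((\<lambda>t. (g (x + t) - g x) / t) \<longlongrightarrow> h x) (at_right 0)" if x: "x \<notin> N" for x
  proof (rule tendstoI)
    fix e :: real assume "e > 0"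
    from lim[OF x this] obtain d where d: "d > 0"
      "\<And>s. 0 < s \<Longrightarrow> s < d \<Longrightarrow> \<bar>integral {x..x + s} h / s - h x\<bar> < e"
      by (auto simp: field_simps)
    have "dist ((g (x + t) - g x) / t) (h x) < e" if "0 < t" "t < d" for t
      using d(2)[OF that] integral_unique[OF int[of x "x + t"]] that by (simp add: dist_real_def)
    then show "\<forall>\<^sub>F t in at_right 0. dist ((g (x + t) - g x) / t) (h x) < e"
      using d(1) by (auto simp: eventually_at_right_field)
  qed
  with N that show thesis by blast
qed

lemma lipschitz_real_ae_derivative:
  fixes g :: "real \<Rightarrow> real"
  assumes "L-lipschitz_on UNIV g"
  obtains h N where "negligible N"
    "\<And>x. x \<notin> N \<Longrightarrow> ((\<lambda>t. (g (x + t) - g x) / t) \<longlongrightarrow> h x) (at 0)"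
    "\<And>a b. a \<le> b \<Longrightarrow> (h has_integral (g b - g a)) {a..b}"
proof -
  obtain h where h: "\<And>a b. a \<le> b \<Longrightarrow> (h has_integral (g b - g a)) {a..b}"
    using lipschitz_real_density[OF assms] by blast
  obtain N1 where N1: "negligible N1"
    and right: "\<And>x. x \<notin> N1 \<Longrightarrow> ((\<lambda>t. (g (x + t) - g x) / t) \<longlongrightarrow> h x) (at_right 0)"
    using right_derivative_of_integral[OF h] by blast
  have "((\<lambda>x. h (- x)) has_integral (- g (- b) - - g (- a))) {a..b}" if "a \<le> b" for a b
    using has_integral_reflect_real[where f=h and a="-b" and b="-a"] h[of "-b" "-a"] that by simp
  then obtain N2 where N2: "negligible N2"
    and left: "\<And>x. x \<notin> N2 \<Longrightarrow>
      ((\<lambda>t. (- g (- (x + t)) - - g (- x)) / t) \<longlongrightarrow> h (- x)) (at_right 0)"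
    using right_derivative_of_integral[where g="\<lambda>x. - g (- x)" and h="\<lambda>x. h (- x)"] by blast
  have "negligible (N1 \<union> uminus ` N2)"
    using N1 N2
    by (intro negligible_Un negligible_differentiable_image_negligible)
      (auto intro!: derivative_intros simp: differentiable_on_def)
  moreover have "((\<lambda>t. (g (x + t) - g x) / t) \<longlongrightarrow> h x) (at 0)" if "x \<notin> N1 \<union> uminus ` N2" for x
  proof -
    have x: "x \<notin> N1" "- x \<notin> N2" using that by force+
    have "((\<lambda>t. (g x - g (x - t)) / t) \<longlongrightarrow> h x) (at_right 0)"
      using left[OF x(2)] by (simp add: add.commute)
    then have "((\<lambda>t. (g x - g (x + t)) / (- t)) \<longlongrightarrow> h x) (at_left 0)"
      by (simp add: filterlim_at_left_to_right)
    moreover have "(g x - g (x + t)) / (- t) = (g (x + t) - g x) / t" for t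
      by (simp add: divide_simps)
    ultimately have "((\<lambda>t. (g (x + t) - g x) / t) \<longlongrightarrow> h x) (at_left 0)"
      by simp
    with right[OF x(1)] show ?thesis
      by (simp add: filterlim_split_at)
  qed
  ultimately show thesis using that h by blast
qed

section \<open>Directional derivatives of Lipschitz functions\<close>

lemma lborel_translate: "distr lborel borel (\<lambda>x. d + x) = (lborel :: 'a::euclidean_space measure)"
  using lborel_affine[of 1 d] by (simp add: density_1)

text \<open>After exchanging the integrals, the inner one is the measure of a translate of \<open>E\<close>.\<close>

lemma nn_integral_along_lines:
  fixes E :: "'a::euclidean_space set" and T :: "real set"
  assumes [measurable]: "E \<in> sets borel" "T \<in> sets borel"
  shows "(\<integral>\<^sup>+x. (\<integral>\<^sup>+t. indicator T t * indicator E (x + t *\<^sub>R v) \<partial>lborel) \<partial>lborel)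
    = emeasure lborel T * emeasure lborel E"
proof -
  have "(\<integral>\<^sup>+x. (\<integral>\<^sup>+t. indicator T t * indicator E (x + t *\<^sub>R v) \<partial>lborel) \<partial>lborel)
    = (\<integral>\<^sup>+t. (\<integral>\<^sup>+x. indicator T t * indicator E (x + t *\<^sub>R v) \<partial>lborel) \<partial>lborel)"
    by (rule lborel_pair.Fubini') measurable
  also have "\<dots> = (\<integral>\<^sup>+t. indicator T t * emeasure lborel E \<partial>lborel)"
  proof (rule nn_integral_cong)
    fix t :: real
    have "(\<integral>\<^sup>+x. indicator E (x + t *\<^sub>R v) \<partial>lborel)
        = (\<integral>\<^sup>+x. indicator E x \<partial>distr lborel borel (\<lambda>x. t *\<^sub>R v + x))"
      by (subst nn_integral_distr) (auto simp: add.commute)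
    then show "(\<integral>\<^sup>+x. indicator T t * indicator E (x + t *\<^sub>R v) \<partial>lborel)
        = indicator T t * emeasure lborel E"
      by (simp add: nn_integral_cmult lborel_translate)
  qed
  also have "\<dots> = emeasure lborel T * emeasure lborel E"
    by (simp add: nn_integral_multc)
  finally show ?thesis .
qed

lemma null_set_if_null_on_lines:
  fixes E :: "'a::euclidean_space set"
  assumes E [measurable]: "E \<in> sets borel" and lines: "\<And>x. negligible {t. x + t *\<^sub>R v \<in> E}"
  shows "E \<in> null_sets lborel"
proof -
  have "emeasure lborel E = (\<integral>\<^sup>+x. (\<integral>\<^sup>+t. indicator {0..1} t * indicator E (x + t *\<^sub>R v) \<partial>lborel) \<partial>lborel)"
    by (simp add: nn_integral_along_lines)
  also have "\<dots> = (\<integral>\<^sup>+x. 0 \<partial>(lborel :: 'a measure))"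
  proof (rule nn_integral_cong)
    fix x :: 'a
    have "AE t in lebesgue. x + t *\<^sub>R v \<notin> E"
      using lines[of x] by (intro AE_I'[of "{t. x + t *\<^sub>R v \<in> E}"]) (auto simp: negligible_iff_null_sets)
    then have "AE t in lborel. x + t *\<^sub>R v \<notin> E"
      by (simp add: AE_completion_iff)
    then show "(\<integral>\<^sup>+t. indicator {0..1} t * indicator E (x + t *\<^sub>R v) \<partial>lborel) = 0"
      by (subst nn_integral_0_iff_AE) (auto elim!: eventually_mono)
  qed
  finally show ?thesis by (simp add: null_sets_def)
qed

lemma AE_null_on_lines:
  fixes E :: "'a::euclidean_space set"
  assumes E: "E \<in> null_sets lborel"
  shows "AE x in lborel. AE t in lborel. x + t *\<^sub>R v \<notin> E"
proof -
  have [measurable]: "E \<in> sets borel" using E by auto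
  have "(\<integral>\<^sup>+x. (\<integral>\<^sup>+t. indicator UNIV t * indicator E (x + t *\<^sub>R v) \<partial>lborel) \<partial>(lborel :: 'a measure)) = 0"
    using E by (subst nn_integral_along_lines) (auto simp: null_sets_def)
  then have "AE x in lborel. (\<integral>\<^sup>+t. indicator E (x + t *\<^sub>R v) \<partial>lborel) = 0"
    by (subst (asm) nn_integral_0_iff_AE) auto
  then show ?thesis
    by eventually_elim
      (subst (asm) nn_integral_0_iff_AE, auto elim!: eventually_mono simp: indicator_eq_0_iff)
qed

definition has_dir_deriv :: "('a::real_normed_vector \<Rightarrow> real) \<Rightarrow> real \<Rightarrow> 'a \<Rightarrow> 'a \<Rightarrow> bool" where
  "has_dir_deriv f D x v \<longleftrightarrow> ((\<lambda>t. (f (x + t *\<^sub>R v) - f x) / t) \<longlongrightarrow> D) (at 0)"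

lemma has_dir_deriv_zero: "has_dir_deriv f 0 x 0"
  by (simp add: has_dir_deriv_def)

lemma has_dir_deriv_scale:
  assumes "has_dir_deriv f D x v"
  shows "has_dir_deriv f (c * D) x (c *\<^sub>R v)"
proof (cases "c = 0")
  case True
  then show ?thesis using has_dir_deriv_zero by simp
next
  case False
  have "filterlim (\<lambda>t. t * c) (at 0) (at 0)"
    using False by (auto intro!: filterlim_atI tendsto_eq_intros simp: eventually_at_filter)
  from filterlim_compose[OF assms[unfolded has_dir_deriv_def] this]
  have "((\<lambda>t. c * ((f (x + (t * c) *\<^sub>R v) - f x) / (t * c))) \<longlongrightarrow> c * D) (at 0)"
    by (rule tendsto_mult_left)
  then show ?thesis using False by (simp add: has_dir_deriv_def)
qed

lemma has_dir_deriv_LIMSEQ: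
  assumes "has_dir_deriv f D x v"
  shows "(\<lambda>n. real (Suc n) * (f (x + inverse (real (Suc n)) *\<^sub>R v) - f x)) \<longlonglongrightarrow> D"
proof -
  have "filterlim (\<lambda>n. inverse (real (Suc n))) (at 0) sequentially"
    by (rule filterlim_atI[OF LIMSEQ_inverse_real_of_nat]) simp
  from filterlim_compose[OF assms[unfolded has_dir_deriv_def] this] show ?thesis
    by (simp add: field_simps)
qed

text \<open>The Cauchy condition for the difference quotients, for one precision \<open>n\<close> and one radius \<open>m\<close>. For continuous
  \<open>f\<close> it describes a closed set of points \<open>x\<close>, so that the set where the directional derivative exists is Borel.\<close>

definition dir_quotients_cauchy :: "('a::real_normed_vector \<Rightarrow> real) \<Rightarrow> 'a \<Rightarrow> 'a \<Rightarrow> nat \<Rightarrow> nat \<Rightarrow> bool" where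
  "dir_quotients_cauchy f v x n m \<longleftrightarrow> (\<forall>s t.
     0 < \<bar>s\<bar> \<and> \<bar>s\<bar> < inverse (real (Suc m)) \<and> 0 < \<bar>t\<bar> \<and> \<bar>t\<bar> < inverse (real (Suc m)) \<longrightarrow>
     \<bar>(f (x + s *\<^sub>R v) - f x) / s - (f (x + t *\<^sub>R v) - f x) / t\<bar> \<le> inverse (real (Suc n)))"

lemma has_dir_deriv_iff_cauchy:
  "(\<exists>D. has_dir_deriv f D x v) \<longleftrightarrow> (\<forall>n. \<exists>m. dir_quotients_cauchy f v x n m)"
proof -
  define q where "q = (\<lambda>t. (f (x + t *\<^sub>R v) - f x) / t)"
  have "(\<exists>D. has_dir_deriv f D x v) \<longleftrightarrow> (\<exists>D. filtermap q (at 0) \<le> nhds D)"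
    by (simp add: has_dir_deriv_def q_def filterlim_def)
  also have "\<dots> \<longleftrightarrow> cauchy_filter (filtermap q (at 0))"
    using complete_UNIV[where 'a = real] nhds_imp_cauchy_filter
    unfolding complete_uniform by (auto simp: filtermap_bot_iff)
  also have "\<dots> \<longleftrightarrow> (\<forall>e>0. \<exists>P. eventually P (at 0) \<and> (\<forall>s t. P s \<and> P t \<longrightarrow> dist (q s) (q t) < e))"
    by (rule cauchy_filter_metric_filtermap)
  also have "\<dots> \<longleftrightarrow> (\<forall>n. \<exists>m. dir_quotients_cauchy f v x n m)"
  proof (intro iffI allI impI)
    fix n :: nat
    assume *: "\<forall>e>0. \<exists>P. eventually P (at 0) \<and> (\<forall>s t. P s \<and> P t \<longrightarrow> dist (q s) (q t) < e)"
    obtain P where P: "eventually P (at 0)" "\<And>s t. P s \<Longrightarrow> P t \<Longrightarrow> dist (q s) (q t) < inverse (real (Suc n))"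
      using *[rule_format, of "inverse (real (Suc n))"] by auto
    obtain d where d: "d > 0" "\<And>t. t \<noteq> 0 \<Longrightarrow> \<bar>t\<bar> < d \<Longrightarrow> P t"
      using P(1) by (auto simp: eventually_at dist_real_def)
    obtain m where "inverse (real (Suc m)) < d" using reals_Archimedean d(1) by blast
    then have "dir_quotients_cauchy f v x n m"
      unfolding dir_quotients_cauchy_def q_def[symmetric]
      using d(2) P(2) by (force simp: dist_real_def q_def intro: less_imp_le)
    then show "\<exists>m. dir_quotients_cauchy f v x n m" ..
  next
    fix e :: real
    assume *: "\<forall>n. \<exists>m. dir_quotients_cauchy f v x n m" and "e > 0"
    obtain n where n: "inverse (real (Suc n)) < e" using reals_Archimedean \<open>e > 0\<close> by blast
    obtain m where m: "dir_quotients_cauchy f v x n m" using * by blast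
    define P where "P = (\<lambda>t. 0 < \<bar>t\<bar> \<and> \<bar>t\<bar> < inverse (real (Suc m)))"
    have "eventually P (at 0)"
      unfolding eventually_at P_def by (intro exI[of _ "inverse (real (Suc m))"]) (auto simp: dist_real_def)
    moreover have "dist (q s) (q t) < e" if "P s \<and> P t" for s t
      using m[unfolded dir_quotients_cauchy_def, rule_format, of s t] that n
      by (simp add: P_def q_def dist_real_def)
    ultimately show "\<exists>P. eventually P (at 0) \<and> (\<forall>s t. P s \<and> P t \<longrightarrow> dist (q s) (q t) < e)" by blast
  qed
  finally show ?thesis .
qed

lemma closed_dir_quotients_cauchy:
  assumes f: "continuous_on UNIV f"
  shows "closed {x. dir_quotients_cauchy f v x n m}"
proof -
  have shift: "continuous_on UNIV (\<lambda>x. f (x + s *\<^sub>R v))" for s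
    by (rule continuous_on_compose2[OF f]) (auto intro!: continuous_intros)
  have "closed {x. \<bar>(f (x + s *\<^sub>R v) - f x) / s - (f (x + t *\<^sub>R v) - f x) / t\<bar> \<le> c}" for s t c
    unfolding divide_inverse by (intro closed_Collect_le continuous_intros shift f)
  then show ?thesis
    unfolding dir_quotients_cauchy_def by (intro closed_Collect_all closed_Collect_imp) auto
qed

lemma lipschitz_along_line:
  fixes f :: "'a::real_normed_vector \<Rightarrow> real"
  assumes "L-lipschitz_on UNIV f"
  shows "(L * norm v)-lipschitz_on UNIV (\<lambda>t. f (x + t *\<^sub>R v))"
proof (rule lipschitz_onI)
  fix s t :: real
  have "dist (f (x + s *\<^sub>R v)) (f (x + t *\<^sub>R v)) \<le> L * dist (x + s *\<^sub>R v) (x + t *\<^sub>R v)"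
    by (rule lipschitz_onD[OF assms]) auto
  also have "dist (x + s *\<^sub>R v) (x + t *\<^sub>R v) = norm v * dist s t"
    by (simp add: dist_norm flip: scaleR_diff_left)
  finally show "dist (f (x + s *\<^sub>R v)) (f (x + t *\<^sub>R v)) \<le> L * norm v * dist s t"
    by (simp add: mult.assoc)
qed (use lipschitz_on_nonneg[OF assms] in simp)

text \<open>The exceptional set is Borel, and it meets each line parallel to \<open>v\<close> in a null set by the one-dimensional
  case.\<close>

lemma lipschitz_AE_dir_deriv:
  fixes f :: "'a::euclidean_space \<Rightarrow> real"
  assumes lip: "L-lipschitz_on UNIV f"
  shows "AE x in lborel. \<exists>D. has_dir_deriv f D x v"
proof -
  have [measurable]: "{x. dir_quotients_cauchy f v x n m} \<in> sets borel" for n m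
    using closed_dir_quotients_cauchy[OF lipschitz_on_continuous_on[OF lip]] by (rule borel_closed)
  define E where "E = {x \<in> space borel. \<not> (\<forall>n. \<exists>m. x \<in> {x. dir_quotients_cauchy f v x n m})}"
  have E: "E \<in> sets borel" unfolding E_def by measurable
  have E_iff: "x \<in> E \<longleftrightarrow> \<not> (\<exists>D. has_dir_deriv f D x v)" for x
    by (simp add: E_def has_dir_deriv_iff_cauchy)
  have "negligible {t. x + t *\<^sub>R v \<in> E}" for x
  proof -
    obtain h N where N: "negligible N" and
      "\<And>t. t \<notin> N \<Longrightarrow> ((\<lambda>s. (f (x + (t + s) *\<^sub>R v) - f (x + t *\<^sub>R v)) / s) \<longlongrightarrow> h t) (at 0)"
      by (rule lipschitz_real_ae_derivative[OF lipschitz_along_line[OF lip, of v x]]) (rule that)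
    then have "t \<in> N" if "x + t *\<^sub>R v \<in> E" for t
      using that by (auto simp: E_iff has_dir_deriv_def scaleR_add_left add.assoc)
    then show ?thesis
      by (auto intro: negligible_subset[OF N])
  qed
  then have "E \<in> null_sets lborel"
    by (rule null_set_if_null_on_lines[OF E])
  then show ?thesis
    by (rule AE_I') (auto simp: E_iff)
qed

section \<open>Rademacher's theorem\<close>

lemma AE_eq_0_if_integral_boxes_0:
  fixes h :: "'a::euclidean_space \<Rightarrow> real"
  assumes int: "\<And>a b. integrable lborel (\<lambda>x. indicator (cbox a b) x * h x)"
    and zero: "\<And>a b. (\<integral>x. indicator (cbox a b) x * h x \<partial>lborel) = 0"
  shows "AE x in lborel. h x = 0"
proof -
  have hi: "(h has_integral 0) (cbox a b)" for a b
  proof -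
    have "((\<lambda>x. indicator (cbox a b) x * h x) has_integral 0) UNIV"
      using has_integral_integral_lborel[OF int[of a b]] by (simp add: zero)
    moreover have "(\<lambda>x. indicator (cbox a b) x * h x) = (\<lambda>x. if x \<in> cbox a b then h x else 0)"
      by (auto simp: fun_eq_iff)
    ultimately show ?thesis
      by (simp add: has_integral_restrict_UNIV)
  qed
  then have "h integrable_on cbox a b" for a b
    by (auto simp: integrable_on_def)
  then obtain N where N: "negligible N"
    and lim: "\<And>x e. \<lbrakk>x \<notin> N; 0 < e\<rbrakk> \<Longrightarrow> \<exists>d>0. \<forall>s. 0 < s \<and> s < d \<longrightarrow>
        norm (integral (cbox x (x + s *\<^sub>R One)) h /\<^sub>R s ^ DIM('a) - h x) < e"
    using integrable_ccontinuous_explicit by blast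
  have "h x = 0" if x: "x \<notin> N" for x
  proof (rule ccontr)
    assume "h x \<noteq> 0"
    then obtain d where "d > 0" and d: "\<forall>s. 0 < s \<and> s < d \<longrightarrow>
        norm (integral (cbox x (x + s *\<^sub>R One)) h /\<^sub>R s ^ DIM('a) - h x) < norm (h x)"
      using lim[OF x, of "norm (h x)"] by (metis zero_less_norm_iff)
    then have "norm (integral (cbox x (x + (d / 2) *\<^sub>R One)) h /\<^sub>R (d / 2) ^ DIM('a) - h x) < norm (h x)"
      using d[rule_format, of "d / 2"] by linarith
    then show False unfolding integral_unique[OF hi] by simp
  qed
  then have "AE x in lebesgue. h x = 0"
    using N by (intro AE_I'[of N]) (auto simp: negligible_iff_null_sets)
  then show ?thesis
    by (simp add: AE_completion_iff)
qed

lemma integral_lborel_translate: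
  fixes k :: "'a::euclidean_space \<Rightarrow> real"
  assumes [measurable]: "k \<in> borel_measurable borel"
  shows "(\<integral>x. k (d + x) \<partial>lborel) = (\<integral>x. k x \<partial>lborel)"
proof -
  have "(\<integral>x. k x \<partial>lborel) = (\<integral>x. k x \<partial>distr lborel borel (\<lambda>x. d + x))"
    unfolding lborel_translate ..
  also have "\<dots> = (\<integral>x. k (d + x) \<partial>lborel)"
    by (rule integral_distr) auto
  finally show ?thesis ..
qed

lemma integrable_bounded_times_indicator_cbox:
  fixes k :: "'a::euclidean_space \<Rightarrow> real"
  assumes [measurable]: "k \<in> borel_measurable borel" and k: "\<And>x. \<bar>k x\<bar> \<le> B"
  shows "integrable lborel (\<lambda>x. indicator (cbox a b) x * k x)"
proof (rule Bochner_Integration.integrable_bound)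
  show "integrable lborel (\<lambda>x. B * indicator (cbox a b) x :: real)"
    by (intro integrable_mult_right integrable_real_indicator)
       (use emeasure_lborel_cbox_finite in auto)
  have "0 \<le> B" using k[of undefined] by simp
  then show "AE x in lborel. norm (indicator (cbox a b) x * k x) \<le> norm (B * indicator (cbox a b) x :: real)"
    using k by (auto simp: indicator_def)
qed simp

text \<open>The indicator functions converge off the boundary of the box.\<close>

lemma cbox_shift_L1:
  fixes w :: "nat \<Rightarrow> 'a::euclidean_space"
  assumes w: "w \<longlonglongrightarrow> 0"
  shows "(\<lambda>n. \<integral>x. \<bar>indicator (cbox a b) (x - w n) - indicator (cbox a b) x\<bar> \<partial>lborel) \<longlonglongrightarrow> (0::real)"
proof -
  obtain K where K: "\<And>n. norm (w n) \<le> K"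
    using Bseq_def convergent_imp_Bseq[of w] w by (metis convergent_def)
  define C where "C = {x + y | x y. x \<in> cbox a b \<and> y \<in> cball 0 K}"
  have "compact C"
    unfolding C_def by (intro compact_sums) auto
  then have C: "C \<in> sets borel" "emeasure lborel C < \<infinity>"
    using emeasure_bounded_finite[OF compact_imp_bounded] by (simp_all add: borel_compact)
  have inC: "x \<in> C" if "x - w n \<in> cbox a b" for x n
    unfolding C_def using that K[of n]
    by (intro CollectI exI[of _ "x - w n"] exI[of _ "w n"]) auto
  have boxC: "x \<in> C" if "x \<in> cbox a b" for x
  proof -
    have "0 \<le> K" using K[of 0] norm_ge_zero[of "w 0"] by linarith
    then show ?thesis
      unfolding C_def using that by (intro CollectI exI[of _ x] exI[of _ 0]) auto
  qed
  have "(\<lambda>n. \<integral>x. \<bar>indicator (cbox a b) (x - w n) - indicator (cbox a b) x\<bar> \<partial>lborel)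
      \<longlonglongrightarrow> (\<integral>x. (0::real) \<partial>(lborel :: 'a measure))"
  proof (rule integral_dominated_convergence[where w = "indicator C"])
    show "integrable lborel (indicator C :: 'a \<Rightarrow> real)"
      using C by (intro integrable_real_indicator) auto
    have "frontier (cbox a b) \<in> null_sets lebesgue"
      using negligible_convex_frontier[OF convex_box(1)] by (simp add: negligible_iff_null_sets)
    then have "AE x in lebesgue. x \<notin> frontier (cbox a b)"
      by (rule AE_not_in)
    then have "AE x in lborel. x \<notin> frontier (cbox a b)"
      by (simp add: AE_completion_iff)
    then show "AE x in lborel. (\<lambda>n. \<bar>indicator (cbox a b) (x - w n) - indicator (cbox a b) x\<bar>) \<longlonglongrightarrow> (0::real)"
    proof eventually_elim
      case (elim x)
      have x: "(\<lambda>n. x - w n) \<longlonglongrightarrow> x"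
        using tendsto_diff[OF tendsto_const w, of x] by simp
      have "\<forall>\<^sub>F n in sequentially. indicator (cbox a b) (x - w n) = (indicator (cbox a b) x :: real)"
      proof (cases "x \<in> cbox a b")
        case True
        then have "x \<in> interior (cbox a b)"
          using elim by (simp add: frontier_def)
        from topological_tendstoD[OF x open_interior this]
        show ?thesis
          by eventually_elim (use True interior_subset[of "cbox a b"] in \<open>auto simp del: interior_cbox\<close>)
      next
        case False
        then have "\<forall>\<^sub>F n in sequentially. x - w n \<in> - cbox a b"
          using topological_tendstoD[OF x, of "- cbox a b"] by (simp add: open_Compl closed_cbox)
        then show ?thesis
          by eventually_elim (use False in auto)
      qed
      then show ?case
        by (intro tendsto_eventually) (auto elim: eventually_mono)
    qed
    show "AE x in lborel. norm \<bar>indicator (cbox a b) (x - w n) - indicator (cbox a b) x :: real\<bar>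
        \<le> indicator C x" for n
      using inC[of _ n] boxC by (auto simp: indicator_def)
  qed auto
  then show ?thesis by simp
qed

text \<open>The difference quotient along \<open>u + v\<close> minus those along \<open>u\<close> and \<open>v\<close> is the increment, under a shift by
  \<open>u / n\<close>, of the bounded difference quotient along \<open>v\<close>. Its integral over a box is therefore an integral over the
  symmetric difference of the box and a shifted copy, and it tends to zero. So the limit function
  \<open>D\<^sub>u\<^sub>+\<^sub>v - D\<^sub>u - D\<^sub>v\<close> integrates to zero over all boxes.\<close>

lemma AE_dir_deriv_add:
  fixes f :: "'a::euclidean_space \<Rightarrow> real"
  assumes lip: "L-lipschitz_on UNIV f"
  shows "AE x in lborel. \<forall>D E. has_dir_deriv f D x u \<longrightarrow> has_dir_deriv f E x v \<longrightarrow>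
    has_dir_deriv f (D + E) x (u + v)"
proof -
  have lip': "\<bar>f y - f z\<bar> \<le> L * norm (y - z)" for y z
    using lipschitz_onD[OF lip, of y z] by (simp add: dist_real_def dist_norm)
  have L: "0 \<le> L" using lip by (rule lipschitz_on_nonneg)
  have "continuous_on UNIV f"
    using lip by (rule lipschitz_on_continuous_on)
  then have [measurable]: "f \<in> borel_measurable borel"
    by (rule borel_measurable_continuous_onI)
  define r where "r = (\<lambda>n. inverse (real (Suc n)))"
  have r: "r n > 0" "real (Suc n) * r n = 1" "r n * real (Suc n) = 1" for n
    by (simp_all add: r_def)
  define k where "k = (\<lambda>n x. real (Suc n) * (f (x + r n *\<^sub>R v) - f x))"
  have k_meas [measurable]: "k n \<in> borel_measurable borel" for n
    unfolding k_def by measurable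
  have k_bound: "\<bar>k n x\<bar> \<le> L * norm v" for n x
  proof -
    have "\<bar>k n x\<bar> \<le> real (Suc n) * (L * norm (r n *\<^sub>R v))"
      unfolding k_def abs_mult using lip'[of "x + r n *\<^sub>R v" x] by (simp add: mult_left_mono del: of_nat_Suc)
    also have "\<dots> = (real (Suc n) * r n) * (L * norm v)"
      using r(1)[of n] by simp
    also have "\<dots> = L * norm v" by (simp only: r mult_1)
    finally show ?thesis .
  qed
  define h where "h = (\<lambda>n x. k n (r n *\<^sub>R u + x) - k n x)"
  have h_meas [measurable]: "h n \<in> borel_measurable borel" for n
    unfolding h_def by measurable
  have h_bound: "\<bar>h n x\<bar> \<le> 2 * (L * norm v)" for n x
    unfolding h_def using k_bound[of n x] k_bound[of n "r n *\<^sub>R u + x"] by linarith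
  define H where "H = (\<lambda>x. lim (\<lambda>n. h n x))"
  have H_meas [measurable]: "H \<in> borel_measurable borel"
    unfolding H_def by measurable
  \<comment> \<open>\<open>h n\<close> is the quotient along \<open>u + v\<close> minus those along \<open>u\<close> and along \<open>v\<close>.\<close>
  have h_lim: "(\<lambda>n. h n x) \<longlonglongrightarrow> W - D - E"
    if "has_dir_deriv f D x u" "has_dir_deriv f E x v" "has_dir_deriv f W x (u + v)" for x D E W
  proof -
    have "(\<lambda>n. real (Suc n) * (f (x + r n *\<^sub>R (u + v)) - f x) - real (Suc n) * (f (x + r n *\<^sub>R u) - f x)
        - real (Suc n) * (f (x + r n *\<^sub>R v) - f x)) \<longlonglongrightarrow> W - D - E"
      unfolding r_def using that by (intro tendsto_diff has_dir_deriv_LIMSEQ)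
    moreover have "real (Suc n) * (f (x + r n *\<^sub>R (u + v)) - f x) - real (Suc n) * (f (x + r n *\<^sub>R u) - f x)
        - real (Suc n) * (f (x + r n *\<^sub>R v) - f x) = h n x" for n
      unfolding h_def k_def by (simp add: algebra_simps)
    ultimately show ?thesis by simp
  qed
  have "AE x in lborel. \<exists>D. has_dir_deriv f D x u" "AE x in lborel. \<exists>D. has_dir_deriv f D x v"
    "AE x in lborel. \<exists>D. has_dir_deriv f D x (u + v)"
    using lip by (intro lipschitz_AE_dir_deriv; assumption)+
  then have ex: "AE x in lborel. \<exists>W D E. has_dir_deriv f D x u \<and> has_dir_deriv f E x v \<and>
      has_dir_deriv f W x (u + v)"
    by eventually_elim blast
  then have conv: "AE x in lborel. (\<lambda>n. h n x) \<longlonglongrightarrow> H x"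
    by eventually_elim (metis H_def h_lim limI)
  have dom: "integrable lborel (\<lambda>x. indicator (cbox a b) x * (2 * (L * norm v)))"
    "AE x in lborel. (\<lambda>n. indicator (cbox a b) x * h n x) \<longlonglongrightarrow> indicator (cbox a b) x * H x"
    "\<And>n. AE x in lborel. norm (indicator (cbox a b) x * h n x) \<le> indicator (cbox a b) x * (2 * (L * norm v))"
    for a b
  proof -
    show "integrable lborel (\<lambda>x. indicator (cbox a b) x * (2 * (L * norm v)))"
      using L by (intro integrable_bounded_times_indicator_cbox[where B = "2 * (L * norm v)"]) auto
    show "AE x in lborel. (\<lambda>n. indicator (cbox a b) x * h n x) \<longlonglongrightarrow> indicator (cbox a b) x * H x"
      using conv by eventually_elim (intro tendsto_intros)
    show "AE x in lborel. norm (indicator (cbox a b) x * h n x) \<le> indicator (cbox a b) x * (2 * (L * norm v))" for n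
      using h_bound by (auto simp: indicator_def)
  qed
  have "(\<integral>x. indicator (cbox a b) x * H x \<partial>lborel) = 0" for a b
  proof -
    have "(\<lambda>n. \<integral>x. indicator (cbox a b) x * h n x \<partial>lborel)
        \<longlonglongrightarrow> (\<integral>x. indicator (cbox a b) x * H x \<partial>lborel)"
      by (rule integral_dominated_convergence[OF _ _ dom]) auto
    moreover have "(\<lambda>n. \<integral>x. indicator (cbox a b) x * h n x \<partial>lborel) \<longlonglongrightarrow> 0"
    proof (rule Lim_null_comparison)
      define \<delta> where "\<delta> = (\<lambda>n x. indicator (cbox a b) (x - r n *\<^sub>R u) - indicator (cbox a b) x :: real)"
      have "norm (\<integral>x. indicator (cbox a b) x * h n x \<partial>lborel) \<le> (L * norm v) * (\<integral>x. \<bar>\<delta> n x\<bar> \<partial>lborel)" for n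
      proof -
        have int: "integrable lborel (\<lambda>x. indicator (cbox c d) x * k m x)" for c d m
          using k_bound by (intro integrable_bounded_times_indicator_cbox) auto
        have shift: "indicator (cbox a b) (x - r n *\<^sub>R u)
            = (indicator (cbox (a + r n *\<^sub>R u) (b + r n *\<^sub>R u)) x :: real)" for x
          by (auto simp: indicator_def mem_box algebra_simps)
        have "(\<integral>x. indicator (cbox a b) x * k n (r n *\<^sub>R u + x) \<partial>lborel)
            = (\<integral>x. indicator (cbox a b) ((r n *\<^sub>R u + x) - r n *\<^sub>R u) * k n (r n *\<^sub>R u + x) \<partial>lborel)"
          by simp
        also have "\<dots> = (\<integral>x. indicator (cbox a b) (x - r n *\<^sub>R u) * k n x \<partial>lborel)"
          by (rule integral_lborel_translate) measurable
        finally have 1: "(\<integral>x. indicator (cbox a b) x * k n (r n *\<^sub>R u + x) \<partial>lborel)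
            = (\<integral>x. indicator (cbox a b) (x - r n *\<^sub>R u) * k n x \<partial>lborel)" .
        have 2: "integrable lborel (\<lambda>x. indicator (cbox a b) x * k n (r n *\<^sub>R u + x))"
          using k_bound by (intro integrable_bounded_times_indicator_cbox) auto
        have "(\<integral>x. indicator (cbox a b) x * h n x \<partial>lborel)
            = (\<integral>x. \<delta> n x * k n x \<partial>lborel)"
          unfolding h_def \<delta>_def right_diff_distrib left_diff_distrib
          using int[of a b n] int[of "a + r n *\<^sub>R u" "b + r n *\<^sub>R u" n] 2
          by (simp add: 1 shift)
        also have "norm \<dots> \<le> (\<integral>x. (L * norm v) * \<bar>\<delta> n x\<bar> \<partial>lborel)"
        proof (rule Bochner_Integration.integral_norm_bound_integral)
          have \<delta>_int: "integrable lborel (\<delta> n)"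
            unfolding \<delta>_def shift
            by (intro Bochner_Integration.integrable_diff integrable_real_indicator)
               (use emeasure_lborel_cbox_finite in auto)
          then show "integrable lborel (\<lambda>x. (L * norm v) * \<bar>\<delta> n x\<bar>)" by simp
          have "integrable lborel (\<lambda>x. indicator (cbox (a + r n *\<^sub>R u) (b + r n *\<^sub>R u)) x * k n x
              - indicator (cbox a b) x * k n x)"
            by (intro Bochner_Integration.integrable_diff int)
          then show "integrable lborel (\<lambda>x. \<delta> n x * k n x)"
            unfolding \<delta>_def shift left_diff_distrib .
          show "norm (\<delta> n x * k n x) \<le> L * norm v * \<bar>\<delta> n x\<bar>" for x
            using mult_left_mono[OF k_bound[of n x], of "\<bar>\<delta> n x\<bar>"] by (simp add: abs_mult mult_ac)
        qed
        finally show ?thesis by simp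
      qed
      then show "\<forall>\<^sub>F n in sequentially. norm (\<integral>x. indicator (cbox a b) x * h n x \<partial>lborel)
          \<le> (L * norm v) * (\<integral>x. \<bar>\<delta> n x\<bar> \<partial>lborel)" by simp
      have "(\<lambda>n. r n *\<^sub>R u) \<longlonglongrightarrow> 0 *\<^sub>R u"
        unfolding r_def by (intro tendsto_intros LIMSEQ_inverse_real_of_nat)
      then have "(\<lambda>n. r n *\<^sub>R u) \<longlonglongrightarrow> 0" by simp
      from tendsto_mult_left[OF cbox_shift_L1[OF this], of "L * norm v"]
      show "(\<lambda>n. (L * norm v) * (\<integral>x. \<bar>\<delta> n x\<bar> \<partial>lborel)) \<longlonglongrightarrow> 0"
        by (simp add: \<delta>_def)
    qed
    ultimately show ?thesis by (rule LIMSEQ_unique)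
  qed
  moreover have "integrable lborel (\<lambda>x. indicator (cbox a b) x * H x)" for a b
    by (rule integrable_dominated_convergence[OF _ _ dom]) auto
  ultimately have "AE x in lborel. H x = 0"
    by (rule AE_eq_0_if_integral_boxes_0[rotated])
  with conv ex show ?thesis
  proof eventually_elim
    case (elim x)
    then obtain W D E where WDE: "has_dir_deriv f D x u" "has_dir_deriv f E x v"
      "has_dir_deriv f W x (u + v)" by blast
    have "W - D - E = 0"
      using LIMSEQ_unique[OF h_lim[OF WDE]] elim by auto
    moreover have "D' = D" if "has_dir_deriv f D' x u" for D'
      using that WDE(1) unfolding has_dir_deriv_def by (rule tendsto_unique[rotated]) simp
    moreover have "E' = E" if "has_dir_deriv f E' x v" for E'
      using that WDE(2) unfolding has_dir_deriv_def by (rule tendsto_unique[rotated]) simp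
    ultimately show ?case using WDE(3) by (auto simp: algebra_simps)
  qed
qed

lemma AE_dir_deriv_linear:
  fixes f :: "'a::euclidean_space \<Rightarrow> real"
  assumes lip: "L-lipschitz_on UNIV f"
  shows "AE x in lborel. \<forall>G. (\<forall>b\<in>Basis. has_dir_deriv f (b \<bullet> G) x b) \<longrightarrow> has_dir_deriv f (v \<bullet> G) x v"
proof -
  have "AE x in lborel. \<forall>G. (\<forall>b\<in>Basis. has_dir_deriv f (b \<bullet> G) x b) \<longrightarrow>
      has_dir_deriv f ((\<Sum>b\<in>B. (v \<bullet> b) *\<^sub>R b) \<bullet> G) x (\<Sum>b\<in>B. (v \<bullet> b) *\<^sub>R b)"
    if "finite B" "B \<subseteq> Basis" for B
    using that
  proof (induction B rule: finite_induct)
    case empty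
    then show ?case by (simp add: has_dir_deriv_zero)
  next
    case (insert c B)
    then have "AE x in lborel. \<forall>G. (\<forall>b\<in>Basis. has_dir_deriv f (b \<bullet> G) x b) \<longrightarrow>
        has_dir_deriv f ((\<Sum>b\<in>B. (v \<bullet> b) *\<^sub>R b) \<bullet> G) x (\<Sum>b\<in>B. (v \<bullet> b) *\<^sub>R b)"
      by simp
    with AE_dir_deriv_add[OF lip, of "(v \<bullet> c) *\<^sub>R c" "\<Sum>b\<in>B. (v \<bullet> b) *\<^sub>R b"]
    show ?case
    proof eventually_elim
      case (elim x)
      show ?case
      proof (intro allI impI)
        fix G assume G: "\<forall>b\<in>Basis. has_dir_deriv f (b \<bullet> G) x b"
        then have "has_dir_deriv f ((v \<bullet> c) * (c \<bullet> G)) x ((v \<bullet> c) *\<^sub>R c)"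
          using insert.prems by (intro has_dir_deriv_scale) auto
        with elim G show "has_dir_deriv f ((\<Sum>b\<in>insert c B. (v \<bullet> b) *\<^sub>R b) \<bullet> G) x
            (\<Sum>b\<in>insert c B. (v \<bullet> b) *\<^sub>R b)"
          using insert.hyps by (simp add: inner_add_left)
      qed
    qed
  qed
  from this[of Basis] show ?thesis
    by (simp add: euclidean_representation)
qed

text \<open>Finitely many of the given directions approximate the whole sphere, and the Lipschitz bound transfers the
  convergence of the difference quotients from them to all directions at a uniform rate.\<close>

lemma gderiv_if_dense_dir_deriv:
  fixes f :: "'a::euclidean_space \<Rightarrow> real"
  assumes lip: "L-lipschitz_on UNIV f"
    and dense: "\<And>X. open X \<Longrightarrow> X \<noteq> {} \<Longrightarrow> \<exists>d\<in>D. d \<in> X"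
    and dir: "\<And>v. v \<in> D \<Longrightarrow> has_dir_deriv f (v \<bullet> G) x v"
  shows "GDERIV f x :> G"
  unfolding gderiv_def has_derivative_at_alt
proof (intro conjI allI impI)
  show "bounded_linear (\<lambda>h. h \<bullet> G)" by (rule bounded_linear_inner_left)
  fix e :: real assume "e > 0"
  have L: "0 \<le> L" using lip by (rule lipschitz_on_nonneg)
  define \<epsilon> where "\<epsilon> = e / (L + norm G + 1)"
  have M: "L + norm G + 1 > 0" using L norm_ge_zero[of G] by linarith
  have \<epsilon>: "\<epsilon> > 0" using \<open>e > 0\<close> M by (simp add: \<epsilon>_def)
  have "sphere (0::'a) 1 \<subseteq> (\<Union>q\<in>D. ball q \<epsilon>)"
  proof
    fix v :: 'a
    obtain q where "q \<in> D" "q \<in> ball v \<epsilon>" using dense[of "ball v \<epsilon>"] \<epsilon> by auto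
    then show "v \<in> (\<Union>q\<in>D. ball q \<epsilon>)" by (auto simp: dist_commute)
  qed
  then obtain Q where Q: "Q \<subseteq> D" "finite Q" "sphere (0::'a) 1 \<subseteq> (\<Union>q\<in>Q. ball q \<epsilon>)"
    by (rule compactE_image[OF compact_sphere, rotated]) auto
  have "\<forall>q\<in>Q. \<forall>\<^sub>F t in at 0. \<bar>(f (x + t *\<^sub>R q) - f x) / t - q \<bullet> G\<bar> < \<epsilon>"
    using dir Q(1) \<epsilon> by (auto simp: has_dir_deriv_def tendsto_iff dist_real_def)
  then have "\<forall>\<^sub>F t in at 0. \<forall>q\<in>Q. \<bar>(f (x + t *\<^sub>R q) - f x) / t - q \<bullet> G\<bar> < \<epsilon>"
    using Q(2) by (rule eventually_ball_finite[rotated])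
  then obtain d where d: "d > 0"
    and close: "\<And>t q. t \<noteq> 0 \<Longrightarrow> \<bar>t\<bar> < d \<Longrightarrow> q \<in> Q \<Longrightarrow> \<bar>(f (x + t *\<^sub>R q) - f x) / t - q \<bullet> G\<bar> < \<epsilon>"
    by (auto simp: eventually_at dist_real_def)
  have "norm (f y - f x - (y - x) \<bullet> G) \<le> e * norm (y - x)" if y: "norm (y - x) < d" for y
  proof (cases "y = x")
    case False
    define t where "t = norm (y - x)"
    have t: "t > 0" "t < d" using False y by (simp_all add: t_def)
    define v where "v = (1 / t) *\<^sub>R (y - x)"
    have "norm v = 1" and y_eq: "y = x + t *\<^sub>R v" using t by (simp_all add: v_def t_def)
    then obtain q where q: "q \<in> Q" "norm (v - q) < \<epsilon>"
      using Q(3) by (force simp: dist_norm norm_minus_commute)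
    have 1: "\<bar>f (x + t *\<^sub>R v) - f (x + t *\<^sub>R q)\<bar> \<le> t * (L * \<epsilon>)"
    proof -
      have "\<bar>f (x + t *\<^sub>R v) - f (x + t *\<^sub>R q)\<bar> \<le> L * (t * norm (v - q))"
        using lipschitz_onD[OF lip, of "x + t *\<^sub>R v" "x + t *\<^sub>R q"] t
        by (simp add: dist_norm flip: scaleR_diff_right)
      also have "\<dots> \<le> L * (t * \<epsilon>)" using q t L by (intro mult_left_mono) auto
      finally show ?thesis by (simp add: mult_ac)
    qed
    have 2: "\<bar>f (x + t *\<^sub>R q) - f x - t * (q \<bullet> G)\<bar> \<le> t * \<epsilon>"
    proof -
      have "f (x + t *\<^sub>R q) - f x - t * (q \<bullet> G) = t * ((f (x + t *\<^sub>R q) - f x) / t - q \<bullet> G)"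
        using t by (simp add: field_simps)
      also have "\<bar>\<dots>\<bar> = t * \<bar>(f (x + t *\<^sub>R q) - f x) / t - q \<bullet> G\<bar>"
        using t by (simp add: abs_mult)
      also have "\<dots> \<le> t * \<epsilon>"
        using close[of t q] t q by (intro mult_left_mono) auto
      finally show ?thesis .
    qed
    have 3: "\<bar>t * (q \<bullet> G) - t * (v \<bullet> G)\<bar> \<le> t * (\<epsilon> * norm G)"
    proof -
      have "\<bar>t * (q \<bullet> G) - t * (v \<bullet> G)\<bar> = t * \<bar>(v - q) \<bullet> G\<bar>"
        using t by (simp add: inner_diff_left abs_mult abs_minus_commute flip: right_diff_distrib)
      also have "\<dots> \<le> t * (norm (v - q) * norm G)"
        using t by (intro mult_left_mono Cauchy_Schwarz_ineq2) auto
      also have "\<dots> \<le> t * (\<epsilon> * norm G)"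
        using t q by (intro mult_left_mono mult_right_mono) auto
      finally show ?thesis .
    qed
    have "norm (f y - f x - (y - x) \<bullet> G) \<le> t * (L * \<epsilon>) + t * \<epsilon> + t * (\<epsilon> * norm G)"
      using 1 2 3 by (simp add: y_eq)
    also have "\<dots> = t * ((L + norm G + 1) * \<epsilon>)" by (simp add: algebra_simps)
    also have "(L + norm G + 1) * \<epsilon> = e" using M by (simp add: \<epsilon>_def)
    finally show ?thesis by (simp add: t_def mult.commute)
  qed auto
  with d show "\<exists>d>0. \<forall>y. norm (y - x) < d \<longrightarrow> norm (f y - f x - (y - x) \<bullet> G) \<le> e * norm (y - x)"
    by blast
qed

text \<open>Each direction has its own exceptional null set; for a countable dense set of directions their union is
  still null.\<close>

theorem rademacher:
  fixes f :: "'a::euclidean_space \<Rightarrow> real"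
  assumes lip: "L-lipschitz_on UNIV f"
  shows "AE x in lborel. \<exists>G. GDERIV f x :> G"
proof -
  obtain D :: "'a set" where "countable D"
    and dense: "\<And>X. open X \<Longrightarrow> X \<noteq> {} \<Longrightarrow> \<exists>d\<in>D. d \<in> X"
    using countable_dense_exists by blast
  have "AE x in lborel. \<forall>b\<in>Basis. \<exists>c. has_dir_deriv f c x b"
    using lipschitz_AE_dir_deriv[OF lip] by (subst AE_ball_countable) (auto simp: countable_finite)
  moreover have "AE x in lborel. \<forall>v\<in>D. \<forall>G. (\<forall>b\<in>Basis. has_dir_deriv f (b \<bullet> G) x b) \<longrightarrow>
      has_dir_deriv f (v \<bullet> G) x v"
    using AE_dir_deriv_linear[OF lip] \<open>countable D\<close> by (subst AE_ball_countable) auto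
  ultimately show ?thesis
  proof eventually_elim
    case (elim x)
    then obtain c where c: "\<And>b. b \<in> Basis \<Longrightarrow> has_dir_deriv f (c b) x b"
      by metis
    have "b \<bullet> (\<Sum>b\<in>Basis. c b *\<^sub>R b) = c b" if "b \<in> Basis" for b
      using that by (simp add: inner_commute[of b])
    then have "has_dir_deriv f (v \<bullet> (\<Sum>b\<in>Basis. c b *\<^sub>R b)) x v" if "v \<in> D" for v
      using elim c that by auto
    with gderiv_if_dense_dir_deriv[OF lip dense] show ?case by blast
  qed
qed

section \<open>Increments of Lipschitz functions\<close>

text \<open>The extension of McShane.\<close>

lemma lipschitz_extension:
  fixes f :: "'a::metric_space \<Rightarrow> real"
  assumes lip: "L-lipschitz_on W f"
  obtains F where "L-lipschitz_on UNIV F" "\<And>x. x \<in> W \<Longrightarrow> F x = f x"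
proof (cases "W = {}")
  case True
  moreover have "L-lipschitz_on UNIV (\<lambda>_::'a. 0::real)"
    using lipschitz_on_nonneg[OF lip] by (auto intro!: lipschitz_onI)
  ultimately show ?thesis
    using that[of "\<lambda>_. 0"] by simp
next
  case False
  have L: "0 \<le> L" using lip by (rule lipschitz_on_nonneg)
  define F where "F = (\<lambda>x. INF y\<in>W. f y + L * dist x y)"
  have le: "f z - L * dist x z \<le> f y + L * dist x y" if "y \<in> W" "z \<in> W" for x y z
  proof -
    have "f z - f y \<le> L * dist z y"
      using lipschitz_onD[OF lip that(2,1)] by (simp add: dist_real_def)
    also have "\<dots> \<le> L * (dist x z + dist x y)"
      by (intro mult_left_mono L dist_triangle3)
    finally show ?thesis by (simp add: algebra_simps)
  qed
  then have bdd: "bdd_below ((\<lambda>y. f y + L * dist x y) ` W)" for x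
    using False by (metis (no_types, lifting) bdd_belowI2 ex_in_conv)
  have step: "F x \<le> F x' + L * dist x x'" for x x'
  proof -
    have "F x - L * dist x x' \<le> f y + L * dist x' y" if "y \<in> W" for y
    proof -
      have "F x \<le> f y + L * dist x y"
        unfolding F_def by (rule cINF_lower[OF bdd that])
      also have "L * dist x y \<le> L * (dist x x' + dist x' y)"
        by (intro mult_left_mono L dist_triangle)
      finally show ?thesis by (simp add: algebra_simps)
    qed
    then have "F x - L * dist x x' \<le> F x'"
      unfolding F_def[of] by (intro cINF_greatest False) (auto simp: F_def)
    then show ?thesis by simp
  qed
  have "L-lipschitz_on UNIV F"
  proof (rule lipschitz_onI)
    fix x y
    show "dist (F x) (F y) \<le> L * dist x y"
      using step[of x y] step[of y x] by (simp add: dist_real_def dist_commute abs_le_iff)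
  qed (rule L)
  moreover have "F x = f x" if "x \<in> W" for x
  proof (rule antisym)
    show "F x \<le> f x" unfolding F_def using cINF_lower[OF bdd that, of x] by simp
    show "f x \<le> F x" unfolding F_def
      using le[OF _ that, of _ x] by (intro cINF_greatest False) auto
  qed
  ultimately show thesis by (rule that)
qed

lemma gderiv_cong_open:
  assumes "open W" "x \<in> W" "\<And>y. y \<in> W \<Longrightarrow> f y = g y"
  shows "GDERIV f x :> G \<longleftrightarrow> GDERIV g x :> G"
  unfolding gderiv_def
  using has_derivative_transform_within_open[OF _ assms(1,2), of f _ UNIV g]
    has_derivative_transform_within_open[OF _ assms(1,2), of g _ UNIV f] assms(3) by auto

lemma AE_lborelE:
  assumes "AE x in lborel. P x"
  obtains N where "\<And>x. x \<notin> N \<Longrightarrow> P x" "N \<in> null_sets lborel"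
  by (rule AE_E3[OF assms]) (rule that; simp)

lemma lipschitz_gderiv_dense:
  fixes f :: "'a::euclidean_space \<Rightarrow> real"
  assumes lip: "L-lipschitz_on W f" and W: "open W" "W \<noteq> {}"
  shows "\<exists>z\<in>W. \<exists>G. GDERIV f z :> G"
proof -
  obtain F where F: "L-lipschitz_on UNIV F" "\<And>x. x \<in> W \<Longrightarrow> F x = f x"
    using lipschitz_extension[OF lip] by blast
  obtain N where N: "\<And>x. x \<notin> N \<Longrightarrow> \<exists>G. GDERIV F x :> G" "N \<in> null_sets lborel"
    by (rule AE_lborelE[OF rademacher[OF F(1)]]) (rule that)
  have "\<not> W \<subseteq> N"
  proof
    assume "W \<subseteq> N"
    moreover have "negligible N"
      using N(2) by (simp add: negligible_iff_null_sets null_sets_completionI)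
    ultimately show False
      using open_not_negligible[OF W] negligible_subset by blast
  qed
  then obtain z where "z \<in> W" "z \<notin> N" by blast
  with N(1) gderiv_cong_open[where f = F and g = f, OF W(1) \<open>z \<in> W\<close> F(2)] show ?thesis by blast
qed

text \<open>The points of non-differentiability form a null set, so for almost every \<open>a\<close> near \<open>x\<close> the segment from \<open>a\<close> to
  \<open>a + (y - x)\<close> meets it in a null set. On such a segment \<open>f\<close> is the integral of its derivative, which is at most \<open>c\<close>.\<close>

theorem lipschitz_increment_le:
  fixes f :: "'a::euclidean_space \<Rightarrow> real"
  assumes lip: "L-lipschitz_on W f" and W: "open W" "convex W" "x \<in> W" "y \<in> W"
    and grad: "\<And>z G. z \<in> W \<Longrightarrow> GDERIV f z :> G \<Longrightarrow> G \<bullet> (y - x) \<le> c"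
  shows "f y - f x \<le> c"
proof -
  define v where "v = y - x"
  obtain F where F: "L-lipschitz_on UNIV F" "\<And>x. x \<in> W \<Longrightarrow> F x = f x"
    using lipschitz_extension[OF lip] by blast
  have contF: "continuous_on UNIV F" using F(1) by (rule lipschitz_on_continuous_on)
  obtain N where N: "\<And>x. x \<notin> N \<Longrightarrow> \<exists>G. GDERIV F x :> G" "N \<in> null_sets lborel"
    by (rule AE_lborelE[OF rademacher[OF F(1)]]) (rule that)
  obtain A where A: "\<And>a. a \<notin> A \<Longrightarrow> AE t in lborel. a + t *\<^sub>R v \<notin> N" "A \<in> null_sets lborel"
    by (rule AE_lborelE[OF AE_null_on_lines[OF N(2), of v]]) (rule that)
  have A_negl: "negligible A"
    using A(2) by (simp add: negligible_iff_null_sets null_sets_completionI)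
  have shifted: "F (a + v) - F a \<le> c" if a: "a \<notin> A" "a \<in> W" "a + v \<in> W" for a
  proof -
    obtain h M where M: "negligible M"
      and der: "\<And>t. t \<notin> M \<Longrightarrow> ((\<lambda>s. (F (a + (t + s) *\<^sub>R v) - F (a + t *\<^sub>R v)) / s) \<longlongrightarrow> h t) (at 0)"
      and int: "\<And>s t. s \<le> t \<Longrightarrow> (h has_integral (F (a + t *\<^sub>R v) - F (a + s *\<^sub>R v))) {s..t}"
      by (rule lipschitz_real_ae_derivative[OF lipschitz_along_line[OF F(1), of v a]]) (rule that)
    obtain K where K: "\<And>t. t \<notin> K \<Longrightarrow> a + t *\<^sub>R v \<notin> N" "K \<in> null_sets lborel"
      by (rule AE_lborelE[OF A(1)[OF a(1)]]) (rule that)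
    have K_negl: "negligible K"
      using K(2) by (simp add: negligible_iff_null_sets null_sets_completionI)
    have h_le: "h t \<le> c" if t: "t \<in> {0..1}" "t \<notin> M" "t \<notin> K" for t
    proof -
      define z where "z = a + t *\<^sub>R v"
      have "z = (1 - t) *\<^sub>R a + t *\<^sub>R (a + v)" by (simp add: z_def algebra_simps)
      then have z: "z \<in> W" using W(2) a t by (simp add: convex_alt)
      obtain G where G: "GDERIV F z :> G"
        using N(1) K(1)[OF t(3)] by (auto simp: z_def)
      have "((\<lambda>s. F (z + s *\<^sub>R v)) has_derivative (\<lambda>s. (s *\<^sub>R v) \<bullet> G)) (at 0)"
      proof (rule has_derivative_compose[of "\<lambda>s. z + s *\<^sub>R v" _ 0 UNIV F "\<lambda>h. h \<bullet> G"])
        show "((\<lambda>s. z + s *\<^sub>R v) has_derivative (\<lambda>s. s *\<^sub>R v)) (at 0)"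
          by (auto intro!: derivative_eq_intros)
      qed (use G in \<open>simp add: gderiv_def\<close>)
      then have "((\<lambda>s. F (z + s *\<^sub>R v)) has_field_derivative (v \<bullet> G)) (at 0)"
        by (simp add: has_field_derivative_def mult.commute[of _ "v \<bullet> G"] mult_commute_abs)
      then have "((\<lambda>s. (F (z + s *\<^sub>R v) - F z) / s) \<longlongrightarrow> v \<bullet> G) (at 0)"
        by (simp add: DERIV_def)
      moreover have "((\<lambda>s. (F (z + s *\<^sub>R v) - F z) / s) \<longlongrightarrow> h t) (at 0)"
        using der[OF t(2)] by (simp add: z_def algebra_simps)
      ultimately have "h t = v \<bullet> G"
        using LIM_unique by blast
      moreover have "GDERIV f z :> G"
        using G gderiv_cong_open[where f = F and g = f, OF W(1) z F(2)] by simp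
      ultimately show ?thesis
        using grad[OF z] by (simp add: v_def inner_commute)
    qed
    define h' where "h' = (\<lambda>t. if t \<in> M \<union> K then c else h t)"
    have "(h' has_integral (F (a + 1 *\<^sub>R v) - F (a + 0 *\<^sub>R v))) {0..1}"
      by (rule has_integral_spike[OF negligible_Un[OF M K_negl] _ int]) (auto simp: h'_def)
    moreover have "((\<lambda>_. c) has_integral c) {0..1::real}"
      using has_integral_const_real[of c 0 1] by simp
    ultimately have "F (a + 1 *\<^sub>R v) - F (a + 0 *\<^sub>R v) \<le> c"
      by (rule has_integral_le) (use h_le in \<open>auto simp: h'_def\<close>)
    then show ?thesis by simp
  qed
  have "F (x + v) - F x \<le> c"
  proof (rule ccontr)
    assume not_le: "\<not> F (x + v) - F x \<le> c"
    define X where "X = {a. c < F (a + v) - F a} \<inter> W \<inter> (\<lambda>a. a + v) -` W"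
    have cont': "continuous_on UNIV (\<lambda>a. F (a + v))"
      by (rule continuous_on_compose2[OF contF]) (auto intro!: continuous_intros)
    have "open {a. c < F (a + v) - F a}"
      by (intro open_Collect_less continuous_intros cont' contF)
    moreover have "open ((\<lambda>a. a + v) -` W)"
      by (intro open_vimage W continuous_intros)
    ultimately have "open X" unfolding X_def using W(1) by blast
    moreover have "x \<in> X" using W not_le by (simp add: X_def v_def)
    ultimately have "\<not> negligible X" using open_not_negligible by blast
    then obtain a where "a \<in> X" "a \<notin> A"
      using A_negl negligible_subset by blast
    with shifted[of a] show False by (auto simp: X_def)
  qed
  then show ?thesis using W F(2) by (simp add: v_def)
qed

section \<open>Clarke's subdifferential\<close>

lemma gderiv_unique:
  fixes f :: "'a::euclidean_space \<Rightarrow> real"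
  assumes "GDERIV f x :> G" "GDERIV f x :> G'"
  shows "G = G'"
proof -
  have "(\<lambda>h. h \<bullet> G) = (\<lambda>h. h \<bullet> G')"
    using assms unfolding gderiv_def by (rule has_derivative_unique)
  then show ?thesis by (metis vector_eq_ldot)
qed

lemma gradient_eq: "GDERIV f z :> G \<Longrightarrow> gradient f z = G"
  unfolding gradient_def by (blast intro: the_equality gderiv_unique)

lemma differentiable_iff_gderiv:
  fixes f :: "real^'m \<Rightarrow> real"
  shows "f differentiable (at z) \<longleftrightarrow> GDERIV f z :> gradient f z"
proof
  assume "f differentiable (at z)"
  then obtain D where D: "(f has_derivative D) (at z)" by (auto simp: differentiable_def)
  then have "linear D" by (rule has_derivative_linear)
  then have "D = (\<lambda>h. h \<bullet> adjoint D 1)"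
    by (simp add: fun_eq_iff adjoint_works)
  with D have "GDERIV f z :> adjoint D 1" by (simp add: gderiv_def)
  then show "GDERIV f z :> gradient f z" using gradient_eq by metis
qed (auto simp: gderiv_def differentiable_def)

definition near_gradients :: "(real^'m) set \<Rightarrow> (real^'m \<Rightarrow> real) \<Rightarrow> real^'m \<Rightarrow> real \<Rightarrow> (real^'m) set" where
  "near_gradients U f x \<epsilon> = {gradient f z | z. z \<in> U \<and> norm (z - x) \<le> \<epsilon> \<and> f differentiable (at z)}"

lemma near_gradientsI:
  fixes f :: "real^'m \<Rightarrow> real"
  assumes "GDERIV f z :> g" "z \<in> U" "norm (z - x) \<le> \<epsilon>"
  shows "g \<in> near_gradients U f x \<epsilon>"
  using assms gradient_eq[OF assms(1)]
  by (auto simp: near_gradients_def gderiv_def differentiable_def)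

lemma near_gradientsE:
  fixes f :: "real^'m \<Rightarrow> real"
  assumes "g \<in> near_gradients U f x \<epsilon>"
  obtains z where "GDERIV f z :> g" "z \<in> U" "norm (z - x) \<le> \<epsilon>"
  using assms by (auto simp: near_gradients_def differentiable_iff_gderiv)

lemma clarke_subdiff_alt:
  "clarke_subdiff U f x = (\<Inter>\<epsilon>\<in>{0<..}. closure (convex hull (near_gradients U f x \<epsilon>)))"
  by (simp add: clarke_subdiff_def near_gradients_def)

lemma closed_clarke_subdiff: "closed (clarke_subdiff U f x)"
  unfolding clarke_subdiff_def by (intro closed_INT) auto

lemma clarke_subdiff_limit:
  fixes f :: "real^'m \<Rightarrow> real"
  assumes z: "z \<longlonglongrightarrow> x" "\<And>n. z n \<in> U" "\<And>n. f differentiable (at (z n))"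
    and g: "(\<lambda>n. gradient f (z n)) \<longlonglongrightarrow> g"
  shows "g \<in> clarke_subdiff U f x"
  unfolding clarke_subdiff_alt
proof
  fix \<epsilon> :: real assume "\<epsilon> \<in> {0<..}"
  then have "\<forall>\<^sub>F n in sequentially. norm (z n - x) < \<epsilon>"
    using tendstoD[OF z(1), of \<epsilon>] by (simp add: dist_norm)
  then have "\<forall>\<^sub>F n in sequentially. gradient f (z n) \<in> closure (convex hull near_gradients U f x \<epsilon>)"
  proof eventually_elim
    case (elim n)
    then have "gradient f (z n) \<in> near_gradients U f x \<epsilon>"
      using z(2,3) by (auto simp: near_gradients_def intro!: exI[of _ "z n"])
    then show ?case
      by (meson closure_subset hull_subset subsetD)
  qed
  then show "g \<in> closure (convex hull near_gradients U f x \<epsilon>)"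
    using g by (intro Lim_in_closed_set[of _ _ sequentially]) auto
qed

lemma gderiv_norm_le_lipschitz:
  fixes f :: "'a::euclidean_space \<Rightarrow> real"
  assumes lip: "L-lipschitz_on W f" and W: "open W" "z \<in> W" and G: "GDERIV f z :> G"
  shows "norm G \<le> L"
proof -
  have "((\<lambda>s. f (z + s *\<^sub>R G)) has_derivative (\<lambda>s. (s *\<^sub>R G) \<bullet> G)) (at 0)"
  proof (rule has_derivative_compose[of "\<lambda>s. z + s *\<^sub>R G" _ 0 UNIV f "\<lambda>h. h \<bullet> G"])
    show "((\<lambda>s. z + s *\<^sub>R G) has_derivative (\<lambda>s. s *\<^sub>R G)) (at 0)"
      by (auto intro!: derivative_eq_intros)
  qed (use G in \<open>simp add: gderiv_def\<close>)
  then have "((\<lambda>s. f (z + s *\<^sub>R G)) has_field_derivative (G \<bullet> G)) (at 0)"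
    by (simp add: has_field_derivative_def mult.commute[of _ "G \<bullet> G"] mult_commute_abs)
  then have lim: "((\<lambda>s. (f (z + s *\<^sub>R G) - f z) / s) \<longlongrightarrow> G \<bullet> G) (at_right 0)"
    unfolding DERIV_def by (auto intro: filterlim_at_split[THEN iffD1, THEN conjunct2])
  have "((\<lambda>s. z + s *\<^sub>R G) \<longlongrightarrow> z + 0 *\<^sub>R G) (at_right 0)"
    by (intro tendsto_intros)
  then have "\<forall>\<^sub>F s in at_right 0. z + s *\<^sub>R G \<in> W"
    using W by (intro topological_tendstoD) auto
  moreover have "\<forall>\<^sub>F s in at_right (0::real). s > 0"
    by (simp add: eventually_at_right_less)
  ultimately have "\<forall>\<^sub>F s in at_right 0. (f (z + s *\<^sub>R G) - f z) / s \<le> L * norm G"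
  proof eventually_elim
    case (elim s)
    have "f (z + s *\<^sub>R G) - f z \<le> L * (s * norm G)"
      using lipschitz_onD[OF lip elim(1) W(2)] elim(2) by (simp add: dist_norm)
    then show ?case using elim(2) by (simp add: field_simps)
  qed
  from tendsto_upperbound[OF lim this] have "norm G * norm G \<le> L * norm G"
    by (simp add: power2_norm_eq_inner flip: power2_eq_square)
  then show ?thesis
    using lipschitz_on_nonneg[OF lip] by (cases "G = 0") auto
qed

text \<open>Gradients at points tending to \<open>x\<close> are bounded, and their cluster points are subgradients at \<open>x\<close>.\<close>

lemma clarke_subdiff_upper_semicontinuous:
  fixes f :: "real^'m \<Rightarrow> real"
  assumes lip: "L-lipschitz_on W f" and W: "open W" "x \<in> W" and "\<eta> > 0"
  obtains \<delta> where "\<delta> > 0"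
    "\<And>z. z \<in> U \<Longrightarrow> norm (z - x) < \<delta> \<Longrightarrow> f differentiable (at z) \<Longrightarrow>
      \<exists>g\<in>clarke_subdiff U f x. norm (gradient f z - g) < \<eta>"
proof (rule ccontr)
  note found = that
  assume "\<not> thesis"
  then have neg: "\<exists>z. z \<in> U \<and> norm (z - x) < \<delta> \<and> f differentiable (at z) \<and>
      (\<forall>g\<in>clarke_subdiff U f x. norm (gradient f z - g) \<ge> \<eta>)" if "\<delta> > 0" for \<delta>
    using found[of \<delta>] \<open>\<delta> > 0\<close> \<open>\<not> thesis\<close> by (meson not_le)
  obtain \<rho> where \<rho>: "\<rho> > 0" "ball x \<rho> \<subseteq> W"
    using W by (meson openE)
  have "\<forall>n. \<exists>z. z \<in> U \<and> norm (z - x) < min \<rho> (inverse (real (Suc n))) \<and> f differentiable (at z) \<and>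
      (\<forall>g\<in>clarke_subdiff U f x. norm (gradient f z - g) \<ge> \<eta>)"
    using \<rho>(1) by (intro allI neg) auto
  then obtain z where z: "\<And>n. z n \<in> U" "\<And>n. norm (z n - x) < min \<rho> (inverse (real (Suc n)))"
      "\<And>n. f differentiable (at (z n))"
      "\<And>n g. g \<in> clarke_subdiff U f x \<Longrightarrow> norm (gradient f (z n) - g) \<ge> \<eta>"
    by metis
  have "gradient f (z n) \<in> cball 0 L" for n
  proof -
    have "z n \<in> W" using z(2)[of n] \<rho>(2) by (auto simp: dist_norm norm_minus_commute)
    from gderiv_norm_le_lipschitz[OF lip W(1) this] z(3)[of n] show ?thesis
      by (simp add: differentiable_iff_gderiv)
  qed
  then obtain g r where r: "strict_mono r" and g: "((\<lambda>n. gradient f (z n)) \<circ> r) \<longlonglongrightarrow> g"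
    using compact_cball[of "0::real^'m" L] unfolding compact_def by (metis (no_types, lifting))
  have "z \<longlonglongrightarrow> x"
  proof (rule metric_tendsto_imp_tendsto[OF LIMSEQ_inverse_real_of_nat])
    have "dist (z n) x \<le> dist (inverse (real (Suc n))) 0" for n
      using z(2)[of n] by (simp add: dist_norm)
    then show "\<forall>\<^sub>F n in sequentially. dist (z n) x \<le> dist (inverse (real (Suc n))) 0" by simp
  qed
  then have "(\<lambda>n. z (r n)) \<longlonglongrightarrow> x"
    using LIMSEQ_subseq_LIMSEQ[OF _ r] by (auto simp: o_def)
  then have gin: "g \<in> clarke_subdiff U f x"
    using g z by (intro clarke_subdiff_limit[of "z \<circ> r"]) (auto simp: o_def)
  obtain n where "norm (gradient f (z (r n)) - g) < \<eta>"
    using tendstoD[OF g \<open>\<eta> > 0\<close>] by (auto simp: dist_norm eventually_sequentially)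
  with z(4)[OF gin, of "r n"] show False by simp
qed

lemma clarke_subdiff_nonempty:
  fixes f :: "real^'m \<Rightarrow> real"
  assumes lip: "L-lipschitz_on W f" and W: "open W" "x \<in> W" "W \<subseteq> U"
  shows "clarke_subdiff U f x \<noteq> {}"
proof -
  obtain \<delta> where \<delta>: "\<delta> > 0" "\<And>z. z \<in> U \<Longrightarrow> norm (z - x) < \<delta> \<Longrightarrow> f differentiable (at z) \<Longrightarrow>
      \<exists>g\<in>clarke_subdiff U f x. norm (gradient f z - g) < 1"
    by (rule clarke_subdiff_upper_semicontinuous[OF lip W(1,2) zero_less_one, of U]) (rule that)
  have "\<exists>z\<in>W \<inter> ball x \<delta>. \<exists>G. GDERIV f z :> G"
    using W \<delta>(1)
    by (intro lipschitz_gderiv_dense[OF lipschitz_on_subset[OF lip]]) (auto intro!: exI[of _ x])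
  then obtain z where "z \<in> W" "norm (z - x) < \<delta>" "f differentiable (at z)"
    unfolding gderiv_def differentiable_def
    by (metis IntD1 IntD2 dist_commute dist_norm mem_ball)
  with \<delta>(2)[of z] W(3) show ?thesis by auto
qed

lemma clarke_subdiff_bounded:
  fixes f :: "real^'m \<Rightarrow> real"
  assumes lip: "L-lipschitz_on W f" and W: "open W" "x \<in> W"
  shows "clarke_subdiff U f x \<subseteq> cball 0 L"
proof -
  obtain \<rho> where \<rho>: "\<rho> > 0" "cball x \<rho> \<subseteq> W"
    using W by (meson open_contains_cball)
  have "near_gradients U f x \<rho> \<subseteq> cball 0 L"
  proof
    fix g assume "g \<in> near_gradients U f x \<rho>"
    then obtain z where z: "GDERIV f z :> g" "norm (z - x) \<le> \<rho>" by (rule near_gradientsE)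
    then have "z \<in> W" using \<rho>(2) by (auto simp: dist_norm norm_minus_commute)
    from gderiv_norm_le_lipschitz[OF lip W(1) this z(1)] show "g \<in> cball 0 L" by simp
  qed
  then have "closure (convex hull near_gradients U f x \<rho>) \<subseteq> cball 0 L"
    by (intro closure_minimal hull_minimal) auto
  then show ?thesis using \<rho>(1) by (auto simp: clarke_subdiff_alt)
qed

text \<open>A one-sided form of Lebourg's mean value theorem that refers to the subdifferential at the single point \<open>x\<close>:
  nearby gradients are within \<open>\<eta>\<close> of it. The bound is uniform in the base point and the direction.\<close>

lemma clarke_subdiff_increment:
  fixes f :: "real^'m \<Rightarrow> real"
  assumes lip: "L-lipschitz_on W f" and W: "open W" "x \<in> W" "W \<subseteq> U" and "\<eta> > 0"
  obtains \<delta> where "\<delta> > 0"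
    "\<And>y d s. norm (y - x) < \<delta> \<Longrightarrow> norm (y + d - x) < \<delta> \<Longrightarrow> (\<And>g. g \<in> clarke_subdiff U f x \<Longrightarrow> g \<bullet> d \<le> s) \<Longrightarrow>
      f (y + d) - f y \<le> s + \<eta> * norm d"
proof -
  obtain \<delta>' where \<delta>': "\<delta>' > 0" "\<And>z. z \<in> U \<Longrightarrow> norm (z - x) < \<delta>' \<Longrightarrow> f differentiable (at z) \<Longrightarrow>
      \<exists>g\<in>clarke_subdiff U f x. norm (gradient f z - g) < \<eta>"
    by (rule clarke_subdiff_upper_semicontinuous[OF lip W(1,2) \<open>\<eta> > 0\<close>, of U]) (rule that)
  obtain \<rho> where \<rho>: "\<rho> > 0" "ball x \<rho> \<subseteq> W"
    using W by (meson openE)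
  define \<delta> where "\<delta> = min \<delta>' \<rho>"
  have \<delta>: "\<delta> > 0" "ball x \<delta> \<subseteq> W"
    using \<delta>'(1) \<rho> by (auto simp: \<delta>_def)
  moreover have "f (y + d) - f y \<le> s + \<eta> * norm d"
    if y: "norm (y - x) < \<delta>" "norm (y + d - x) < \<delta>"
      and s: "\<And>g. g \<in> clarke_subdiff U f x \<Longrightarrow> g \<bullet> d \<le> s" for y d s
  proof (rule lipschitz_increment_le[OF lipschitz_on_subset[OF lip \<delta>(2)]])
    show "y \<in> ball x \<delta>" "y + d \<in> ball x \<delta>"
      using y by (simp_all add: dist_norm norm_minus_commute)
    fix z G assume z: "z \<in> ball x \<delta>" and G: "GDERIV f z :> G"
    have "f differentiable (at z)" "gradient f z = G"
      using G gradient_eq[OF G] by (auto simp: gderiv_def differentiable_def)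
    moreover have "z \<in> U" "norm (z - x) < \<delta>'"
      using z \<delta>(2) W(3) by (auto simp: dist_norm norm_minus_commute \<delta>_def)
    ultimately obtain g where g: "g \<in> clarke_subdiff U f x" "norm (G - g) < \<eta>"
      using \<delta>'(2) by blast
    have "G \<bullet> d = g \<bullet> d + (G - g) \<bullet> d" by (simp add: inner_diff_left)
    also have "\<dots> \<le> s + norm (G - g) * norm d"
      by (intro add_mono s g norm_cauchy_schwarz)
    also have "\<dots> \<le> s + \<eta> * norm d"
      using g by (intro add_mono mult_right_mono) auto
    finally show "G \<bullet> (y + d - y) \<le> s + \<eta> * norm d" by simp
  qed auto
  ultimately show thesis using that by blast
qed

text \<open>A linear map that takes gradients of \<open>f1\<close> near \<open>x1\<close> approximately to gradients of \<open>f2\<close> near \<open>x2\<close> does the same to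
  closed convex hulls, because the \<open>\<eta>\<close>-neighbourhood of a closed convex set is closed and convex. The allowed
  error is what lets a factor that varies with the point, as in the chain rule for \<open>- 1 / f\<close>, be frozen at \<open>x1\<close>.\<close>

lemma clarke_subdiff_transform:
  fixes f1 :: "real^'m \<Rightarrow> real" and f2 :: "real^'k \<Rightarrow> real"
  assumes T: "bounded_linear T"
    and near: "\<And>\<epsilon> \<eta>. \<epsilon> > 0 \<Longrightarrow> \<eta> > 0 \<Longrightarrow> \<exists>\<delta>>0. \<forall>g\<in>near_gradients U1 f1 x1 \<delta>.
      \<exists>h\<in>near_gradients U2 f2 x2 \<epsilon>. norm (T g - h) \<le> \<eta>"
    and g: "g \<in> clarke_subdiff U1 f1 x1"
  shows "T g \<in> clarke_subdiff U2 f2 x2"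
  unfolding clarke_subdiff_alt
proof
  fix \<epsilon> :: real assume "\<epsilon> \<in> {0<..}"
  then have \<epsilon>: "\<epsilon> > 0" by simp
  define K where "K = closure (convex hull (near_gradients U2 f2 x2 \<epsilon>))"
  have K: "closed K" "convex K" by (simp_all add: K_def convex_closure)
  have K_sup: "near_gradients U2 f2 x2 \<epsilon> \<subseteq> K"
    unfolding K_def by (meson closure_subset hull_subset order_trans)
  have "\<exists>b\<in>K. dist b (T g) < \<eta>" if "\<eta> > 0" for \<eta>
  proof -
    obtain \<delta> where \<delta>: "\<delta> > 0"
      "\<And>g. g \<in> near_gradients U1 f1 x1 \<delta> \<Longrightarrow> \<exists>h\<in>near_gradients U2 f2 x2 \<epsilon>. norm (T g - h) \<le> \<eta> / 2"
      using near[of \<epsilon> "\<eta> / 2"] \<epsilon> \<open>\<eta> > 0\<close> half_gt_zero by blast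
    define V where "V = T -` (\<Union>a\<in>cball 0 (\<eta> / 2). \<Union>b\<in>K. {a + b})"
    have "closed V"
      unfolding V_def
      by (intro closed_vimage compact_closed_sums) (use K T in \<open>auto intro: linear_continuous_on\<close>)
    moreover have "convex V"
      unfolding V_def
      using convex_sums[OF convex_cball K(2)] T
      by (intro convex_linear_vimage) (auto dest: bounded_linear.linear)
    moreover have "near_gradients U1 f1 x1 \<delta> \<subseteq> V"
    proof
      fix g assume "g \<in> near_gradients U1 f1 x1 \<delta>"
      then obtain h where "h \<in> K" "norm (T g - h) \<le> \<eta> / 2" using \<delta>(2) K_sup by blast
      then show "g \<in> V"
        unfolding V_def vimage_def by (intro CollectI UN_I[of "T g - h"] UN_I[of h]) auto
    qed
    ultimately have "closure (convex hull near_gradients U1 f1 x1 \<delta>) \<subseteq> V"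
      by (intro closure_minimal hull_minimal)
    then have "g \<in> V"
      using g \<delta>(1) by (auto simp: clarke_subdiff_alt)
    then obtain a b where "norm a \<le> \<eta> / 2" "b \<in> K" "T g = a + b"
      by (auto simp: V_def)
    then show ?thesis using that by (intro bexI[of _ b]) (auto simp: dist_norm)
  qed
  then have "T g \<in> closure K" by (simp add: closure_approachable)
  then show "T g \<in> closure (convex hull near_gradients U2 f2 x2 \<epsilon>)"
    using K(1) by (simp add: K_def)
qed

section \<open>The Lyapunov equation\<close>

text \<open>\<open>p(T) x\<close> for a complex polynomial \<open>p\<close>. Multiplication by complex scalars is the parameter \<open>sc\<close>, because
  complex matrices as a type carry only a real vector space structure.\<close>

definition poly_op :: "(complex \<Rightarrow> 'v \<Rightarrow> 'v) \<Rightarrow> ('v \<Rightarrow> 'v) \<Rightarrow> complex poly \<Rightarrow> 'v \<Rightarrow> 'v::real_vector" where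
  "poly_op sc T p = fold_coeffs (\<lambda>a g x. sc a x + g (T x)) p (\<lambda>_. 0)"

locale complex_operator =
  fixes sc :: "complex \<Rightarrow> 'v \<Rightarrow> 'v::euclidean_space" and T :: "'v \<Rightarrow> 'v"
  assumes sc_add_right: "sc a (x + y) = sc a x + sc a y"
    and sc_add_left: "sc (a + b) x = sc a x + sc b x"
    and sc_mult: "sc a (sc b x) = sc (a * b) x"
    and sc_real: "sc (complex_of_real r) x = r *\<^sub>R x"
    and T_add: "T (x + y) = T x + T y"
    and T_sc: "T (sc a x) = sc a (T x)"
begin

lemma sc_0 [simp]: "sc 0 x = 0" and sc_1 [simp]: "sc 1 x = x"
  using sc_real[of 0 x] sc_real[of 1 x] by simp_all

lemma sc_0_right [simp]: "sc a 0 = 0"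
  using sc_mult[of a 0 0] by simp

lemma poly_op_0 [simp]: "poly_op sc T 0 x = 0"
  by (simp add: poly_op_def)

lemma poly_op_pCons [simp]: "poly_op sc T (pCons a p) x = sc a x + poly_op sc T p (T x)"
  by (cases "p = 0 \<and> a = 0") (auto simp: poly_op_def)

lemma poly_op_add: "poly_op sc T (p + q) x = poly_op sc T p x + poly_op sc T q x"
proof (induction p arbitrary: q x)
  case (pCons a p)
  then show ?case by (cases q) (simp add: sc_add_left)
qed simp

lemma poly_op_smult: "poly_op sc T (smult c p) x = poly_op sc T p (sc c x)"
  by (induction p arbitrary: x) (simp_all add: sc_mult T_sc mult.commute)

lemma poly_op_arg_add: "poly_op sc T p (x + y) = poly_op sc T p x + poly_op sc T p y"
  by (induction p arbitrary: x y) (simp_all add: sc_add_right T_add)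

lemma poly_op_linear_factor: "poly_op sc T ([:- z, 1:] * q) x = poly_op sc T q (T x + sc (- z) x)"
proof -
  have "[:- z, 1:] * q = smult (- z) q + pCons 0 q" by simp
  then show ?thesis
    by (simp only: poly_op_add poly_op_smult poly_op_arg_add poly_op_pCons) simp
qed

text \<open>Sufficiently many iterates \<open>T\<^sup>i x\<close> are linearly dependent already over the reals.\<close>

lemma annihilating_poly: "\<exists>p. p \<noteq> 0 \<and> poly_op sc T p x = 0"
proof -
  define f where "f = (\<lambda>i. (T ^^ i) x)"
  define n where "n = DIM('v)"
  have f_Suc: "(T ^^ i) (T x) = f (Suc i)" for i by (simp add: f_def funpow_swap1)
  have "\<exists>c. (\<exists>i\<le>n. c i \<noteq> 0) \<and> (\<Sum>i\<le>n. c i *\<^sub>R f i) = 0"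
  proof (cases "inj_on f {..n}")
    case True
    then have "card (f ` {..n}) > DIM('v)" by (simp add: card_image n_def)
    then have "dependent (f ` {..n})" by (intro dependent_biggerset)
    then obtain u where u: "\<exists>v\<in>f ` {..n}. u v \<noteq> 0" "(\<Sum>v\<in>f ` {..n}. u v *\<^sub>R v) = 0"
      by (subst (asm) dependent_finite) auto
    then show ?thesis
      using True by (intro exI[of _ "u \<circ> f"]) (auto simp: sum.reindex o_def)
  next
    case False
    then obtain i j where ij: "i \<le> n" "j \<le> n" "i \<noteq> j" "f i = f j" by (auto simp: inj_on_def)
    define c where "c = (\<lambda>k. if k = i then 1 else if k = j then - 1 else (0::real))"
    have "(\<Sum>k\<le>n. c k *\<^sub>R f k) = (\<Sum>k\<in>{i, j}. c k *\<^sub>R f k)"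
      using ij by (intro sum.mono_neutral_right) (auto simp: c_def)
    also have "\<dots> = 0" using ij by (simp add: c_def)
    finally show ?thesis using ij by (intro exI[of _ c]) (auto simp: c_def)
  qed
  then obtain c k where c: "k \<le> n" "c k \<noteq> 0" "(\<Sum>i\<le>n. c i *\<^sub>R f i) = 0" by blast
  have monom: "poly_op sc T (monom a i) y = sc a ((T ^^ i) y)" for a i y
    by (induction i arbitrary: y) (simp_all add: monom_0 monom_Suc funpow_swap1)
  have sum: "poly_op sc T (\<Sum>i\<in>S. monom (complex_of_real (c i)) i) x = (\<Sum>i\<in>S. c i *\<^sub>R f i)"
    if "finite S" for S
    using that by (induction S rule: finite_induct) (simp_all add: poly_op_add monom sc_real f_def)
  define p where "p = (\<Sum>i\<le>n. monom (complex_of_real (c i)) i)"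
  have "coeff p k = complex_of_real (c k)"
    using c(1) by (simp add: p_def coeff_sum sum.delta)
  then have "p \<noteq> 0" using c(2) by auto
  moreover have "poly_op sc T p x = 0" using sum c(3) by (simp add: p_def)
  ultimately show ?thesis by blast
qed

text \<open>Split off linear factors \<open>T - z\<close> from an annihilating polynomial of \<open>x\<close>; the first one that maps the current
  vector to zero exhibits an eigenvector.\<close>

lemma eigenvector_exists:
  assumes K: "x \<in> K" "x \<noteq> 0" "\<And>y. y \<in> K \<Longrightarrow> T y \<in> K" "\<And>a y. y \<in> K \<Longrightarrow> sc a y \<in> K"
    "\<And>y z. y \<in> K \<Longrightarrow> z \<in> K \<Longrightarrow> y + z \<in> K"
  obtains z y where "y \<in> K" "y \<noteq> 0" "T y = sc z y"
proof -
  have "\<exists>z y. y \<in> K \<and> y \<noteq> 0 \<and> T y = sc z y"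
    if "p \<noteq> 0" "poly_op sc T p x = 0" "x \<in> K" "x \<noteq> 0" for p x
    using that
  proof (induction "degree p" arbitrary: p x rule: less_induct)
    case less
    show ?case
    proof (cases "degree p = 0")
      case True
      then obtain a where "p = [:a:]" by (rule degree_eq_zeroE)
      with less.prems have "a \<noteq> 0" "sc a x = 0" by auto
      then have "x = 0" using sc_mult[of "1 / a" a x] by simp
      with less.prems show ?thesis by simp
    next
      case False
      then have "\<not> constant (poly p)" by (simp add: constant_degree)
      then obtain z where "poly p z = 0" using fundamental_theorem_of_algebra by blast
      then obtain q where q: "p = [:- z, 1:] * q" by (auto simp: poly_eq_0_iff_dvd dvd_def)
      then have "q \<noteq> 0" using less.prems by auto
      then have "degree q < degree p" unfolding q by (subst degree_mult_eq) auto
      show ?thesis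
      proof (cases "T x + sc (- z) x = 0")
        case True
        have "T x = (T x + sc (- z) x) + sc z x"
          by (simp add: add.assoc flip: sc_add_left)
        then have "T x = sc z x" using True by simp
        with less.prems show ?thesis by blast
      next
        case False
        have "poly_op sc T q (T x + sc (- z) x) = 0"
          using less.prems by (simp only: q poly_op_linear_factor)
        moreover have "T x + sc (- z) x \<in> K" using less.prems K by blast
        ultimately show ?thesis
          using less.hyps[OF \<open>degree q < degree p\<close> \<open>q \<noteq> 0\<close>] False by blast
      qed
    qed
  qed
  with annihilating_poly[of x] K(1,2) that show thesis by blast
qed

end

lemma matrix_matrix_add_rdistrib: "(A + B) ** C = A ** C + B ** (C :: 'a::semiring_1^_^_)"
  by (simp add: matrix_matrix_mult_def vec_eq_iff distrib_right sum.distrib)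

definition lyap_op :: "real^'k^'k \<Rightarrow> real^'k^'k \<Rightarrow> real^'k^'k" where
  "lyap_op A X = transpose A ** X + X ** A"

definition cmat :: "real^'k^'k \<Rightarrow> complex^'k^'k" where
  "cmat A = (\<chi> i j. complex_of_real (A $ i $ j))"

lemma hurwitz_transpose_eigenvalue:
  assumes "hurwitz A" "v \<noteq> 0" "transpose (cmat A) *v v = z *s v"
  shows "Re z < 0"
proof -
  have shift: "(B - mat z) *v w = B *v w - z *s w" for B :: "complex^'k^'k" and w
  proof -
    have "mat z *v w = z *s w"
      by (simp add: vec_eq_iff matrix_vector_mult_def mat_def if_distrib[of "\<lambda>x. x * _"] cong: if_cong)
    then show ?thesis by (simp add: matrix_vector_mult_diff_rdistrib)
  qed
  have tr: "transpose (cmat A) - mat z = transpose (cmat A - mat z)"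
    by (auto simp: vec_eq_iff transpose_def mat_def)
  have "transpose (cmat A - mat z) *v v = 0"
    using assms(3) by (simp add: shift flip: tr)
  with assms(2) have "\<not> (\<exists>B. B ** transpose (cmat A - mat z) = mat 1)"
    unfolding matrix_left_invertible_ker by blast
  then have "\<not> (\<exists>B. B ** (cmat A - mat z) = mat 1)"
    by (simp add: left_invertible_transpose matrix_left_right_inverse)
  then obtain w where "w \<noteq> 0" "cmat A *v w = z *s w"
    unfolding matrix_left_invertible_ker by (auto simp: shift)
  with assms(1) show ?thesis unfolding hurwitz_def cmat_def by blast
qed

text \<open>The kernel of the Lyapunov operator is invariant under right multiplication by \<open>A\<close>. If it were
  nonzero, it would contain an eigenvector \<open>Y A = z Y\<close> of this map, and then \<open>A\<^sup>T Y = - z Y\<close>: both \<open>z\<close>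
  and \<open>- z\<close> would be eigenvalues of \<open>A\<^sup>T\<close>.\<close>

lemma lyap_op_kernel:
  fixes A :: "real^'k^'k"
  assumes A: "hurwitz A" and X: "lyap_op A X = 0"
  shows "X = 0"
proof (rule ccontr)
  assume "X \<noteq> 0"
  define sc :: "complex \<Rightarrow> complex^'k^'k \<Rightarrow> complex^'k^'k" where "sc = (\<lambda>a Y. \<chi> i j. a * Y $ i $ j)"
  define K where "K = {Y. transpose (cmat A) ** Y + Y ** cmat A = 0}"
  interpret complex_operator sc "\<lambda>Y :: complex^'k^'k. Y ** cmat A"
    by unfold_locales
      (auto simp: sc_def vec_eq_iff algebra_simps matrix_matrix_mult_def sum_distrib_left sum.distrib
        scaleR_conv_of_real[where 'a = complex])
  have sc_left: "B ** sc a Y = sc a (B ** Y)" for a B Y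
    by (simp add: sc_def vec_eq_iff matrix_matrix_mult_def sum_distrib_left mult_ac)
  have "cmat X \<in> K"
  proof -
    have "(transpose (cmat A) ** cmat X + cmat X ** cmat A) $ i $ j = of_real (lyap_op A X $ i $ j)" for i j
      by (simp add: lyap_op_def cmat_def matrix_matrix_mult_def transpose_def)
    then show ?thesis using X by (simp add: K_def vec_eq_iff)
  qed
  moreover have "cmat X \<noteq> 0" using \<open>X \<noteq> 0\<close> by (auto simp: cmat_def vec_eq_iff)
  moreover have "Y ** cmat A \<in> K" if "Y \<in> K" for Y
  proof -
    have "transpose (cmat A) ** (Y ** cmat A) + (Y ** cmat A) ** cmat A
        = (transpose (cmat A) ** Y + Y ** cmat A) ** cmat A"
      by (simp add: matrix_mul_assoc matrix_matrix_add_rdistrib)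
    then show ?thesis using that by (simp add: K_def)
  qed
  moreover have "sc a Y \<in> K" if "Y \<in> K" for a Y
  proof -
    have "transpose (cmat A) ** sc a Y + sc a Y ** cmat A = sc a (transpose (cmat A) ** Y + Y ** cmat A)"
      by (simp add: sc_left sc_add_right T_sc)
    then show ?thesis using that by (simp add: K_def)
  qed
  moreover have "Y + Z \<in> K" if "Y \<in> K" "Z \<in> K" for Y Z
  proof -
    have "transpose (cmat A) ** (Y + Z) + (Y + Z) ** cmat A
        = (transpose (cmat A) ** Y + Y ** cmat A) + (transpose (cmat A) ** Z + Z ** cmat A)"
      by (simp add: matrix_add_ldistrib matrix_matrix_add_rdistrib)
    then show ?thesis using that by (simp add: K_def)
  qed
  ultimately obtain z Y where Y: "Y \<in> K" "Y \<noteq> 0" "Y ** cmat A = sc z Y"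
    by (rule eigenvector_exists)
  obtain i j where ij: "Y $ i $ j \<noteq> 0" using Y(2) by (auto simp: vec_eq_iff)
  have row: "transpose (cmat A) *v (Y $ i) = z *s (Y $ i)"
  proof -
    have "(transpose (cmat A) *v (Y $ i)) $ k = (Y ** cmat A) $ i $ k" for k
      by (simp add: matrix_vector_mult_def matrix_matrix_mult_def transpose_def mult.commute)
    then show ?thesis by (simp add: Y(3) vec_eq_iff sc_def)
  qed
  have column: "transpose (cmat A) *v (column j Y) = (- z) *s column j Y"
  proof -
    have "(transpose (cmat A) *v column j Y) $ k = (transpose (cmat A) ** Y) $ k $ j" for k
      by (simp add: matrix_vector_mult_def matrix_matrix_mult_def column_def)
    moreover have "transpose (cmat A) ** Y = - sc z Y"
      using Y(1,3) by (simp add: K_def eq_neg_iff_add_eq_0)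
    ultimately show ?thesis by (simp add: vec_eq_iff sc_def column_def)
  qed
  have "Y $ i \<noteq> 0" "column j Y \<noteq> 0" using ij by (auto simp: vec_eq_iff column_def)
  then have "Re z < 0" "Re (- z) < 0"
    using hurwitz_transpose_eigenvalue[OF A _ row] hurwitz_transpose_eigenvalue[OF A _ column] by auto
  then show False by simp
qed

lemma bounded_bilinear_lyap_op: "bounded_bilinear lyap_op"
  unfolding bilinear_conv_bounded_bilinear[symmetric] bilinear_def
  by (auto simp: lyap_op_def matrix_add_ldistrib matrix_matrix_add_rdistrib scalar_matrix_assoc matrix_scalar_ac
      scaleR_add_right transpose_def vec_eq_iff matrix_matrix_mult_def sum.distrib sum_distrib_left
      algebra_simps intro!: linearI)

lemma linear_lyap_op: "linear (lyap_op A)"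
  using bounded_bilinear.bounded_linear_right[OF bounded_bilinear_lyap_op] by (rule bounded_linear.linear)

lemma inj_lyap_op: "hurwitz A \<Longrightarrow> inj (lyap_op A)"
  using lyap_op_kernel linear_lyap_op by (subst linear_injective_0) auto

lemma lyap_op_solvable:
  assumes "hurwitz A"
  obtains X where "lyap_op A X = B"
  using linear_injective_imp_surjective[OF linear_lyap_op inj_lyap_op[OF assms]] by (metis surjD)

lemma lyap_op_inject: "hurwitz A \<Longrightarrow> lyap_op A X = lyap_op A Y \<Longrightarrow> X = Y"
  using inj_lyap_op by (meson injD)

text \<open>Injectivity of the Lyapunov operator at \<open>A0\<close> gives a lower bound \<open>c \<parallel>X\<parallel>\<close> on its values, and half of this bound
  persists for nearby matrices.\<close>

lemma lyap_solution_lipschitz: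
  fixes A0 :: "real^'k^'k"
  assumes "hurwitz A0"
  obtains \<delta> C where "\<delta> > 0" "C \<ge> 0"
    "\<And>A B X Y. norm (A - A0) < \<delta> \<Longrightarrow> norm (B - A0) < \<delta> \<Longrightarrow> lyap_op A X = - mat 1 \<Longrightarrow>
      lyap_op B Y = - mat 1 \<Longrightarrow> norm (X - Y) \<le> C * norm (A - B)"
proof -
  interpret bounded_bilinear "lyap_op :: real^'k^'k \<Rightarrow> _" by (rule bounded_bilinear_lyap_op)
  obtain M where M: "M > 0" "\<And>A X :: real^'k^'k. norm (lyap_op A X) \<le> norm A * norm X * M"
    using pos_bounded by blast
  obtain c where c: "c > 0" "\<And>X. c * norm X \<le> norm (lyap_op A0 X)"
    using linear_inj_bounded_below_pos[OF linear_lyap_op inj_lyap_op[OF assms]] by blast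
  define \<delta> where "\<delta> = c / (2 * M)"
  have \<delta>: "\<delta> > 0" using c M by (simp add: \<delta>_def)
  have below: "(c / 2) * norm X \<le> norm (lyap_op A X)" if "norm (A - A0) < \<delta>" for A X
  proof -
    have "norm (lyap_op (A0 - A) X) \<le> norm (A0 - A) * norm X * M" by (rule M)
    also have "\<dots> \<le> \<delta> * norm X * M"
      using that M by (intro mult_right_mono) (auto simp: norm_minus_commute)
    also have "\<dots> = (c / 2) * norm X" using M by (simp add: \<delta>_def)
    finally have 1: "norm (lyap_op (A0 - A) X) \<le> (c / 2) * norm X" .
    have "c * norm X \<le> norm (lyap_op A X + lyap_op (A0 - A) X)"
      using c(2)[of X] by (simp flip: add_left)
    also have "\<dots> \<le> norm (lyap_op A X) + (c / 2) * norm X"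
      using norm_triangle_ineq[of "lyap_op A X" "lyap_op (A0 - A) X"] 1 by linarith
    finally show ?thesis by simp
  qed
  define C where "C = (2 / c) * M * ((2 / c) * norm (mat 1 :: real^'k^'k))"
  have "norm (X - Y) \<le> C * norm (A - B)"
    if "norm (A - A0) < \<delta>" "norm (B - A0) < \<delta>" "lyap_op A X = - mat 1" "lyap_op B Y = - mat 1"
    for A B X Y
  proof -
    have "(c / 2) * norm Y \<le> norm (mat 1 :: real^'k^'k)"
      using below[OF that(2), of Y] that(4) by simp
    then have Y: "norm Y \<le> (2 / c) * norm (mat 1 :: real^'k^'k)"
      using c by (simp add: field_simps)
    have "lyap_op A (X - Y) = lyap_op (B - A) Y"
      using that by (simp add: diff_left diff_right)
    then have "(c / 2) * norm (X - Y) \<le> norm (B - A) * norm Y * M"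
      using below[OF that(1), of "X - Y"] M(2)[of "B - A" Y] by simp
    also have "\<dots> \<le> norm (B - A) * ((2 / c) * norm (mat 1 :: real^'k^'k)) * M"
      using Y M by (intro mult_right_mono mult_left_mono) auto
    finally show ?thesis
      using c by (simp add: C_def field_simps norm_minus_commute)
  qed
  moreover have "C \<ge> 0" using c M by (simp add: C_def)
  ultimately show thesis using that \<delta> by blast
qed

lemma inner_transpose_mult: "(x::real^'a) \<bullet> (transpose B *v y) = (B *v x) \<bullet> y"
  by (metis dot_lmul_matrix vector_transpose_matrix)

lemma transpose_lyap_op: "transpose (lyap_op A X) = lyap_op A (transpose X)"
proof -
  have "transpose (B + C) = transpose B + transpose C" for B C :: "real^'k^'k"
    by (simp add: transpose_def vec_eq_iff)
  then show ?thesis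
    unfolding lyap_op_def matrix_transpose_mul by (metis add.commute matrix_transpose_mul transpose_transpose)
qed

lemma lyap_solution_symmetric:
  assumes "hurwitz A" "lyap_op A P = - mat 1"
  shows "transpose P = P"
proof (rule lyap_op_inject[OF assms(1)])
  have "transpose (- mat 1 :: real^'k^'k) = - mat 1"
    by (simp add: transpose_def vec_eq_iff mat_def)
  then show "lyap_op A (transpose P) = lyap_op A P"
    using transpose_lyap_op[of A P] assms(2) by metis
qed

lemma lyap_solution_quadratic:
  assumes "transpose P = P" "lyap_op A P = - mat 1"
  shows "2 * ((P *v v) \<bullet> (A *v v)) = - (v \<bullet> v)"
proof -
  have "v \<bullet> ((P ** A) *v v) = (P *v v) \<bullet> (A *v v)"
    using inner_transpose_mult[of v P "A *v v"] assms(1) by (simp add: matrix_vector_mul_assoc)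
  moreover have "v \<bullet> ((transpose A ** P) *v v) = (P *v v) \<bullet> (A *v v)"
    by (metis inner_transpose_mult inner_commute matrix_vector_mul_assoc)
  ultimately have "v \<bullet> (lyap_op A P *v v) = 2 * ((P *v v) \<bullet> (A *v v))"
    by (simp add: lyap_op_def matrix_vector_mult_add_rdistrib inner_add_right)
  moreover have "(- mat 1) *v v = - v"
    using matrix_vector_mult_diff_rdistrib[of 0 "mat 1" v] by simp
  ultimately show ?thesis using assms(2) by simp
qed

lemma positive_semidefinite_kernel:
  fixes P :: "real^'k^'k"
  assumes sym: "transpose P = P" and psd: "\<And>w. w \<bullet> (P *v w) \<ge> 0" and v: "v \<bullet> (P *v v) = 0"
  shows "P *v v = 0"
proof (rule ccontr)
  define w where "w = P *v v"
  assume "P *v v \<noteq> 0"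
  then have ww: "w \<bullet> w > 0" by (simp add: w_def)
  define b where "b = w \<bullet> (P *v w)"
  have b: "b \<ge> 0" by (simp add: b_def psd)
  have quad: "0 \<le> - 2 * t * (w \<bullet> w) + t\<^sup>2 * b" for t
  proof -
    have vw: "v \<bullet> (P *v w) = w \<bullet> w"
      using inner_transpose_mult[of v P w] sym by (simp add: w_def)
    have "(v - t *\<^sub>R w) \<bullet> (P *v (v - t *\<^sub>R w)) = - 2 * t * (w \<bullet> w) + t\<^sup>2 * b"
      using v vw by (simp add: matrix_vector_mult_diff_distrib matrix_vector_mult_scaleR inner_diff_left
          inner_diff_right b_def power2_eq_square algebra_simps flip: w_def)
    then show ?thesis using psd[of "v - t *\<^sub>R w"] by simp
  qed
  \<comment> \<open>For this \<open>t\<close> the form is negative at \<open>v - t w\<close>.\<close>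
  define t where "t = (w \<bullet> w) / (b + 1)"
  have t: "t > 0" "w \<bullet> w = t * (b + 1)" using b ww by (simp_all add: t_def)
  have "0 \<le> - 2 * t * (t * (b + 1)) + t\<^sup>2 * b"
    using quad[of t] unfolding t(2) .
  also have "\<dots> = - (t\<^sup>2 * (b + 2))"
    by (simp add: algebra_simps power2_eq_square)
  also have "\<dots> < 0"
    using b t(1) by simp
  finally show False by simp
qed

text \<open>A positive semidefinite solution is definite: a zero of its form is in its kernel, and
  \<open>v\<^sup>T (A\<^sup>T P + P A) v = - v\<^sup>T v\<close> excludes a kernel.\<close>

lemma lyap_solution_dichotomy:
  assumes A: "hurwitz A" and P: "lyap_op A P = - mat 1" and neg: "\<not> pos_def P"
  obtains v where "v \<bullet> (P *v v) < 0"
proof (rule ccontr)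
  assume "\<not> thesis"
  with that have psd: "v \<bullet> (P *v v) \<ge> 0" for v by (meson not_le)
  have sym: "transpose P = P" using A P by (rule lyap_solution_symmetric)
  have "v \<bullet> (P *v v) \<noteq> 0" if "v \<noteq> 0" for v
  proof
    assume "v \<bullet> (P *v v) = 0"
    then have "P *v v = 0" using positive_semidefinite_kernel[OF sym psd] by blast
    with lyap_solution_quadratic[OF sym P, of v] that show False by simp
  qed
  with psd have "pos_def P" using sym unfolding pos_def_def by (metis order_le_less)
  with neg show False by simp
qed

lemma bounded_bilinear_matrix_vector: "bounded_bilinear ((*v) :: real^'b^'a \<Rightarrow> real^'b \<Rightarrow> real^'a)"
  unfolding bilinear_conv_bounded_bilinear[symmetric] bilinear_def
  by (auto simp: matrix_vector_mult_add_rdistrib matrix_vector_right_distrib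
      scaleR_matrix_vector_assoc matrix_vector_mult_scaleR intro!: linearI)

lemma pos_def_lower_bound:
  fixes P :: "real^'k^'k"
  assumes "\<And>v. v \<noteq> 0 \<Longrightarrow> v \<bullet> (P *v v) > 0"
  obtains p where "p > 0" "\<And>v. p * (v \<bullet> v) \<le> v \<bullet> (P *v v)"
proof -
  have cont: "continuous_on (sphere 0 1) (\<lambda>v. v \<bullet> (P *v v))"
    by (intro continuous_intros linear_continuous_on matrix_vector_mul_bounded_linear)
  have ne: "sphere (0::real^'k) 1 \<noteq> {}"
    by (metis all_not_in_conv mem_sphere_0 norm_axis_1)
  obtain u where u: "u \<in> sphere 0 1" "\<And>v. v \<in> sphere 0 1 \<Longrightarrow> u \<bullet> (P *v u) \<le> v \<bullet> (P *v v)"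
    using continuous_attains_inf[OF compact_sphere ne cont] by blast
  have "u \<bullet> (P *v u) > 0" using assms u(1) by (metis mem_sphere_0 norm_zero zero_neq_one)
  moreover have "(u \<bullet> (P *v u)) * (v \<bullet> v) \<le> v \<bullet> (P *v v)" for v
  proof (cases "v = 0")
    case False
    have "u \<bullet> (P *v u) \<le> ((1 / norm v) *\<^sub>R v) \<bullet> (P *v ((1 / norm v) *\<^sub>R v))"
      using False by (intro u) simp
    also have "\<dots> = (v \<bullet> (P *v v)) / (v \<bullet> v)"
      by (simp add: matrix_vector_mult_scaleR power2_norm_eq_inner flip: power2_eq_square)
    finally show ?thesis using False by (simp add: field_simps)
  qed simp
  ultimately show thesis by (rule that)
qed

lemma hurwitz_segment_to_minus_identity:
  fixes A :: "real^'k^'k"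
  assumes A: "hurwitz A" and s: "0 \<le> s" "s \<le> 1"
  shows "hurwitz ((1 - s) *\<^sub>R A - s *\<^sub>R mat 1)"
  unfolding hurwitz_def
proof (intro allI impI)
  fix z :: complex and v :: "complex^'k"
  assume v: "v \<noteq> 0 \<and> (\<chi> i j. complex_of_real (((1 - s) *\<^sub>R A - s *\<^sub>R mat 1) $ i $ j)) *v v = z *s v"
  have "(\<chi> i j. complex_of_real (((1 - s) *\<^sub>R A - s *\<^sub>R mat 1) $ i $ j)) *v v
      = complex_of_real (1 - s) *s (cmat A *v v) - complex_of_real s *s v"
    by (simp add: vec_eq_iff matrix_vector_mult_def cmat_def mat_def left_diff_distrib sum_subtractf
        sum_distrib_left mult.assoc if_distrib[of complex_of_real] if_distrib[of "\<lambda>x. x * _"]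
        if_distrib[of "\<lambda>x. _ * x"] cong: if_cong)
  with v have eq: "complex_of_real (1 - s) *s (cmat A *v v) = (z + complex_of_real s) *s v"
    by (simp add: diff_eq_eq vector_sadd_rdistrib)
  show "Re z < 0"
  proof (cases "s = 1")
    case True
    then have "(z + 1) *s v = 0" using eq by simp
    then have "z + 1 = 0" using v unfolding vector_mul_eq_0 by blast
    then have "z = - 1" by (simp add: eq_neg_iff_add_eq_0)
    then show ?thesis by simp
  next
    case False
    then have "1 - s > 0" using s by simp
    define y where "y = (z + complex_of_real s) / complex_of_real (1 - s)"
    have ne: "complex_of_real (1 - s) \<noteq> 0" using False by (simp del: of_real_diff)
    have "complex_of_real (1 - s) *s (cmat A *v v) = complex_of_real (1 - s) *s (y *s v)"
      unfolding eq y_def using ne by (simp add: vector_smult_assoc)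
    then have "cmat A *v v = y *s v"
      using ne unfolding vector_mul_lcancel by blast
    then have "Re y < 0" using A v unfolding hurwitz_def cmat_def by blast
    moreover have "z = complex_of_real (1 - s) * y - complex_of_real s"
      using ne by (simp add: y_def)
    then have "Re z = (1 - s) * Re y - s" 
      by (simp del: of_real_diff)
    ultimately show ?thesis using \<open>1 - s > 0\<close> s by (smt (verit) mult_pos_neg)
  qed
qed

text \<open>Along the segment from \<open>A\<close> to \<open>- I\<close>, the solution is continuous. By the dichotomy above, both the parameters
  where it is positive definite and those where it is not form open sets, and at the end point it is \<open>I / 2\<close>.\<close>

theorem lyap_solution_pos_def:
  fixes A :: "real^'k^'k"
  assumes A: "hurwitz A" and P: "lyap_op A P = - mat 1"
  shows "pos_def P"
proof -
  define B where "B = (\<lambda>s. (1 - s) *\<^sub>R A - s *\<^sub>R (mat 1 :: real^'k^'k))"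
  have B: "hurwitz (B s)" if "s \<in> {0..1}" for s
    using hurwitz_segment_to_minus_identity[OF A] that by (simp add: B_def)
  have "\<forall>s. \<exists>X. s \<in> {0..1} \<longrightarrow> lyap_op (B s) X = - mat 1"
    using B lyap_op_solvable by metis
  then obtain X where X: "\<And>s. s \<in> {0..1} \<Longrightarrow> lyap_op (B s) (X s) = - mat 1" by metis
  have B_cont: "continuous_on {0..1} B"
    unfolding B_def by (intro continuous_intros)
  have X_cont: "continuous_on {0..1} X"
    unfolding continuous_on_def
  proof
    fix s :: real assume s: "s \<in> {0..1}"
    obtain \<delta> C where \<delta>: "\<delta> > 0" and C: "\<And>F G Y Z. norm (F - B s) < \<delta> \<Longrightarrow> norm (G - B s) < \<delta> \<Longrightarrow>
        lyap_op F Y = - mat 1 \<Longrightarrow> lyap_op G Z = - mat 1 \<Longrightarrow> norm (Y - Z) \<le> C * norm (F - G)"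
      using lyap_solution_lipschitz[OF B[OF s]] by metis
    have lim: "(B \<longlongrightarrow> B s) (at s within {0..1})"
      using B_cont s by (simp add: continuous_on_def)
    have "\<forall>\<^sub>F r in at s within {0..1}. r \<in> {0..1}"
      by (simp add: eventually_at_filter)
    with tendstoD[OF lim \<delta>]
    have "\<forall>\<^sub>F r in at s within {0..1}. norm (X r - X s) \<le> C * norm (B r - B s)"
      by eventually_elim (use s \<delta> in \<open>auto simp: dist_norm intro!: C X\<close>)
    moreover have "((\<lambda>r. C * norm (B r - B s)) \<longlongrightarrow> C * norm (B s - B s)) (at s within {0..1})"
      by (intro tendsto_intros lim)
    then have "((\<lambda>r. C * norm (B r - B s)) \<longlongrightarrow> 0) (at s within {0..1})" by simp
    ultimately have "((\<lambda>r. X r - X s) \<longlongrightarrow> 0) (at s within {0..1})"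
      by (rule Lim_null_comparison)
    then show "(X \<longlongrightarrow> X s) (at s within {0..1})" by (simp add: LIM_zero_iff)
  qed
  interpret mv: bounded_bilinear "(*v) :: real^'k^'k \<Rightarrow> real^'k \<Rightarrow> real^'k"
    by (rule bounded_bilinear_matrix_vector)
  define S where "S = {s \<in> {0..1}. pos_def (X s)}"
  have openS: "openin (top_of_set {0..1}) S"
    unfolding openin_euclidean_subtopology_iff
  proof (intro conjI ballI)
    fix s assume "s \<in> S"
    then have s: "s \<in> {0..1}" "pos_def (X s)" by (auto simp: S_def)
    then obtain p where p: "p > 0" "\<And>v. p * (v \<bullet> v) \<le> v \<bullet> (X s *v v)"
      using pos_def_lower_bound[of "X s"] unfolding pos_def_def by metis
    obtain M where M: "M > 0" "\<And>(D::real^'k^'k) v. norm (D *v v) \<le> norm D * norm v * M"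
      using mv.pos_bounded by blast
    obtain e where e: "e > 0" "\<And>r. r \<in> {0..1} \<Longrightarrow> dist r s < e \<Longrightarrow> dist (X r) (X s) < p / M"
      using X_cont s(1) p(1) M(1) unfolding continuous_on_iff by (metis divide_pos_pos)
    have "r \<in> S" if r: "r \<in> {0..1}" "dist r s < e" for r
    proof -
      have "v \<bullet> (X r *v v) > 0" if "v \<noteq> 0" for v
      proof -
        have "\<bar>v \<bullet> ((X r - X s) *v v)\<bar> \<le> norm v * (norm (X r - X s) * norm v * M)"
          using Cauchy_Schwarz_ineq2 M(2) by (meson mult_left_mono norm_ge_zero order_trans)
        also have "\<dots> = (norm (X r - X s) * M) * (v \<bullet> v)"
          by (simp add: power2_norm_eq_inner[symmetric] power2_eq_square)
        also have "\<dots> < p * (v \<bullet> v)"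
          using e(2)[OF r] M(1) that by (intro mult_strict_right_mono) (auto simp: dist_norm field_simps)
        finally have "\<bar>v \<bullet> ((X r - X s) *v v)\<bar> < p * (v \<bullet> v)" .
        then show ?thesis using p(2)[of v] by (simp add: mv.diff_left inner_diff_right)
      qed
      then show ?thesis
        using r lyap_solution_symmetric[OF B X] by (auto simp: S_def pos_def_def)
    qed
    then show "\<exists>e>0. \<forall>x'\<in>{0..1}. dist x' s < e \<longrightarrow> x' \<in> S" using e(1) by blast
  qed (auto simp: S_def)
  have openC: "openin (top_of_set {0..1}) ({0..1} - S)"
    unfolding openin_euclidean_subtopology_iff
  proof (intro conjI ballI)
    fix s assume "s \<in> {0..1} - S"
    then have s: "s \<in> {0..1}" "\<not> pos_def (X s)" by (auto simp: S_def)
    then obtain v where v: "v \<bullet> (X s *v v) < 0"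
      using lyap_solution_dichotomy[OF B X] by metis
    have "continuous_on {0..1} (\<lambda>r. v \<bullet> (X r *v v))"
      by (intro continuous_intros mv.continuous_on X_cont)
    then obtain e where e: "e > 0"
      "\<And>r. r \<in> {0..1} \<Longrightarrow> dist r s < e \<Longrightarrow> dist (v \<bullet> (X r *v v)) (v \<bullet> (X s *v v)) < - (v \<bullet> (X s *v v))"
      using v s(1) unfolding continuous_on_iff by (metis neg_0_less_iff_less)
    have "r \<notin> S" if "r \<in> {0..1}" "dist r s < e" for r
    proof
      assume "r \<in> S"
      then have "v \<bullet> (X r *v v) \<ge> 0"
        by (cases "v = 0") (auto simp: S_def pos_def_def intro: less_imp_le)
      with e(2)[OF that] v show False by (simp add: dist_real_def)
    qed
    then show "\<exists>e>0. \<forall>x'\<in>{0..1}. dist x' s < e \<longrightarrow> x' \<in> {0..1} - S" using e(1) by blast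
  qed auto
  interpret L: bounded_bilinear "lyap_op :: real^'k^'k \<Rightarrow> _" by (rule bounded_bilinear_lyap_op)
  have B1: "lyap_op (B 1) Y = - (Y + Y)" for Y
    by (simp add: B_def L.minus_left) (simp add: lyap_op_def transpose_mat)
  have "X 1 = (1 / 2) *\<^sub>R mat 1"
  proof (rule lyap_op_inject[OF B])
    show "lyap_op (B 1) (X 1) = lyap_op (B 1) ((1 / 2) *\<^sub>R mat 1)"
      using X[of 1] by (simp add: B1 flip: scaleR_add_left)
  qed simp
  moreover have "pos_def ((1 / 2) *\<^sub>R mat 1 :: real^'k^'k)"
    unfolding pos_def_def
  proof (intro conjI allI impI)
    show "transpose ((1 / 2) *\<^sub>R mat 1 :: real^'k^'k) = (1 / 2) *\<^sub>R mat 1"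
      by (simp add: transpose_def mat_def vec_eq_iff)
  qed (simp flip: scaleR_matrix_vector_assoc)
  ultimately have "1 \<in> S" by (simp add: S_def)
  moreover have "closedin (top_of_set {0..1}) S"
    using openC by (auto simp: closedin_def S_def)
  ultimately have "S = {0..1}"
    using connected_clopen[THEN iffD1, OF connected_Icc, rule_format, OF conjI[OF openS]] by (metis empty_iff)
  then have "0 \<in> S" by simp
  then have "pos_def (X 0)" unfolding S_def by blast
  moreover have "X 0 = P"
  proof (rule lyap_op_inject[OF A])
    show "lyap_op A (X 0) = lyap_op A P" using X[of 0] P by (simp add: B_def)
  qed
  ultimately show ?thesis by simp
qed

section \<open>Lipschitz continuity of the optimal gauge norm\<close>

lemma lyap_P_eq:
  assumes \<Lambda>: "\<Lambda> \<in> feasible S" and X: "lyap_op (A_stab S \<Lambda>) X = - mat 1"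
  shows "lyap_P S \<Lambda> = X"
proof -
  have A: "hurwitz (A_stab S \<Lambda>)" using \<Lambda> by (simp add: feasible_def)
  show ?thesis
    unfolding lyap_P_def lyap_op_def[symmetric]
    using X lyap_solution_pos_def[OF A X] lyap_op_inject[OF A]
    by (intro the_equality) (auto simp: X)
qed

lemma lyap_P_solution:
  assumes \<Lambda>: "\<Lambda> \<in> feasible S"
  shows "lyap_op (A_stab S \<Lambda>) (lyap_P S \<Lambda>) = - mat 1" "pos_def (lyap_P S \<Lambda>)"
proof -
  have A: "hurwitz (A_stab S \<Lambda>)" using \<Lambda> by (simp add: feasible_def)
  obtain X where X: "lyap_op (A_stab S \<Lambda>) X = - mat 1" using lyap_op_solvable[OF A] by blast
  with lyap_P_eq[OF \<Lambda> X] lyap_solution_pos_def[OF A X]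
  show "lyap_op (A_stab S \<Lambda>) (lyap_P S \<Lambda>) = - mat 1" "pos_def (lyap_P S \<Lambda>)" by simp_all
qed

lemma pos_def_inverse:
  fixes P :: "real^'k^'k"
  assumes "pos_def P"
  obtains B where "B ** P = mat 1" "P ** B = mat 1"
proof -
  have "\<forall>v. P *v v = 0 \<longrightarrow> v = 0"
    using assms unfolding pos_def_def by (metis inner_zero_right less_irrefl)
  then obtain B where "B ** P = mat 1" using matrix_left_invertible_ker by metis
  then show thesis using that matrix_left_right_inverse by metis
qed

lemma kron_mat_mult: "kron_mat A B ** kron_mat C D = kron_mat (A ** C) (B ** D)"
  by (simp add: vec_eq_iff kron_mat_def matrix_matrix_mult_def sum_product sum.cartesian_product
      UNIV_Times_UNIV[symmetric] mult_ac split_beta del: UNIV_Times_UNIV)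

lemma kron_mat_one: "kron_mat (mat 1) (mat 1) = mat 1"
  by (auto simp: vec_eq_iff kron_mat_def mat_def prod_eq_iff)

lemma transpose_kron_mat: "transpose (kron_mat A B) = kron_mat (transpose A) (transpose B)"
  by (simp add: vec_eq_iff kron_mat_def transpose_def)

definition kron_form :: "real^'k^'k \<Rightarrow> real^('k \<times> 'k) \<Rightarrow> real" where
  "kron_form P w = w \<bullet> (kron_mat P (mat 1) *v w)"

lemma norm_kron_factor:
  fixes B P :: "real^'k^'k"
  assumes "transpose B ** B = P"
  shows "norm (kron_mat B (mat 1) *v w) = sqrt (kron_form P w)"
proof -
  have "transpose (kron_mat B (mat 1)) ** kron_mat B (mat 1) = kron_mat P (mat 1 :: real^'k^'k)"
    by (simp add: transpose_kron_mat kron_mat_mult assms transpose_mat)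
  then have "kron_form P w = w \<bullet> (transpose (kron_mat B (mat 1)) *v (kron_mat B (mat 1) *v w))"
    by (simp add: kron_form_def matrix_vector_mul_assoc)
  also have "\<dots> = (norm (kron_mat B (mat 1) *v w))\<^sup>2"
    by (simp only: inner_transpose_mult power2_norm_eq_inner)
  finally show ?thesis by simp
qed

text \<open>Writing test vectors as \<open>B w\<close> removes the inverse: \<open>(B\<^sup>-\<^sup>T y)\<^sup>T B w = y\<^sup>T w\<close>.\<close>

lemma spectral_norm_inv_transpose_le_iff:
  fixes B :: "real^'a^'a" and G :: "real^'c^'a"
  assumes B: "C ** B = mat 1" and c: "0 \<le> c"
  shows "spectral_norm (matrix_inv (transpose B) ** G) \<le> c \<longleftrightarrow>
    (\<forall>x w. (G *v x) \<bullet> w \<le> c * norm x * norm (B *v w))"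
proof -
  have BC: "B ** C = mat 1" using B by (simp add: matrix_left_right_inverse)
  have "transpose C ** transpose B = mat 1" "transpose B ** transpose C = mat 1"
    using B BC by (simp_all add: transpose_mat flip: matrix_transpose_mul)
  then have "invertible (transpose B)" by (auto simp: invertible_def)
  then have inv: "transpose B ** matrix_inv (transpose B) = mat 1" 
    unfolding invertible_def matrix_inv_def by (rule someI2_ex) blast
  define W where "W = matrix_inv (transpose B) ** G"
  have G: "(G *v x) \<bullet> w = (W *v x) \<bullet> (B *v w)" for x w
  proof -
    have "G = transpose B ** W"
      by (simp add: W_def matrix_mul_assoc inv)
    then have "(G *v x) \<bullet> w = w \<bullet> (transpose B *v (W *v x))"
      by (simp add: matrix_vector_mul_assoc inner_commute)
    then show ?thesis by (simp only: inner_transpose_mult inner_commute)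
  qed
  show ?thesis
    unfolding W_def[symmetric]
  proof
    assume le: "spectral_norm W \<le> c"
    show "\<forall>x w. (G *v x) \<bullet> w \<le> c * norm x * norm (B *v w)"
    proof (intro allI)
      fix x w
      have "(G *v x) \<bullet> w \<le> norm (W *v x) * norm (B *v w)"
        unfolding G by (rule norm_cauchy_schwarz)
      also have "norm (W *v x) \<le> spectral_norm W * norm x"
        unfolding spectral_norm_def by (rule onorm[OF matrix_vector_mul_bounded_linear])
      also have "\<dots> \<le> c * norm x" using le by (intro mult_right_mono) auto
      finally show "(G *v x) \<bullet> w \<le> c * norm x * norm (B *v w)"
        by (simp add: mult_right_mono)
    qed
  next
    assume dual: "\<forall>x w. (G *v x) \<bullet> w \<le> c * norm x * norm (B *v w)"
    have "norm (W *v x) \<le> c * norm x" for x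
    proof -
      have "B *v (C *v (W *v x)) = W *v x" by (simp add: matrix_vector_mul_assoc BC matrix_mul_assoc)
      then have "norm (W *v x) * norm (W *v x) \<le> c * norm x * norm (W *v x)"
        using dual[rule_format, of x "C *v (W *v x)"]
        by (simp add: G flip: power2_norm_eq_inner power2_eq_square)
      then show ?thesis using c by (cases "W *v x = 0") auto
    qed
    then show "spectral_norm W \<le> c"
      unfolding spectral_norm_def by (intro onorm_le) (simp add: mult.commute)
  qed
qed

text \<open>For \<open>T = P H\<close> with symmetric \<open>P\<close>, the stacked blocks \<open>M\<^sub>i\<^sup>T P + P M\<^sub>i\<close> are this linear function of \<open>T\<close>.\<close>

definition symmetrize :: "real^('k \<times> 'k)^'k \<Rightarrow> real^'k^('k \<times> 'k)" where
  "symmetrize T = (\<chi> ir j. T $ j $ ir + T $ snd ir $ (fst ir, j))"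

lemma G_mat_eq_symmetrize:
  assumes "transpose (lyap_P S \<Lambda>) = lyap_P S \<Lambda>"
  shows "G_mat S \<Lambda> \<mu> = symmetrize (lyap_P S \<Lambda> ** H_gauge S \<Lambda> \<mu>)"
proof -
  have sym: "lyap_P S \<Lambda> $ a $ b = lyap_P S \<Lambda> $ b $ a" for a b
    using arg_cong[OF assms, of "\<lambda>M. M $ a $ b"] by (simp add: transpose_def)
  show ?thesis
    by (auto simp: vec_eq_iff G_mat_def Let_def symmetrize_def matrix_matrix_mult_def transpose_def
        sym mult.commute intro!: sum.cong)
qed

lemma linear_symmetrize: "linear symmetrize"
  by (auto simp: symmetrize_def vec_eq_iff algebra_simps intro!: linearI)

lemma gauge_space_mult:
  assumes "K \<in> gauge_space"
  shows "B ** K \<in> gauge_space"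
  using assms by (simp add: gauge_space_def flip: matrix_vector_mul_assoc)

definition gauge_shift :: "('n::finite, 'm::finite, 'd::finite) lifted_system \<Rightarrow> real^'d
    \<Rightarrow> real^(('n + 'm) \<times> ('n + 'm))^('n + 'm)" where
  "gauge_shift S \<mu> = (\<Sum>k\<in>UNIV. \<mu> $ k *\<^sub>R gauge_basis S k)"

lemma range_gauge_shift:
  fixes S :: "('n::finite, 'm::{finite,linorder}, 'd::finite) lifted_system"
  assumes "lifted_system_ok S"
  shows "range (gauge_shift S) = gauge_space"
proof -
  have inj: "inj (gauge_basis S)" and span: "span (range (gauge_basis S)) = gauge_space"
    using assms by (auto simp: lifted_system_ok_def)
  show ?thesis
  proof
    show "range (gauge_shift S) \<subseteq> gauge_space"
      unfolding span[symmetric] gauge_shift_def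
      by (intro image_subsetI span_sum span_scale span_base rangeI)
    show "gauge_space \<subseteq> range (gauge_shift S)"
    proof
      fix K assume "K \<in> (gauge_space :: (real^(('n + 'm) \<times> ('n + 'm))^('n + 'm)) set)"
      then obtain u where "K = (\<Sum>v\<in>range (gauge_basis S). u v *\<^sub>R v)"
        unfolding span[symmetric] by (subst (asm) span_finite) auto
      then have "K = gauge_shift S (\<chi> k. u (gauge_basis S k))"
        by (simp add: gauge_shift_def sum.reindex[OF inj])
      then show "K \<in> range (gauge_shift S)" by blast
    qed
  qed
qed

text \<open>Multiplication by \<open>P\<close> maps the gauge space onto itself, so the set of attainable \<open>G\<close> is a translate
  of a subspace that does not depend on \<open>\<Lambda>\<close>.\<close>

lemma G_mat_transfer:
  assumes S: "lifted_system_ok S" and \<Lambda>: "\<Lambda> \<in> feasible S" "\<Lambda>' \<in> feasible S"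
  obtains \<mu>' where "G_mat S \<Lambda>' \<mu>' = G_mat S \<Lambda> \<mu>
    + symmetrize (lyap_P S \<Lambda>' ** H_stab S \<Lambda>' - lyap_P S \<Lambda> ** H_stab S \<Lambda>)"
proof -
  define P where "P = lyap_P S \<Lambda>"
  define P' where "P' = lyap_P S \<Lambda>'"
  have P: "pos_def P" "pos_def P'" using \<Lambda> lyap_P_solution by (auto simp: P_def P'_def)
  obtain B where B: "P' ** B = mat 1" using pos_def_inverse[OF P(2)] by metis
  have "gauge_shift S \<mu> \<in> gauge_space" using range_gauge_shift[OF S] by blast
  then have "B ** (P ** gauge_shift S \<mu>) \<in> range (gauge_shift S)"
    unfolding range_gauge_shift[OF S] by (intro gauge_space_mult)
  then obtain \<mu>' where \<mu>': "gauge_shift S \<mu>' = B ** (P ** gauge_shift S \<mu>)" by auto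
  have H: "H_gauge S \<Lambda> \<mu> = H_stab S \<Lambda> + gauge_shift S \<mu>" for \<Lambda> \<mu>
    by (simp add: H_gauge_def gauge_shift_def)
  have "G_mat S \<Lambda>' \<mu>' = symmetrize (P' ** (H_stab S \<Lambda>' + gauge_shift S \<mu>'))"
    unfolding P'_def H[symmetric] using P by (intro G_mat_eq_symmetrize) (auto simp: P'_def pos_def_def)
  also have "P' ** (H_stab S \<Lambda>' + gauge_shift S \<mu>') = P' ** H_stab S \<Lambda>' + P ** gauge_shift S \<mu>"
    by (simp add: matrix_add_ldistrib \<mu>' matrix_mul_assoc B)
  also have "\<dots> = P ** (H_stab S \<Lambda> + gauge_shift S \<mu>) + (P' ** H_stab S \<Lambda>' - P ** H_stab S \<Lambda>)"
    by (simp add: matrix_add_ldistrib)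
  also have "symmetrize \<dots> = symmetrize (P ** (H_stab S \<Lambda> + gauge_shift S \<mu>))
      + symmetrize (P' ** H_stab S \<Lambda>' - P ** H_stab S \<Lambda>)"
    by (rule linear_add[OF linear_symmetrize])
  also have "symmetrize (P ** (H_stab S \<Lambda> + gauge_shift S \<mu>)) = G_mat S \<Lambda> \<mu>"
    unfolding P_def H[symmetric]
    using P by (intro G_mat_eq_symmetrize[symmetric]) (auto simp: P_def pos_def_def)
  finally show thesis using that by (simp add: P_def P'_def)
qed

lemma J_norm_le_iff:
  fixes S :: "('n::finite, 'm::{finite,linorder}, 'd::finite) lifted_system"
  assumes S: "lifted_system_ok S" and \<Lambda>: "\<Lambda> \<in> feasible S" and c: "0 \<le> c"
  shows "spectral_norm (J_mat S \<Lambda> \<mu>) \<le> c \<longleftrightarrow>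
    (\<forall>x w. (G_mat S \<Lambda> \<mu> *v x) \<bullet> w \<le> c * norm x * sqrt (kron_form (lyap_P S \<Lambda>) w))"
proof -
  define B where "B = chol S \<Lambda>"
  have B: "transpose B ** B = lyap_P S \<Lambda>"
    using S \<Lambda> by (simp add: lifted_system_ok_def B_def)
  have "pos_def (lyap_P S \<Lambda>)" using \<Lambda> by (rule lyap_P_solution)
  then obtain C where "C ** lyap_P S \<Lambda> = mat 1" by (rule pos_def_inverse)
  then have "(C ** transpose B) ** B = mat 1" by (simp add: B flip: matrix_mul_assoc)
  then have "kron_mat (C ** transpose B) (mat 1) ** kron_mat B (mat 1 :: real^('n + 'm)^('n + 'm)) = mat 1"
    by (simp add: kron_mat_mult kron_mat_one)
  from spectral_norm_inv_transpose_le_iff[OF this c] show ?thesis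
    by (simp add: J_mat_def transpose_kron_mat transpose_mat norm_kron_factor[OF B] flip: B_def)
qed

lemma spectral_norm_nonneg: "0 \<le> spectral_norm A"
  unfolding spectral_norm_def by (intro onorm_pos_le matrix_vector_mul_bounded_linear)

lemma phi_le: "phi S \<Lambda> \<le> spectral_norm (J_mat S \<Lambda> \<mu>)"
  unfolding phi_def by (rule cINF_lower) (auto intro!: bdd_belowI2[of _ 0] spectral_norm_nonneg)

lemma phi_nonneg: "0 \<le> phi S \<Lambda>"
  unfolding phi_def by (rule cINF_greatest) (auto intro!: spectral_norm_nonneg)

text \<open>The form is a sum of values of the form of \<open>P\<close>, one for each value of the second index.\<close>

lemma kron_form_pos:
  assumes "pos_def P" "w \<noteq> 0"
  shows "kron_form P w > 0"
proof -
  have form: "kron_form P w = (\<Sum>j\<in>UNIV. (\<chi> i. w $ (i, j)) \<bullet> (P *v (\<chi> i. w $ (i, j))))"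
  proof -
    have "(kron_mat P (mat 1) *v w) $ (i, j) = (P *v (\<chi> i. w $ (i, j))) $ i" for i j
      by (simp add: kron_mat_def matrix_vector_mult_def mat_def UNIV_Times_UNIV[symmetric]
          sum.cartesian_product' if_distrib[of "\<lambda>x. _ * x"] if_distrib[of "\<lambda>x. x * _"]
          del: UNIV_Times_UNIV cong: if_cong)
    then have "kron_form P w = (\<Sum>i\<in>UNIV. \<Sum>j\<in>UNIV. w $ (i, j) * (P *v (\<chi> i. w $ (i, j))) $ i)"
      by (simp add: kron_form_def inner_vec_def UNIV_Times_UNIV[symmetric]
          sum.cartesian_product' del: UNIV_Times_UNIV)
    also have "\<dots> = (\<Sum>j\<in>UNIV. \<Sum>i\<in>UNIV. w $ (i, j) * (P *v (\<chi> i. w $ (i, j))) $ i)"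
      by (rule sum.swap)
    finally show ?thesis by (simp add: inner_vec_def)
  qed
  obtain i j where "w $ (i, j) \<noteq> 0"
    using assms(2) by (metis surj_pair vec_eq_iff zero_index)
  then have "(\<chi> i. w $ (i, j)) \<noteq> 0" by (auto simp: vec_eq_iff)
  then have pos: "(\<chi> i. w $ (i, j)) \<bullet> (P *v (\<chi> i. w $ (i, j))) > 0"
    using assms(1) by (simp add: pos_def_def)
  have "v \<bullet> (P *v v) \<ge> 0" for v
    using assms(1) by (cases "v = 0") (auto simp: pos_def_def intro: less_imp_le)
  then show ?thesis
    unfolding form by (intro sum_pos2[where i = j]) (use pos in auto)
qed

text \<open>The same translation of \<open>G\<close> serves all \<open>\<mu>\<close>, so the infimum over \<open>\<mu>\<close> can be taken at the end.\<close>

lemma phi_perturbation: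
  fixes S :: "('n::finite, 'm::{finite,linorder}, 'd::finite) lifted_system"
  assumes S: "lifted_system_ok S" and \<Lambda>: "\<Lambda> \<in> feasible S" "\<Lambda>' \<in> feasible S"
    and ab: "0 \<le> a" "0 \<le> b"
    and form: "\<And>w. kron_form (lyap_P S \<Lambda>) w \<le> (1 + a)\<^sup>2 * kron_form (lyap_P S \<Lambda>') w"
    and shift: "\<And>x w. (symmetrize (lyap_P S \<Lambda>' ** H_stab S \<Lambda>' - lyap_P S \<Lambda> ** H_stab S \<Lambda>) *v x) \<bullet> w
      \<le> b * norm x * sqrt (kron_form (lyap_P S \<Lambda>') w)"
  shows "phi S \<Lambda>' \<le> (1 + a) * phi S \<Lambda> + b"
proof -
  define Q where "Q = (\<lambda>w. sqrt (kron_form (lyap_P S \<Lambda>) w))"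
  define Q' where "Q' = (\<lambda>w. sqrt (kron_form (lyap_P S \<Lambda>') w))"
  have QQ': "Q w \<le> (1 + a) * Q' w" for w
    using real_sqrt_le_mono[OF form[of w]] ab by (simp add: Q_def Q'_def real_sqrt_mult)
  have "phi S \<Lambda>' \<le> (1 + a) * spectral_norm (J_mat S \<Lambda> \<mu>) + b" for \<mu>
  proof -
    define c where "c = spectral_norm (J_mat S \<Lambda> \<mu>)"
    have c: "0 \<le> c" by (simp add: c_def spectral_norm_nonneg)
    obtain \<mu>' where \<mu>': "G_mat S \<Lambda>' \<mu>' = G_mat S \<Lambda> \<mu>
        + symmetrize (lyap_P S \<Lambda>' ** H_stab S \<Lambda>' - lyap_P S \<Lambda> ** H_stab S \<Lambda>)"
      using G_mat_transfer[OF S \<Lambda>] by metis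
    have "(G_mat S \<Lambda>' \<mu>' *v x) \<bullet> w \<le> ((1 + a) * c + b) * norm x * Q' w" for x w
    proof -
      have "(G_mat S \<Lambda> \<mu> *v x) \<bullet> w \<le> c * norm x * Q w"
        using J_norm_le_iff[OF S \<Lambda>(1) c, of \<mu>] by (simp add: c_def Q_def)
      also have "\<dots> \<le> c * norm x * ((1 + a) * Q' w)"
        using QQ' c by (intro mult_left_mono) auto
      finally have 1: "(G_mat S \<Lambda> \<mu> *v x) \<bullet> w \<le> c * norm x * ((1 + a) * Q' w)" .
      have "(G_mat S \<Lambda>' \<mu>' *v x) \<bullet> w \<le> c * norm x * ((1 + a) * Q' w) + b * norm x * Q' w"
        unfolding \<mu>' matrix_vector_mult_add_rdistrib inner_add_left Q'_def
        using add_mono[OF 1 shift[of x w]] by (simp add: Q'_def)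
      then show ?thesis by (simp add: algebra_simps)
    qed
    then have "spectral_norm (J_mat S \<Lambda>' \<mu>') \<le> (1 + a) * c + b"
      using ab c by (subst J_norm_le_iff[OF S \<Lambda>(2)]) (auto simp: Q'_def)
    then show ?thesis
      using phi_le[of S \<Lambda>' \<mu>'] by (simp add: c_def)
  qed
  then have "(phi S \<Lambda>' - b) / (1 + a) \<le> spectral_norm (J_mat S \<Lambda> \<mu>)" for \<mu>
    using ab by (simp add: pos_divide_le_eq mult.commute diff_le_eq)
  then have "(phi S \<Lambda>' - b) / (1 + a) \<le> phi S \<Lambda>"
    unfolding phi_def[of S \<Lambda>] by (intro cINF_greatest) auto
  then show ?thesis
    using ab by (simp add: pos_divide_le_eq mult.commute diff_le_eq)
qed

lemma affine_lipschitz: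
  fixes F :: "'a::euclidean_space \<Rightarrow> 'b::real_normed_vector"
  assumes "linear (\<lambda>x. F x - c)"
  obtains K where "K \<ge> 0" "\<And>x y. norm (F x - F y) \<le> K * norm (x - y)"
proof -
  have "bounded_linear (\<lambda>x. F x - c)" using assms by (simp add: linear_conv_bounded_linear)
  then obtain K where K: "K > 0" "\<And>x. norm (F x - c) \<le> norm x * K"
    using bounded_linear.pos_bounded by blast
  have "norm (F x - F y) \<le> K * norm (x - y)" for x y
    using K(2)[of "x - y"] linear_diff[OF assms, of x y] by (simp add: mult.commute)
  with K(1) show thesis by (intro that[of K]) auto
qed

lemma A_stab_affine: "linear (\<lambda>\<Lambda>. A_stab S \<Lambda> - A_ref S)"
  by (intro linearI)
     (simp_all add: A_stab_def scaleR_add_left sum.distrib scaleR_sum_right)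

lemma H_stab_affine: "linear (\<lambda>\<Lambda>. H_stab S \<Lambda> - H_ref S)"
  by (intro linearI)
     (simp_all add: H_stab_def scaleR_add_left sum.distrib scaleR_sum_right)

lemma bounded_bilinear_matrix_mult:
  "bounded_bilinear ((**) :: real^'b^'a \<Rightarrow> real^'c^'b \<Rightarrow> real^'c^'a)"
  unfolding bilinear_conv_bounded_bilinear[symmetric] bilinear_def
  by (auto simp: matrix_add_ldistrib matrix_matrix_add_rdistrib scalar_matrix_assoc matrix_scalar_ac
      intro!: linearI)

lemma kron_form_lipschitz:
  obtains K where "K > 0" "\<And>P P' w. \<bar>kron_form (P :: real^'k^'k) w - kron_form P' w\<bar> \<le> K * norm (P - P') * (norm w)\<^sup>2"
proof -
  define f where "f = (\<lambda>(P :: real^'k^'k) w. kron_mat P (mat 1 :: real^'k^'k) *v w)"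
  have kron_add: "kron_mat (P + P') B = kron_mat P B + kron_mat P' B"
    and kron_scale: "kron_mat (r *\<^sub>R P) B = r *\<^sub>R kron_mat P B" for P P' B :: "real^'k^'k" and r
    by (simp_all add: kron_mat_def vec_eq_iff distrib_right)
  have "bounded_bilinear f"
    unfolding bilinear_conv_bounded_bilinear[symmetric] bilinear_def f_def
    by (auto simp: kron_add kron_scale matrix_vector_mult_add_rdistrib matrix_vector_right_distrib
      scaleR_matrix_vector_assoc matrix_vector_mult_scaleR intro!: linearI)
  then interpret f: bounded_bilinear f .
  obtain K where K: "K > 0" "\<And>P w. norm (f P w) \<le> norm P * norm w * K"
    using f.pos_bounded by blast
  have "\<bar>kron_form P w - kron_form P' w\<bar> \<le> K * norm (P - P') * (norm w)\<^sup>2" for P P' :: "real^'k^'k" and w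
  proof -
    have "kron_form P w - kron_form P' w = w \<bullet> f (P - P') w"
      unfolding f.diff_left by (simp add: kron_form_def f_def inner_diff_right)
    also have "\<bar>\<dots>\<bar> \<le> norm w * norm (f (P - P') w)" by (rule Cauchy_Schwarz_ineq2)
    also have "\<dots> \<le> norm w * (norm (P - P') * norm w * K)" by (intro mult_left_mono K) auto
    finally show ?thesis by (simp add: power2_eq_square mult_ac)
  qed
  with K(1) show thesis by (rule that)
qed

lemma norm_le_near:
  fixes F :: "'a::real_normed_vector \<Rightarrow> 'b::real_normed_vector"
  assumes "norm (F x - F x0) \<le> K * norm (x - x0)" "norm (x - x0) < 1" "0 \<le> K"
  shows "norm (F x) \<le> norm (F x0) + K"
proof -
  have "norm (F x) \<le> norm (F x0) + norm (F x - F x0)"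
    by (metis add.commute diff_add_cancel norm_triangle_ineq)
  moreover have "K * norm (x - x0) \<le> K" using assms(2,3) by (simp add: mult_left_le)
  ultimately show ?thesis using assms(1) by linarith
qed

text \<open>Near \<open>\<Lambda>0\<close> both constants in \<open>phi_perturbation\<close> can be taken \<open>O(\<parallel>\<Lambda> - \<Lambda>'\<parallel>)\<close>: the solution of the Lyapunov
  equation is Lipschitz in \<open>A\<close>, hence in \<open>\<Lambda>\<close>, and its form stays bounded below by a positive multiple \<open>q\<close> of the
  squared norm.\<close>

theorem phi_locally_lipschitz:
  fixes S :: "('n::finite, 'm::{finite,linorder}, 'd::finite) lifted_system"
  assumes S: "lifted_system_ok S" and V: "open V" "V \<subseteq> feasible S" "\<Lambda>0 \<in> V"
  obtains \<rho> L where "\<rho> > 0" "ball \<Lambda>0 \<rho> \<subseteq> V" "L-lipschitz_on (ball \<Lambda>0 \<rho>) (phi S)"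
proof -
  define P where "P = lyap_P S"
  define n where "n = (\<lambda>u v :: real^'m::{finite,linorder}. norm (u - v))"
  have \<Lambda>0: "\<Lambda>0 \<in> feasible S" using V by blast
  obtain \<rho>1 where \<rho>1: "\<rho>1 > 0" "ball \<Lambda>0 \<rho>1 \<subseteq> V" using V by (meson openE)
  obtain KA where KA: "KA \<ge> 0" "\<And>u v. norm (A_stab S u - A_stab S v) \<le> KA * norm (u - v)"
    using affine_lipschitz[OF A_stab_affine] by blast
  obtain KH where KH: "KH \<ge> 0" "\<And>u v. norm (H_stab S u - H_stab S v) \<le> KH * norm (u - v)"
    using affine_lipschitz[OF H_stab_affine] by blast
  have "hurwitz (A_stab S \<Lambda>0)" using \<Lambda>0 by (simp add: feasible_def)
  then obtain \<delta> C where \<delta>: "\<delta> > 0" "C \<ge> 0"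
    "\<And>A B X Y. norm (A - A_stab S \<Lambda>0) < \<delta> \<Longrightarrow> norm (B - A_stab S \<Lambda>0) < \<delta> \<Longrightarrow> lyap_op A X = - mat 1 \<Longrightarrow>
      lyap_op B Y = - mat 1 \<Longrightarrow> norm (X - Y) \<le> C * norm (A - B)"
    using lyap_solution_lipschitz by metis
  define \<rho>2 where "\<rho>2 = min (min \<rho>1 1) (\<delta> / (KA + 1))"
  have \<rho>2: "\<rho>2 > 0" using \<rho>1 \<delta>(1) KA(1) by (simp add: \<rho>2_def)
  have feas: "u \<in> feasible S" if "n u \<Lambda>0 < \<rho>2" for u
    using that \<rho>1(2) V(2) by (auto simp: n_def \<rho>2_def dist_norm norm_minus_commute)
  define KP where "KP = C * KA"
  have KP0: "KP \<ge> 0" using \<delta>(2) KA(1) by (simp add: KP_def)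
  have KP: "norm (P u - P v) \<le> KP * n u v" if "n u \<Lambda>0 < \<rho>2" "n v \<Lambda>0 < \<rho>2" for u v
  proof -
    have close: "norm (A_stab S x - A_stab S \<Lambda>0) < \<delta>" if "n x \<Lambda>0 < \<rho>2" for x
    proof -
      have "norm (A_stab S x - A_stab S \<Lambda>0) \<le> (KA + 1) * n x \<Lambda>0"
        using KA(2)[of x \<Lambda>0] norm_ge_zero[of "x - \<Lambda>0"] unfolding n_def distrib_right by linarith
      also have "\<dots> < \<delta>" using that KA(1) by (simp add: \<rho>2_def field_simps)
      finally show ?thesis .
    qed
    have "norm (P u - P v) \<le> C * norm (A_stab S u - A_stab S v)"
      using that unfolding P_def by (intro \<delta>(3) close lyap_P_solution feas)
    also have "\<dots> \<le> C * (KA * n u v)" unfolding n_def by (intro mult_left_mono KA \<delta>)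
    finally show ?thesis by (simp add: KP_def)
  qed
  have n1: "norm (u - \<Lambda>0) < 1" if "n u \<Lambda>0 < \<rho>2" for u
    using that by (simp add: n_def \<rho>2_def)
  define bP where "bP = norm (P \<Lambda>0) + KP"
  define bH where "bH = norm (H_stab S \<Lambda>0) + KH"
  have bP: "norm (P u) \<le> bP" if "n u \<Lambda>0 < \<rho>2" for u
    unfolding bP_def using KP[of u \<Lambda>0] that \<rho>2 n1[OF that] KP0
    by (intro norm_le_near) (auto simp: n_def)
  have bH: "norm (H_stab S u) \<le> bH" if "n u \<Lambda>0 < \<rho>2" for u
    unfolding bH_def using KH n1[OF that] by (intro norm_le_near) auto
  interpret mm: bounded_bilinear "(**) :: real^('n + 'm)^('n + 'm) \<Rightarrow> real^(('n + 'm) \<times> ('n + 'm))^('n + 'm) \<Rightarrow> _"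
    by (rule bounded_bilinear_matrix_mult)
  obtain M where M: "M > 0" "\<And>(X :: real^('n + 'm)^('n + 'm)) (Y :: real^(('n + 'm) \<times> ('n + 'm))^('n + 'm)).
      norm (X ** Y) \<le> norm X * norm Y * M"
    using mm.pos_bounded by blast
  interpret mv: bounded_bilinear "(*v) :: real^('n + 'm)^(('n + 'm) \<times> ('n + 'm)) \<Rightarrow> _ \<Rightarrow> _"
    by (rule bounded_bilinear_matrix_vector)
  obtain M' where M': "M' > 0" "\<And>(X :: real^('n + 'm)^(('n + 'm) \<times> ('n + 'm))) y. norm (X *v y) \<le> norm X * norm y * M'"
    using mv.pos_bounded by blast
  obtain Ks where Ks: "Ks > 0" "\<And>T :: real^(('n + 'm) \<times> ('n + 'm))^('n + 'm). norm (symmetrize T) \<le> norm T * Ks"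
    using linear_symmetrize bounded_linear.pos_bounded unfolding linear_conv_bounded_linear by blast
  define Kg where "Kg = M * (KP * bH + bP * KH) * Ks"
  have Kg: "norm (symmetrize (P v ** H_stab S v - P u ** H_stab S u)) \<le> Kg * n u v"
    if "n u \<Lambda>0 < \<rho>2" "n v \<Lambda>0 < \<rho>2" for u v
  proof -
    let ?D = "P v ** H_stab S v - P u ** H_stab S u"
    have "?D = (P v - P u) ** H_stab S v + P u ** (H_stab S v - H_stab S u)"
      by (simp add: mm.diff_left mm.diff_right)
    also have "norm \<dots> \<le> norm (P v - P u) * norm (H_stab S v) * M
        + norm (P u) * norm (H_stab S v - H_stab S u) * M"
      by (intro norm_triangle_le add_mono M)
    also have "\<dots> \<le> (KP * n v u) * bH * M + bP * (KH * n v u) * M"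
      using bP[OF that(1)] bH[OF that(2)] KP[OF that(2,1)] KH M(1) KP0 order_trans[OF norm_ge_zero bP[OF that(1)]]
      by (intro add_mono mult_right_mono mult_mono) (auto simp: n_def)
    also have "\<dots> = M * (KP * bH + bP * KH) * n u v"
      by (simp add: n_def norm_minus_commute algebra_simps)
    finally have "norm ?D * Ks \<le> M * (KP * bH + bP * KH) * n u v * Ks"
      using Ks(1) by (intro mult_right_mono) auto
    with Ks(2)[of ?D] show ?thesis
      by (simp add: Kg_def mult_ac)
  qed
  obtain KQ where KQ: "KQ > 0" "\<And>P P' w. \<bar>kron_form (P :: real^('n + 'm)^('n + 'm)) w - kron_form P' w\<bar>
      \<le> KQ * norm (P - P') * (norm w)\<^sup>2"
    by (rule kron_form_lipschitz) (rule that)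
  have "pos_def (P \<Lambda>0)" unfolding P_def using \<Lambda>0 by (rule lyap_P_solution)
  then have "w \<bullet> (kron_mat (P \<Lambda>0) (mat 1 :: real^('n + 'm)^('n + 'm)) *v w) > 0" if "w \<noteq> 0" for w
    using kron_form_pos[OF _ that] by (simp add: kron_form_def)
  then obtain p where p: "p > 0" "\<And>w. p * (w \<bullet> w) \<le> w \<bullet> (kron_mat (P \<Lambda>0) (mat 1 :: real^('n + 'm)^('n + 'm)) *v w)"
    using pos_def_lower_bound by metis
  define q where "q = p / 2"
  have q: "q > 0" using p(1) by (simp add: q_def)
  define \<rho> where "\<rho> = min \<rho>2 (q / (KQ * KP + 1))"
  have \<rho>: "\<rho> > 0" using \<rho>2 q KQ(1) KP0 by (simp add: \<rho>_def add_nonneg_pos)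
  have \<rho>_le: "n u \<Lambda>0 < \<rho>2" if "n u \<Lambda>0 < \<rho>" for u using that by (simp add: \<rho>_def)
  have form_lower: "q * (norm w)\<^sup>2 \<le> kron_form (P u) w" if "n u \<Lambda>0 < \<rho>" for u w
  proof -
    have "KQ * norm (P u - P \<Lambda>0) \<le> KQ * (KP * n u \<Lambda>0)"
      using KP[OF \<rho>_le[OF that], of \<Lambda>0] KQ(1) \<rho>2 by (intro mult_left_mono) (auto simp: n_def)
    also have "\<dots> \<le> (KQ * KP + 1) * n u \<Lambda>0" by (simp add: n_def algebra_simps)
    also have "\<dots> \<le> q"
      using that KQ(1) KP0 by (simp add: \<rho>_def pos_less_divide_eq add_nonneg_pos mult.commute)
    finally have "KQ * norm (P u - P \<Lambda>0) * (norm w)\<^sup>2 \<le> q * (norm w)\<^sup>2"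
      by (intro mult_right_mono) auto
    moreover have "2 * q * (norm w)\<^sup>2 \<le> kron_form (P \<Lambda>0) w"
      using p(2)[of w] by (simp add: q_def kron_form_def power2_norm_eq_inner)
    ultimately show ?thesis using KQ(2)[of "P u" w "P \<Lambda>0"] by linarith
  qed
  define a where "a = KQ * KP / q"
  define b where "b = Kg * M' / sqrt q"
  have a0: "a \<ge> 0" using KQ(1) KP0 q by (simp add: a_def)
  have bP0: "bP \<ge> 0" "bH \<ge> 0" using KP0 KH(1) by (simp_all add: bP_def bH_def)
  have "Kg \<ge> 0" using M(1) Ks(1) KP0 KH(1) bP0 by (simp add: Kg_def)
  then have b0: "b \<ge> 0" using M'(1) q by (simp add: b_def)
  have step: "phi S v \<le> (1 + a * n u v) * phi S u + b * n u v"
    if u: "n u \<Lambda>0 < \<rho>" and v: "n v \<Lambda>0 < \<rho>" for u v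
  proof (rule phi_perturbation[OF S feas[OF \<rho>_le[OF u]] feas[OF \<rho>_le[OF v]], folded P_def])
    have n0: "n u v \<ge> 0" by (simp add: n_def)
    show "0 \<le> a * n u v" "0 \<le> b * n u v" using a0 b0 n0 by simp_all
    fix w
    have w2: "(norm w)\<^sup>2 \<le> kron_form (P v) w / q"
      using form_lower[OF v, of w] q by (simp add: pos_le_divide_eq mult.commute)
    have "0 \<le> q * (norm w)\<^sup>2" using q by simp
    then have form0: "kron_form (P v) w \<ge> 0" using form_lower[OF v, of w] by linarith
    have "kron_form (P u) w \<le> kron_form (P v) w + KQ * norm (P u - P v) * (norm w)\<^sup>2"
      using KQ(2)[of "P u" w "P v"] by linarith
    also have "\<dots> \<le> kron_form (P v) w + KQ * (KP * n u v) * (kron_form (P v) w / q)"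
      using KP[OF \<rho>_le[OF u] \<rho>_le[OF v]] KQ(1) KP0 n0 w2
      by (intro add_left_mono mult_mono mult_left_mono) auto
    also have "\<dots> = (1 + a * n u v) * kron_form (P v) w"
      by (simp add: a_def algebra_simps)
    also have "\<dots> \<le> (1 + a * n u v)\<^sup>2 * kron_form (P v) w"
      using a0 n0 form0 by (intro mult_right_mono) (auto simp: power2_eq_square algebra_simps)
    finally show "kron_form (P u) w \<le> (1 + a * n u v)\<^sup>2 * kron_form (P v) w" .
    have sqrt_w: "norm w \<le> sqrt (kron_form (P v) w) / sqrt q"
      using real_sqrt_le_mono[OF w2] by (simp add: real_sqrt_divide)
    fix x
    let ?D = "symmetrize (P v ** H_stab S v - P u ** H_stab S u)"
    have "(?D *v x) \<bullet> w
        \<le> norm (?D *v x) * norm w"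
      by (rule norm_cauchy_schwarz)
    also have "\<dots> \<le> (Kg * n u v * norm x * M') * (sqrt (kron_form (P v) w) / sqrt q)"
    proof (rule mult_mono)
      have "norm (?D *v x)
          \<le> norm (?D) * norm x * M'" by (rule M')
      also have "\<dots> \<le> (Kg * n u v) * norm x * M'"
        using Kg[OF \<rho>_le[OF u] \<rho>_le[OF v]] M'(1) by (intro mult_right_mono) auto
      finally show "norm (?D *v x)
          \<le> Kg * n u v * norm x * M'" .
      show "0 \<le> Kg * n u v * norm x * M'" using \<open>Kg \<ge> 0\<close> n0 M'(1) by simp
    qed (use sqrt_w in auto)
    also have "\<dots> = b * n u v * norm x * sqrt (kron_form (P v) w)"
      by (simp add: b_def mult_ac)
    finally show "(?D *v x) \<bullet> w
        \<le> b * n u v * norm x * sqrt (kron_form (P v) w)" .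
  qed
  define F where "F = (1 + a) * phi S \<Lambda>0 + b"
  have F: "phi S u \<le> F" if "n u \<Lambda>0 < \<rho>" for u
  proof -
    have "n \<Lambda>0 u \<le> 1" "n \<Lambda>0 u \<ge> 0"
      using n1[OF \<rho>_le[OF that]] by (simp_all add: n_def norm_minus_commute)
    then have "(1 + a * n \<Lambda>0 u) * phi S \<Lambda>0 + b * n \<Lambda>0 u \<le> F"
      unfolding F_def using a0 b0 phi_nonneg[of S \<Lambda>0]
      by (intro add_mono mult_right_mono) (auto simp: mult_left_le)
    with step[of \<Lambda>0 u] that \<rho> show ?thesis by (simp add: n_def)
  qed
  have "(a * F + b)-lipschitz_on (ball \<Lambda>0 \<rho>) (phi S)"
  proof (rule lipschitz_onI)
    fix u v assume "u \<in> ball \<Lambda>0 \<rho>" "v \<in> ball \<Lambda>0 \<rho>"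
    then have in_ball: "n u \<Lambda>0 < \<rho>" "n v \<Lambda>0 < \<rho>" by (simp_all add: n_def dist_norm norm_minus_commute)
    have "phi S y \<le> phi S x + (a * F + b) * n x y" if "n x \<Lambda>0 < \<rho>" "n y \<Lambda>0 < \<rho>" for x y
    proof -
      have "phi S y \<le> phi S x + (a * n x y) * phi S x + b * n x y"
        using step[OF that] by (simp add: algebra_simps)
      also have "(a * n x y) * phi S x \<le> (a * n x y) * F"
        using F[OF that(1)] a0 by (intro mult_left_mono) (auto simp: n_def)
      finally show ?thesis by (simp add: algebra_simps)
    qed
    from this[OF in_ball] this[OF in_ball(2,1)]
    show "dist (phi S u) (phi S v) \<le> (a * F + b) * dist u v"
      by (simp add: dist_real_def dist_norm n_def norm_minus_commute abs_le_iff)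
  next
    have "0 \<le> F" using F[of \<Lambda>0] phi_nonneg[of S \<Lambda>0] \<rho> by (simp add: n_def)
    then show "0 \<le> a * F + b" using a0 b0 by simp
  qed
  moreover have "ball \<Lambda>0 \<rho> \<subseteq> V"
    using \<rho>1(2) by (auto simp: \<rho>_def \<rho>2_def)
  ultimately show thesis using that \<rho> by blast
qed

section \<open>Runs of the gradient sampling algorithm\<close>

lemma in_unit_box: "(x :: real^'m) \<in> unit_box \<longleftrightarrow> (\<forall>i. 0 \<le> x $ i \<and> x $ i \<le> 1)"
  by (simp add: unit_box_def mem_box_cart)

locale gs_execution =
  fixes f :: "real^'m \<Rightarrow> real" and X :: "(real^'m) set" and I :: "'m gs_input" and R :: "'m gs_trace"
  assumes input: "gs_input_ok I" and run: "gs_run f X I R"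
begin

lemma steps:
  assumes "reached R (Suc k)"
  shows "metric_step f I R k" "qp_step f I R k" "update_step f I R k"
  using assms run by (auto simp: gs_run_def reached_def less_Suc_eq)

lemma iterate_plus_dir_in_box:
  assumes "reached R (Suc k)"
  shows "iterate R k + dir R k \<in> unit_box"
proof -
  have "qp_feasible f I R k (dir R k, level R k)"
    using steps[OF assms] by (simp add: qp_step_def is_arg_min_def)
  then have le: "- iterate R k $ i \<le> dir R k $ i" "dir R k $ i \<le> 1 - iterate R k $ i" for i
    by (auto simp: qp_feasible_def less_eq_vec_def)
  have "0 \<le> iterate R k $ i + dir R k $ i \<and> iterate R k $ i + dir R k $ i \<le> 1" for i
    using le[of i] by linarith
  then show ?thesis by (simp add: in_unit_box)
qed

lemma bundle_le_level:
  assumes "reached R (Suc k)" "g \<in> bundle_set f I R k"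
  shows "g \<bullet> dir R k \<le> level R k"
proof -
  have "qp_feasible f I R k (dir R k, level R k)"
    using steps[OF assms(1)] by (simp add: qp_step_def is_arg_min_def)
  then show ?thesis using assms(2) by (auto simp: qp_feasible_def bundle_set_def)
qed

lemma backtrack_power: "0 < backtrack I ^ l" "backtrack I ^ l \<le> 1"
  using input by (auto simp: gs_input_ok_def intro: power_le_one)

lemma iterate_Suc_cases:
  assumes "reached R (Suc k)"
  obtains "iterate R (Suc k) = iterate R k"
  | l where "armijo_at f I R k l" "iterate R (Suc k) = iterate R k + backtrack I ^ l *\<^sub>R dir R k"
proof (cases "tol I k < chi R k \<and> (\<exists>l. armijo_at f I R k l)")
  case True
  then have "iterate R (Suc k) = iterate R k + backtrack I ^ (LEAST l. armijo_at f I R k l) *\<^sub>R dir R k"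
    using steps(3)[OF assms] by (auto simp: update_step_def)
  moreover have "armijo_at f I R k (LEAST l. armijo_at f I R k l)"
    using True by (metis LeastI)
  ultimately show thesis by (rule that(2)[rotated])
next
  case False
  then show thesis
    using steps(3)[OF assms] that(1) by (auto simp: update_step_def split: if_splits)
qed

lemma iterate_in_box: "reached R k \<Longrightarrow> iterate R k \<in> unit_box"
proof (induction k)
  case 0
  then show ?case using input run by (simp add: gs_run_def gs_input_ok_def)
next
  case (Suc k)
  then have box: "iterate R k \<in> unit_box" by (simp add: reached_def)
  show ?case
  proof (cases rule: iterate_Suc_cases[OF Suc.prems])
    case 1
    then show ?thesis using box by simp
  next
    case (2 l)
    define t where "t = backtrack I ^ l"
    have "convex (unit_box :: (real^'m) set)" by (simp add: unit_box_def convex_box)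
    moreover have "iterate R k + t *\<^sub>R dir R k
        = (1 - t) *\<^sub>R iterate R k + t *\<^sub>R (iterate R k + dir R k)"
      by (simp add: algebra_simps)
    ultimately show ?thesis
      using 2(2) box iterate_plus_dir_in_box[OF Suc.prems] backtrack_power[of l]
      by (simp add: convex_alt t_def)
  qed
qed

lemma step_decreasing:
  assumes "reached R (Suc k)"
  shows "f (iterate R (Suc k)) \<le> f (iterate R k)"
proof (cases rule: iterate_Suc_cases[OF assms])
  case (2 l)
  have "0 \<le> armijo_c I * backtrack I ^ l * (chi R k)\<^sup>2"
    using input backtrack_power[of l] by (simp add: gs_input_ok_def)
  with 2 show ?thesis by (simp add: armijo_at_def)
qed simp

lemma decreasing:
  assumes "j \<le> k" "reached R k"
  shows "f (iterate R k) \<le> f (iterate R j)"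
  using assms
proof (induction k rule: dec_induct)
  case (step k)
  then have "f (iterate R k) \<le> f (iterate R j)" by (simp add: reached_def)
  with step_decreasing[OF step.prems] show ?case by simp
qed simp

lemma aggregate_in_hull:
  assumes "reached R (Suc k)"
  shows "aggregate f I R k \<in> convex hull (bundle_set f I R k)"
proof -
  have "qp_multiplier f I R k" using steps[OF assms] by (simp add: qp_step_def)
  then show ?thesis
    unfolding aggregate_def qp_multiplier_def
    by (intro convex_sum convex_convex_hull) (auto simp: bundle_set_def intro!: hull_inc)
qed

lemma aggregate_dot_dir:
  assumes "reached R (Suc k)"
  shows "aggregate f I R k \<bullet> dir R k = level R k"
proof -
  have m: "qp_multiplier f I R k" using steps[OF assms] by (simp add: qp_step_def)
  have "aggregate f I R k \<bullet> dir R k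
      = (\<Sum>j<bundle_size I k. mult R k j * (bundle_grad f R k j \<bullet> dir R k))"
    by (simp add: aggregate_def inner_sum_left)
  also have "\<dots> = (\<Sum>j<bundle_size I k. mult R k j * level R k)"
    using m by (intro sum.cong) (auto simp: qp_multiplier_def algebra_simps)
  also have "\<dots> = (\<Sum>j<bundle_size I k. mult R k j) * level R k"
    by (rule sum_distrib_right[symmetric])
  also have "\<dots> = level R k" using m by (simp add: qp_multiplier_def)
  finally show ?thesis .
qed

text \<open>The multipliers of the two box constraints combine to a normal vector because of complementarity.\<close>

lemma normal_multiplier:
  assumes "reached R (Suc k)"
  shows "- (metric R k *v dir R k + aggregate f I R k) \<in> normal_cone unit_box (iterate R k + dir R k)"
proof -
  have "qp_multiplier f I R k" using steps[OF assms] by (simp add: qp_step_def)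
  then obtain u v where uv: "u \<ge> 0" "v \<ge> 0"
    "\<And>i. u $ i * (dir R k $ i + iterate R k $ i) = 0"
    "\<And>i. v $ i * (dir R k $ i - (1 - iterate R k $ i)) = 0"
    and kkt: "metric R k *v dir R k + aggregate f I R k - u + v = 0"
    unfolding qp_multiplier_def by blast
  have eq: "- (metric R k *v dir R k + aggregate f I R k) = v - u"
    using kkt by (simp add: algebra_simps eq_neg_iff_add_eq_0)
  show ?thesis
    unfolding eq normal_cone_def
  proof (intro CollectI ballI)
    fix y :: "real^'m" assume y: "y \<in> unit_box"
    have "(v $ i - u $ i) * (y $ i - (iterate R k $ i + dir R k $ i)) \<le> 0" for i
    proof -
      have "0 \<le> u $ i" "0 \<le> v $ i" using uv(1,2) by (auto simp: less_eq_vec_def)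
      moreover have "0 \<le> y $ i" "y $ i \<le> 1" using y by (auto simp: in_unit_box)
      ultimately have 1: "v $ i * (y $ i - 1) \<le> 0" "0 \<le> u $ i * y $ i"
        by (auto simp: mult_nonneg_nonpos)
      have "v $ i * (y $ i - (iterate R k $ i + dir R k $ i)) = v $ i * (y $ i - 1)"
        "u $ i * (y $ i - (iterate R k $ i + dir R k $ i)) = u $ i * y $ i"
        using uv(3)[of i] uv(4)[of i] by (simp_all add: algebra_simps)
      with 1 show ?thesis unfolding left_diff_distrib[of "v $ i"] by argo
    qed
    then show "(v - u) \<bullet> (y - (iterate R k + dir R k)) \<le> 0"
      unfolding inner_vec_def by (intro sum_nonpos) auto
  qed
qed

text \<open>Testing the normal vector against the feasible point \<open>\<theta>\<^sup>k\<close> gives the predicted decrease.\<close>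

lemma level_le:
  assumes k: "reached R (Suc k)"
  shows "level R k \<le> - (dir R k \<bullet> (metric R k *v dir R k))"
proof -
  have "iterate R k \<in> unit_box" using k by (intro iterate_in_box) (simp add: reached_def)
  then have "- (metric R k *v dir R k + aggregate f I R k) \<bullet> (iterate R k - (iterate R k + dir R k)) \<le> 0"
    using normal_multiplier[OF k] unfolding normal_cone_def by blast
  then have "(metric R k *v dir R k) \<bullet> dir R k + aggregate f I R k \<bullet> dir R k \<le> 0"
    by (simp add: inner_add_left inner_diff_left)
  then show ?thesis using aggregate_dot_dir[OF k] by (simp add: inner_commute)
qed

lemma norm_dir_le:
  assumes k: "reached R (Suc k)"
  shows "norm (dir R k) \<le> real CARD('m)"
proof -
  have "iterate R k \<in> unit_box" using k by (intro iterate_in_box) (simp add: reached_def)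
  then have 1: "0 \<le> iterate R k $ i" "iterate R k $ i \<le> 1" for i by (simp_all add: in_unit_box)
  have 2: "0 \<le> iterate R k $ i + dir R k $ i" "iterate R k $ i + dir R k $ i \<le> 1" for i
    using iterate_plus_dir_in_box[OF k] by (simp_all add: in_unit_box)
  have "\<bar>dir R k $ i\<bar> \<le> 1" for i
    using 1[of i] 2[of i] by linarith
  then have "(\<Sum>i\<in>UNIV. \<bar>dir R k $ i\<bar>) \<le> (\<Sum>i\<in>(UNIV::'m set). 1)" by (intro sum_mono)
  with norm_le_l1_cart[of "dir R k"] show ?thesis by simp
qed

end

lemma infdist_le_hausdorff_dist:
  fixes S T :: "(real^'m) set"
  assumes "bounded S" "bounded T" "S \<noteq> {}" "T \<noteq> {}"
  shows "s \<in> S \<Longrightarrow> infdist s T \<le> hausdorff_dist S T" "t \<in> T \<Longrightarrow> infdist t S \<le> hausdorff_dist S T"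
proof -
  have bdd: "bdd_above ((\<lambda>a. infdist a B) ` A)" if AB: "bounded A" "B \<noteq> {}" for A B :: "(real^'m) set"
  proof -
    obtain b where b: "b \<in> B" using AB(2) by blast
    obtain r where r: "\<And>a. a \<in> A \<Longrightarrow> dist b a \<le> r" using AB(1) bounded_any_center by metis
    have "infdist a B \<le> r" if "a \<in> A" for a
      using infdist_le[OF b, of a] r[OF that] by (simp add: dist_commute)
    then show ?thesis by (rule bdd_aboveI2)
  qed
  show "infdist s T \<le> hausdorff_dist S T" if "s \<in> S"
    unfolding hausdorff_dist_def using cSUP_upper[OF that bdd[OF assms(1,4)]] by simp
  show "infdist t S \<le> hausdorff_dist S T" if "t \<in> T"
    unfolding hausdorff_dist_def using cSUP_upper[OF that bdd[OF assms(2,3)]] by simp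
qed

text \<open>By polarization, applied to \<open>d\<close> and to the multiple of \<open>M d\<close> that has the norm of \<open>d\<close>.\<close>

lemma norm_mult_le_loewner:
  fixes M :: "real^'k^'k"
  assumes sym: "transpose M = M" and psd: "\<And>v. 0 \<le> v \<bullet> (M *v v)" and le: "\<And>v. v \<bullet> (M *v v) \<le> h * (v \<bullet> v)"
  shows "norm (M *v d) \<le> h * norm d"
proof (cases "M *v d = 0 \<or> d = 0")
  case True
  have "0 \<le> h" if "d \<noteq> 0"
    using order_trans[OF psd[of d] le[of d]] that inner_gt_zero_iff[of d]
    by (auto simp: zero_le_mult_iff simp del: inner_gt_zero_iff)
  with True show ?thesis by (cases "d = 0") auto
next
  case False
  define y where "y = (norm d / norm (M *v d)) *\<^sub>R (M *v d)"
  have ny: "norm y = norm d" using False by (simp add: y_def)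
  have dMy: "d \<bullet> (M *v y) = y \<bullet> (M *v d)"
    using inner_transpose_mult[of d M y] sym by (simp add: inner_commute)
  have "4 * (y \<bullet> (M *v d)) = (y + d) \<bullet> (M *v (y + d)) - (y - d) \<bullet> (M *v (y - d))"
    by (simp add: matrix_vector_right_distrib matrix_vector_mult_diff_distrib inner_add_left inner_add_right
        inner_diff_left inner_diff_right dMy)
  also have "\<dots> \<le> h * ((y + d) \<bullet> (y + d)) + h * ((y - d) \<bullet> (y - d))"
    using le[of "y + d"] psd[of "y - d"] order_trans[OF psd[of "y - d"] le[of "y - d"]] by linarith
  also have "\<dots> = h * ((y + d) \<bullet> (y + d) + (y - d) \<bullet> (y - d))" by (simp add: distrib_left)
  also have "(y + d) \<bullet> (y + d) + (y - d) \<bullet> (y - d) = 2 * (y \<bullet> y) + 2 * (d \<bullet> d)"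
    by (simp add: inner_add_left inner_add_right inner_diff_left inner_diff_right)
  also have "h * \<dots> = 4 * (h * (norm d * norm d))"
    using ny by (simp add: power2_norm_eq_inner[symmetric] power2_eq_square)
  finally have "y \<bullet> (M *v d) \<le> h * (norm d * norm d)" by simp
  moreover have "y \<bullet> (M *v d) = norm d * norm (M *v d)"
    using False by (simp add: y_def power2_norm_eq_inner[symmetric] power2_eq_square)
  ultimately show ?thesis using False by simp
qed

section \<open>Accumulation points of infinite runs\<close>

locale gs_infinite_execution = gs_execution f X I R
  for f :: "real^'m \<Rightarrow> real" and X :: "(real^'m) set" and I :: "'m gs_input" and R :: "'m gs_trace" +
  assumes infinite: "\<And>k. reached R k"
    and local_lipschitz: "\<And>x. x \<in> unit_box \<Longrightarrow> \<exists>W L. open W \<and> x \<in> W \<and> W \<subseteq> X \<and> L-lipschitz_on W f"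
    and tol_0: "tol I \<longlonglongrightarrow> 0"
    and ls_cap: "filterlim (ls_cap I) at_top sequentially"
    and metric_bounds: "\<And>k. loewner_le (metric_lo I *\<^sub>R mat 1) (metric R k)"
      "\<And>k. loewner_le (metric R k) (metric_hi I *\<^sub>R mat 1)"
    and consistent: "gradient_consistent f X I R"
begin

lemma metric_form_bounds:
  "metric_lo I * (norm v)\<^sup>2 \<le> v \<bullet> (metric R k *v v)" "v \<bullet> (metric R k *v v) \<le> metric_hi I * (norm v)\<^sup>2"
  using metric_bounds[of k]
  by (auto simp: loewner_le_def power2_norm_eq_inner simp flip: scaleR_matrix_vector_assoc)

lemma metric_form_nonneg: "0 \<le> v \<bullet> (metric R k *v v)"
proof -
  have "0 \<le> metric_lo I * (norm v)\<^sup>2" using input by (simp add: gs_input_ok_def)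
  with metric_form_bounds(1)[of v k] show ?thesis by linarith
qed

lemma chi_squared: "(chi R k)\<^sup>2 = dir R k \<bullet> (metric R k *v dir R k)"
  using metric_form_nonneg by (simp add: chi_def)

lemma chi_nonneg: "0 \<le> chi R k"
  by (simp add: chi_def metric_form_nonneg)

lemma norm_dir_le_chi: "sqrt (metric_lo I) * norm (dir R k) \<le> chi R k"
proof -
  have "(sqrt (metric_lo I) * norm (dir R k))\<^sup>2 \<le> (chi R k)\<^sup>2"
    using metric_form_bounds(1)[of "dir R k" k] input
    by (simp add: chi_squared power_mult_distrib gs_input_ok_def)
  then show ?thesis using chi_nonneg by (rule power2_le_imp_le)
qed

lemma norm_metric_dir_le: "norm (metric R k *v dir R k) \<le> metric_hi I * norm (dir R k)"
proof (rule norm_mult_le_loewner)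
  show "transpose (metric R k) = metric R k" using metric_bounds(1)[of k] by (simp add: loewner_le_def)
  show "0 \<le> v \<bullet> (metric R k *v v)" for v by (rule metric_form_nonneg)
  show "v \<bullet> (metric R k *v v) \<le> metric_hi I * (v \<bullet> v)" for v
    using metric_form_bounds(2)[of v k] by (simp add: power2_norm_eq_inner)
qed

lemma hull_dot_dir_le:
  assumes "h \<in> convex hull (bundle_set f I R k)"
  shows "h \<bullet> dir R k \<le> - (chi R k)\<^sup>2"
proof -
  have "convex hull (bundle_set f I R k) \<subseteq> {h. h \<bullet> dir R k \<le> - (chi R k)\<^sup>2}"
  proof (rule hull_minimal)
    show "bundle_set f I R k \<subseteq> {h. h \<bullet> dir R k \<le> - (chi R k)\<^sup>2}"
      using bundle_le_level[OF infinite] level_le[OF infinite, of k] by (force simp: chi_squared)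
    show "convex {h. h \<bullet> dir R k \<le> - (chi R k)\<^sup>2}"
      using convex_halfspace_le[of "dir R k"] by (simp add: inner_commute)
  qed
  with assms show ?thesis by blast
qed

lemma bundle_hull:
  shows "compact (convex hull (bundle_set f I R k))" "convex hull (bundle_set f I R k) \<noteq> {}"
proof -
  have "finite (bundle_set f I R k)" by (simp add: bundle_set_def)
  then show "compact (convex hull (bundle_set f I R k))" by (rule finite_imp_compact_convex_hull)
  show "convex hull (bundle_set f I R k) \<noteq> {}" using aggregate_in_hull[OF infinite] by blast
qed

lemma subdiff_props:
  assumes "\<theta> \<in> unit_box"
  shows "compact (clarke_subdiff X f \<theta>)" "clarke_subdiff X f \<theta> \<noteq> {}"
proof -
  obtain W L where W: "open W" "\<theta> \<in> W" "W \<subseteq> X" "L-lipschitz_on W f"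
    using local_lipschitz[OF assms] by blast
  have "bounded (clarke_subdiff X f \<theta>)"
    by (rule bounded_subset[OF bounded_cball clarke_subdiff_bounded[OF W(4,1,2)]])
  then show "compact (clarke_subdiff X f \<theta>)"
    using closed_clarke_subdiff by (simp add: compact_eq_bounded_closed)
  show "clarke_subdiff X f \<theta> \<noteq> {}" by (rule clarke_subdiff_nonempty[OF W(4,1,2,3)])
qed

lemma hausdorff_bounds:
  assumes "\<theta> \<in> unit_box"
  shows "h \<in> convex hull (bundle_set f I R k) \<Longrightarrow> infdist h (clarke_subdiff X f \<theta>)
      \<le> hausdorff_dist (convex hull (bundle_set f I R k)) (clarke_subdiff X f \<theta>)"
    "g \<in> clarke_subdiff X f \<theta> \<Longrightarrow> infdist g (convex hull (bundle_set f I R k))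
      \<le> hausdorff_dist (convex hull (bundle_set f I R k)) (clarke_subdiff X f \<theta>)"
  using bundle_hull[of k] subdiff_props[OF assms]
  by (intro infdist_le_hausdorff_dist; simp add: compact_imp_bounded)+

lemma accumulation_in_box:
  assumes "(\<lambda>i. iterate R (r i)) \<longlonglongrightarrow> \<theta>"
  shows "\<theta> \<in> unit_box"
proof -
  have "closed (unit_box :: (real^'m) set)" by (simp add: unit_box_def closed_cbox)
  then show ?thesis
    by (rule closed_sequentially[rotated 2, OF assms]) (simp add: iterate_in_box infinite)
qed

text \<open>Vanishing \<open>\<chi>\<close> forces stationarity, by passing to the limit in the optimality conditions of the
  quadratic programs.\<close>

lemma stationary_if_chi_vanishes:
  assumes r: "strict_mono r" and lim: "(\<lambda>i. iterate R (r i)) \<longlonglongrightarrow> \<theta>" and chi: "(\<lambda>i. chi R (r i)) \<longlonglongrightarrow> 0"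
  shows "0 \<in> clarke_subdiff X f \<theta> + normal_cone unit_box \<theta>"
proof -
  define D where "D = clarke_subdiff X f \<theta>"
  define a where "a = (\<lambda>i. aggregate f I R (r i))"
  have box: "\<theta> \<in> unit_box" using lim by (rule accumulation_in_box)
  have D: "compact D" "D \<noteq> {}" using subdiff_props[OF box] by (simp_all add: D_def)
  have "\<exists>g\<in>D. infdist (a i) D = dist (a i) g" for i
    using infdist_attains_inf[OF compact_imp_closed[OF D(1)] D(2)] by metis
  then obtain g where g: "\<And>i. g i \<in> D" "\<And>i. infdist (a i) D = dist (a i) (g i)" by metis
  have haus: "(\<lambda>i. hausdorff_dist (convex hull (bundle_set f I R (r i))) D) \<longlonglongrightarrow> 0"
    using consistent r lim unfolding gradient_consistent_def D_def by blast
  have ag: "(\<lambda>i. a i - g i) \<longlonglongrightarrow> 0"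
  proof (rule Lim_null_comparison[OF _ haus])
    have "norm (a i - g i) \<le> hausdorff_dist (convex hull (bundle_set f I R (r i))) D" for i
      using hausdorff_bounds(1)[OF box aggregate_in_hull[OF infinite], of "r i"] g(2)[of i]
      by (simp add: a_def D_def dist_norm)
    then show "\<forall>\<^sub>F i in sequentially. norm (a i - g i)
        \<le> hausdorff_dist (convex hull (bundle_set f I R (r i))) D" by simp
  qed
  obtain g' s where s: "g' \<in> D" "strict_mono s" "(g \<circ> s) \<longlonglongrightarrow> g'"
    using D(1) g(1) unfolding compact_def by (metis (no_types, lifting))
  have lo: "metric_lo I > 0" using input by (simp add: gs_input_ok_def)
  have dir_0: "(\<lambda>i. dir R (r i)) \<longlonglongrightarrow> 0"
  proof (rule Lim_null_comparison)
    show "\<forall>\<^sub>F i in sequentially. norm (dir R (r i)) \<le> chi R (r i) / sqrt (metric_lo I)"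
      using norm_dir_le_chi lo by (simp add: pos_le_divide_eq mult.commute)
    show "(\<lambda>i. chi R (r i) / sqrt (metric_lo I)) \<longlonglongrightarrow> 0"
      using tendsto_divide[OF chi tendsto_const, of "sqrt (metric_lo I)"] lo by simp
  qed
  have metric_0: "(\<lambda>i. metric R (r i) *v dir R (r i)) \<longlonglongrightarrow> 0"
  proof (rule Lim_null_comparison)
    show "\<forall>\<^sub>F i in sequentially. norm (metric R (r i) *v dir R (r i)) \<le> metric_hi I * norm (dir R (r i))"
      using norm_metric_dir_le by simp
    show "(\<lambda>i. metric_hi I * norm (dir R (r i))) \<longlonglongrightarrow> 0"
      using tendsto_mult_left[OF tendsto_norm_zero[OF dir_0]] by simp
  qed
  have "- g' \<in> normal_cone unit_box \<theta>"
    unfolding normal_cone_def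
  proof (intro CollectI ballI)
    fix y :: "real^'m" assume y: "y \<in> unit_box"
    define k where "k = (\<lambda>i. r (s i))"
    have le: "- (metric R (k i) *v dir R (k i) + aggregate f I R (k i)) \<bullet> (y - (iterate R (k i) + dir R (k i))) \<le> 0" (is "?e i \<le> 0") for i
      using normal_multiplier[OF infinite, of "k i"] y unfolding normal_cone_def by blast
    have sub: "(\<lambda>i. h (s i)) \<longlonglongrightarrow> l" if "h \<longlonglongrightarrow> l" for h :: "nat \<Rightarrow> real^'m" and l
      using LIMSEQ_subseq_LIMSEQ[OF that s(2)] by (simp add: o_def)
    have "(\<lambda>i. (a (s i) - g (s i)) + (g \<circ> s) i) \<longlonglongrightarrow> 0 + g'"
      by (intro tendsto_add s(3) sub[OF ag])
    then have "(\<lambda>i. aggregate f I R (k i)) \<longlonglongrightarrow> g'" by (simp add: a_def k_def)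
    then have "?e
        \<longlonglongrightarrow> - (0 + g') \<bullet> (y - (\<theta> + 0))"
      unfolding k_def by (intro tendsto_intros sub[OF metric_0] sub[OF lim] sub[OF dir_0])
    then show "(- g') \<bullet> (y - \<theta>) \<le> 0"
      using le by (intro LIMSEQ_le_const2[where X = "?e"]) auto
  qed
  then have "g' + - g' \<in> D + normal_cone unit_box \<theta>" using s(1) by (intro set_plus_intro)
  then show ?thesis by (simp add: D_def)
qed

text \<open>If \<open>\<chi>\<close> stays away from zero near \<open>\<theta>\<close>, the line search succeeds there after boundedly many
  backtrackings, so the objective drops by a fixed amount infinitely often. This is incompatible with
  its convergence.\<close>

lemma chi_not_bounded_below:
  assumes r: "strict_mono r" and lim: "(\<lambda>i. iterate R (r i)) \<longlonglongrightarrow> \<theta>"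
    and chi: "\<forall>\<^sub>F i in sequentially. \<delta> < chi R (r i)" and \<delta>: "\<delta> > 0"
  shows False
proof -
  have box: "\<theta> \<in> unit_box" using lim by (rule accumulation_in_box)
  obtain W L where W: "open W" "\<theta> \<in> W" "W \<subseteq> X" "L-lipschitz_on W f"
    using local_lipschitz[OF box] by blast
  have lo: "metric_lo I > 0" and c: "0 < armijo_c I" "armijo_c I < 1"
    and \<beta>: "0 < backtrack I" "backtrack I < 1"
    using input by (simp_all add: gs_input_ok_def)
  \<comment> \<open>Two errors of size \<open>\<eta> \<parallel>d\<parallel>\<close> are to be absorbed by the slack \<open>(1 - c) \<chi>\<^sup>2\<close>.\<close>
  define \<eta> where "\<eta> = (1 - armijo_c I) * \<delta> * sqrt (metric_lo I) / 2"
  have \<eta>: "\<eta> > 0" using c \<delta> lo by (simp add: \<eta>_def)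
  obtain \<rho> where \<rho>: "\<rho> > 0" and inc: "\<And>y d s. norm (y - \<theta>) < \<rho> \<Longrightarrow> norm (y + d - \<theta>) < \<rho> \<Longrightarrow>
      (\<And>g. g \<in> clarke_subdiff X f \<theta> \<Longrightarrow> g \<bullet> d \<le> s) \<Longrightarrow> f (y + d) - f y \<le> s + \<eta> * norm d"
    using clarke_subdiff_increment[OF W(4,1,2,3) \<eta>] by metis
  define N where "N = real CARD('m)"
  have N: "N > 0" by (simp add: N_def)
  obtain l0 where l0: "backtrack I ^ l0 < \<rho> / (2 * N)"
    using real_arch_pow_inv[of "\<rho> / (2 * N)" "backtrack I"] \<rho> N \<beta> by auto
  define \<kappa> where "\<kappa> = armijo_c I * backtrack I ^ l0 * \<delta>\<^sup>2"
  have \<kappa>: "\<kappa> > 0" using c \<beta> \<delta> by (simp add: \<kappa>_def)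
  have haus: "(\<lambda>i. hausdorff_dist (convex hull (bundle_set f I R (r i))) (clarke_subdiff X f \<theta>)) \<longlonglongrightarrow> 0"
    using consistent r lim unfolding gradient_consistent_def by blast
  have r_top: "filterlim r at_top sequentially" using r by (rule filterlim_subseq)
  have "\<forall>\<^sub>F i in sequentially. norm (iterate R (r i) - \<theta>) < \<rho> / 2"
    using tendstoD[OF lim, of "\<rho> / 2"] \<rho> by (simp add: dist_norm)
  moreover have "\<forall>\<^sub>F i in sequentially.
      hausdorff_dist (convex hull (bundle_set f I R (r i))) (clarke_subdiff X f \<theta>) < \<eta>"
    using order_tendstoD(2)[OF haus \<eta>] .
  moreover have "\<forall>\<^sub>F i in sequentially. tol I (r i) < \<delta>"
    using order_tendstoD(2)[OF filterlim_compose[OF tol_0 r_top] \<delta>] .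
  moreover have "\<forall>\<^sub>F i in sequentially. Suc l0 \<le> ls_cap I (r i)"
    using filterlim_compose[OF ls_cap r_top] by (simp add: filterlim_at_top)
  ultimately have drop: "\<forall>\<^sub>F i in sequentially. f (iterate R (Suc (r i))) \<le> f (iterate R (r i)) - \<kappa>"
    using chi
  proof eventually_elim
    case (elim i)
    define k where "k = r i"
    define d where "d = dir R k"
    define t where "t = backtrack I ^ l0"
    note elim = elim[folded k_def]
    have t: "0 < t" "t \<le> 1" using backtrack_power[of l0] by (simp_all add: t_def)
    have "t * norm d \<le> t * N"
      using norm_dir_le[OF infinite, of k] t by (intro mult_left_mono) (auto simp: d_def N_def)
    also have "\<dots> < \<rho> / 2" using l0 N by (simp add: t_def field_simps)
    finally have td: "norm (t *\<^sub>R d) < \<rho> / 2" using t by simp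
    have "norm (iterate R k + t *\<^sub>R d - \<theta>) \<le> norm (iterate R k - \<theta>) + norm (t *\<^sub>R d)"
      using norm_triangle_ineq[of "iterate R k - \<theta>" "t *\<^sub>R d"] by (simp add: algebra_simps)
    with td elim(1) have near: "norm (iterate R k - \<theta>) < \<rho>" "norm (iterate R k + t *\<^sub>R d - \<theta>) < \<rho>"
      using \<rho> by linarith+
    have "g \<bullet> (t *\<^sub>R d) \<le> t * (\<eta> * norm d - (chi R k)\<^sup>2)" if g: "g \<in> clarke_subdiff X f \<theta>" for g
    proof -
      define K where "K = convex hull (bundle_set f I R k)"
      have K: "compact K" "K \<noteq> {}" using bundle_hull[of k] by (simp_all add: K_def)
      obtain h where h: "h \<in> K" "infdist g K = dist g h"
        using infdist_attains_inf[OF compact_imp_closed[OF K(1)] K(2)] by metis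
      have gh: "norm (g - h) \<le> \<eta>"
        using hausdorff_bounds(2)[OF box g, of k] elim(2) h(2) by (simp add: K_def dist_norm)
      have "g \<bullet> d = h \<bullet> d + (g - h) \<bullet> d" by (simp add: inner_diff_left)
      also have "(g - h) \<bullet> d \<le> norm (g - h) * norm d" by (rule norm_cauchy_schwarz)
      also have "\<dots> \<le> \<eta> * norm d" using gh by (intro mult_right_mono) auto
      also have "h \<bullet> d \<le> - (chi R k)\<^sup>2" using hull_dot_dir_le[of h k] h(1) by (simp add: K_def d_def)
      finally have "g \<bullet> d \<le> \<eta> * norm d - (chi R k)\<^sup>2" by simp
      with t show ?thesis by (simp add: mult_left_mono)
    qed
    from inc[OF near this] have "f (iterate R k + t *\<^sub>R d) - f (iterate R k)
        \<le> t * (\<eta> * norm d - (chi R k)\<^sup>2) + \<eta> * norm (t *\<^sub>R d)" by blast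
    also have "\<dots> = t * (2 * \<eta> * norm d - (chi R k)\<^sup>2)" using t by (simp add: algebra_simps)
    also have "2 * \<eta> * norm d \<le> (1 - armijo_c I) * (chi R k)\<^sup>2"
    proof -
      have "2 * \<eta> * norm d = (1 - armijo_c I) * \<delta> * (sqrt (metric_lo I) * norm d)" by (simp add: \<eta>_def)
      also have "\<dots> \<le> (1 - armijo_c I) * chi R k * chi R k"
        using elim(5) c \<delta> lo norm_dir_le_chi[of k] chi_nonneg[of k]
        by (intro mult_mono mult_left_mono) (auto simp: d_def)
      finally show ?thesis by (simp add: power2_eq_square)
    qed
    then have "t * (2 * \<eta> * norm d - (chi R k)\<^sup>2) \<le> t * (- armijo_c I * (chi R k)\<^sup>2)"
      using t by (intro mult_left_mono) (auto simp: algebra_simps)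
    finally have "armijo_at f I R k l0"
      using elim(4) by (simp add: armijo_at_def t_def d_def algebra_simps)
    define l where "l = (LEAST l. armijo_at f I R k l)"
    have l: "armijo_at f I R k l" "l \<le> l0"
      using \<open>armijo_at f I R k l0\<close> unfolding l_def by (auto intro: LeastI Least_le)
    have "\<not> chi R k \<le> tol I k" using elim(3,5) by simp
    then have "iterate R (Suc k) = iterate R k + backtrack I ^ l *\<^sub>R dir R k"
      using steps(3)[OF infinite, of k] \<open>armijo_at f I R k l0\<close> unfolding update_step_def l_def
      by (auto split: if_splits)
    then have "f (iterate R (Suc k)) \<le> f (iterate R k) - armijo_c I * backtrack I ^ l * (chi R k)\<^sup>2"
      using l(1) by (simp add: armijo_at_def)
    moreover have "\<kappa> \<le> armijo_c I * backtrack I ^ l * (chi R k)\<^sup>2"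
      unfolding \<kappa>_def using c \<beta> \<delta> elim(5) l(2)
      by (intro mult_mono power_decreasing power_mono) auto
    ultimately show ?case by (simp add: k_def)
  qed
  have next_le: "f (iterate R (r (Suc i))) \<le> f (iterate R (Suc (r i)))" for i
    using r by (intro decreasing infinite) (simp add: strict_mono_Suc_iff Suc_le_eq)
  have step: "\<forall>\<^sub>F i in sequentially. f (iterate R (r (Suc i))) \<le> f (iterate R (r i)) - \<kappa>"
    using drop by eventually_elim (use next_le order_trans in blast)
  have "isCont f \<theta>"
    using lipschitz_on_continuous_on[OF W(4)] W(1,2) by (simp add: continuous_on_eq_continuous_at)
  then have f_lim: "(\<lambda>i. f (iterate R (r i))) \<longlonglongrightarrow> f \<theta>"
    using lim by (rule isCont_tendsto_compose)
  then have "(\<lambda>i. f (iterate R (r (Suc i)))) \<longlonglongrightarrow> f \<theta>" by (rule LIMSEQ_Suc)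
  moreover have "(\<lambda>i. f (iterate R (r i)) - \<kappa>) \<longlonglongrightarrow> f \<theta> - \<kappa>"
    by (intro tendsto_intros f_lim)
  ultimately have "f \<theta> \<le> f \<theta> - \<kappa>"
    using step by (intro tendsto_le[OF sequentially_bot])
  with \<kappa> show False by simp
qed

text \<open>Since \<open>\<chi>\<close> is bounded, some subsequence makes it converge, and the two preceding lemmas treat the possible
  limits.\<close>

theorem accumulation_point_stationary:
  assumes "accumulation_point (iterate R) \<theta>"
  shows "0 \<in> clarke_subdiff X f \<theta> + normal_cone unit_box \<theta>"
proof -
  obtain r where r: "strict_mono r" "(\<lambda>i. iterate R (r i)) \<longlonglongrightarrow> \<theta>"
    using assms by (auto simp: accumulation_point_def)
  have "chi R k \<in> cball 0 (sqrt (metric_hi I) * real CARD('m))" for k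
  proof -
    have hi: "metric_hi I \<ge> 0" using input by (simp add: gs_input_ok_def)
    have "chi R k \<le> sqrt (metric_hi I * (norm (dir R k))\<^sup>2)"
      unfolding chi_def by (intro real_sqrt_le_mono metric_form_bounds)
    also have "\<dots> \<le> sqrt (metric_hi I) * real CARD('m)"
      using norm_dir_le[OF infinite, of k] hi by (simp add: real_sqrt_mult mult_left_mono)
    finally show ?thesis using chi_nonneg[of k] by simp
  qed
  then obtain c s where s: "strict_mono s" "((\<lambda>i. chi R (r i)) \<circ> s) \<longlonglongrightarrow> c"
    using compact_cball[of "0 :: real" "sqrt (metric_hi I) * real CARD('m)"]
    unfolding compact_def by (metis (no_types, lifting))
  have rs: "strict_mono (r \<circ> s)" using r(1) s(1) by (rule strict_mono_o)
  have lim: "(\<lambda>i. iterate R ((r \<circ> s) i)) \<longlonglongrightarrow> \<theta>"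
    using LIMSEQ_subseq_LIMSEQ[OF r(2) s(1)] by (simp add: o_def)
  have chi: "(\<lambda>i. chi R ((r \<circ> s) i)) \<longlonglongrightarrow> c" using s(2) by (simp add: o_def)
  have "c \<ge> 0" using chi chi_nonneg by (intro LIMSEQ_le_const) auto
  moreover have "\<not> c > 0"
  proof
    assume "c > 0"
    then have "\<forall>\<^sub>F i in sequentially. c / 2 < chi R ((r \<circ> s) i)"
      using chi by (intro order_tendstoD(1)) auto
    with \<open>c > 0\<close> show False using chi_not_bounded_below[OF rs lim, of "c / 2"] by simp
  qed
  ultimately have "c = 0" by simp
  with stationary_if_chi_vanishes[OF rs lim] chi show ?thesis by simp
qed

end

section \<open>Stationarity under rescaling and inversion\<close>

lemma zero_in_set_plus_iff: "(0 :: 'a::ab_group_add) \<in> A + B \<longleftrightarrow> (\<exists>a\<in>A. - a \<in> B)"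
proof
  assume "0 \<in> A + B"
  then obtain a b where "a \<in> A" "b \<in> B" "0 = a + b" by (auto elim: set_plus_elim)
  then show "\<exists>a\<in>A. - a \<in> B" by (metis add_eq_0_iff)
next
  assume "\<exists>a\<in>A. - a \<in> B"
  then show "0 \<in> A + B" by (metis set_plus_intro add.right_inverse)
qed

lemma diag_mat_mult: "(diag_mat v *v x) $ i = v $ i * x $ i"
  by (simp add: diag_mat_def matrix_vector_mult_def if_distrib[of "\<lambda>a. a * _"] cong: if_cong)

lemma inner_diag_mat: "(diag_mat v *v x) \<bullet> y = x \<bullet> (diag_mat v *v y)"
  by (simp add: inner_vec_def diag_mat_mult mult_ac)

definition vec_inverse :: "real^'m \<Rightarrow> real^'m" where
  "vec_inverse v = (\<chi> i. inverse (v $ i))"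

lemma diag_mat_inverse:
  assumes "\<And>i. v $ i \<noteq> 0"
  shows "diag_mat (vec_inverse v) *v (diag_mat v *v x) = x" "diag_mat v *v (diag_mat (vec_inverse v) *v x) = x"
  using assms by (simp_all add: vec_eq_iff diag_mat_mult vec_inverse_def)

lemma gderiv_diag_affine:
  fixes f :: "real^'m \<Rightarrow> real"
  assumes "GDERIV f (c + diag_mat v *v x) :> G"
  shows "GDERIV (\<lambda>z. f (c + diag_mat v *v z)) x :> diag_mat v *v G"
proof -
  have "((\<lambda>z. c + diag_mat v *v z) has_derivative (\<lambda>h. diag_mat v *v h)) (at x)"
    using bounded_linear_imp_has_derivative[OF matrix_vector_mul_bounded_linear]
    by (auto intro!: derivative_eq_intros)
  from has_derivative_compose[OF this assms[unfolded gderiv_def]]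
  show ?thesis by (simp add: gderiv_def inner_diag_mat)
qed

lemma clarke_subdiff_diag_affine:
  fixes f :: "real^'m \<Rightarrow> real"
  assumes v: "\<And>i. v $ i \<noteq> 0" and U': "open U0" "x \<in> U0" "U0 \<subseteq> U'"
    and g: "g \<in> clarke_subdiff U f (c + diag_mat v *v x)"
  shows "diag_mat v *v g \<in> clarke_subdiff U' (\<lambda>z. f (c + diag_mat v *v z)) x"
proof (rule clarke_subdiff_transform[OF matrix_vector_mul_bounded_linear _ g])
  fix \<epsilon> \<eta> :: real assume "\<epsilon> > 0" "\<eta> > 0"
  obtain r where r: "r > 0" "cball x r \<subseteq> U0" using U' by (meson open_contains_cball)
  define w where "w = vec_inverse v"
  obtain K where K: "K > 0" "\<And>y. norm (diag_mat w *v y) \<le> norm y * K"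
    using bounded_linear.pos_bounded[OF matrix_vector_mul_bounded_linear] by blast
  define \<delta> where "\<delta> = min \<epsilon> r / K"
  have \<delta>: "\<delta> > 0" using \<open>\<epsilon> > 0\<close> r K by (simp add: \<delta>_def)
  have "diag_mat v *v h \<in> near_gradients U' (\<lambda>z. f (c + diag_mat v *v z)) x \<epsilon>"
    if h: "h \<in> near_gradients U f (c + diag_mat v *v x) \<delta>" for h
  proof -
    obtain z where z: "GDERIV f z :> h" "norm (z - (c + diag_mat v *v x)) \<le> \<delta>"
      using h by (rule near_gradientsE)
    define z' where "z' = diag_mat w *v (z - c)"
    have z_eq: "z = c + diag_mat v *v z'" by (simp add: z'_def w_def diag_mat_inverse[OF v])
    have "z' - x = diag_mat w *v (z - (c + diag_mat v *v x))"
      by (simp add: z_eq w_def diag_mat_inverse[OF v] flip: matrix_vector_mult_diff_distrib)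
    then have "norm (z' - x) \<le> norm (z - (c + diag_mat v *v x)) * K" using K(2) by metis
    also have "\<dots> \<le> \<delta> * K" using z K by (intro mult_right_mono) auto
    finally have near: "norm (z' - x) \<le> min \<epsilon> r" using K by (simp add: \<delta>_def)
    then have "z' \<in> cball x r" by (simp add: dist_norm norm_minus_commute)
    with near r(2) U'(3) z(1) show ?thesis
      by (intro near_gradientsI[of _ z'] gderiv_diag_affine) (auto simp flip: z_eq)
  qed
  with \<delta> show "\<exists>\<delta>>0. \<forall>g\<in>near_gradients U f (c + diag_mat v *v x) \<delta>.
      \<exists>h\<in>near_gradients U' (\<lambda>z. f (c + diag_mat v *v z)) x \<epsilon>. norm (diag_mat v *v g - h) \<le> \<eta>"
    using \<open>\<eta> > 0\<close> by (intro exI[of _ \<delta>] conjI ballI bexI[of _ "diag_mat v *v _"]) auto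
qed

lemma gderiv_neg_inverse:
  assumes "GDERIV f z :> G" "f z \<noteq> 0"
  shows "GDERIV (\<lambda>x. - 1 / f x) z :> (1 / (f z)\<^sup>2) *\<^sub>R G"
proof (rule GDERIV_DERIV_compose[OF assms(1)])
  show "DERIV (\<lambda>t. - 1 / t) (f z) :> 1 / (f z)\<^sup>2"
    using assms(2) by (auto intro!: derivative_eq_intros simp: power2_eq_square)
qed

lemma lipschitz_neg_inverse:
  fixes f :: "'a::metric_space \<Rightarrow> real"
  assumes lip: "L-lipschitz_on W f" and W: "open W" "x \<in> W" and "f x \<noteq> 0"
  obtains W' L' where "open W'" "x \<in> W'" "W' \<subseteq> W" "L'-lipschitz_on W' (\<lambda>z. - 1 / f z)"
    "\<And>z. z \<in> W' \<Longrightarrow> \<bar>f z\<bar> > \<bar>f x\<bar> / 2"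
proof -
  define m where "m = \<bar>f x\<bar> / 2"
  have m: "m > 0" using \<open>f x \<noteq> 0\<close> by (simp add: m_def)
  have "isCont f x"
    using lipschitz_on_continuous_on[OF lip] W by (simp add: continuous_on_eq_continuous_at)
  then have f_lim: "(f \<longlongrightarrow> f x) (nhds x)"
    by (simp add: continuous_at tendsto_nhds_iff)
  have "\<forall>\<^sub>F z in nhds x. m < \<bar>f z\<bar>"
    by (rule order_tendstoD(1)[OF tendsto_rabs[OF f_lim]]) (use \<open>f x \<noteq> 0\<close> in \<open>simp add: m_def\<close>)
  then obtain V where V: "open V" "x \<in> V" "\<And>z. z \<in> V \<Longrightarrow> m < \<bar>f z\<bar>"
    by (auto simp: eventually_nhds)
  have "(L / m\<^sup>2)-lipschitz_on (V \<inter> W) (\<lambda>z. - 1 / f z)"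
  proof (rule lipschitz_onI)
    fix y z assume yz: "y \<in> V \<inter> W" "z \<in> V \<inter> W"
    then have ne: "f y \<noteq> 0" "f z \<noteq> 0" and big: "m < \<bar>f y\<bar>" "m < \<bar>f z\<bar>"
      using V(3) m by force+
    have "- 1 / f y - (- 1 / f z) = (f y - f z) / (f y * f z)"
      using ne by (simp add: field_simps)
    then have "dist (- 1 / f y) (- 1 / f z) = \<bar>f y - f z\<bar> / (\<bar>f y\<bar> * \<bar>f z\<bar>)"
      unfolding dist_real_def by (simp only: abs_divide abs_mult)
    also have "\<dots> \<le> (L * dist y z) / (m * m)"
      using lipschitz_onD[OF lip, of y z] yz big m
      by (intro frac_le mult_mono) (auto simp: dist_real_def intro: mult_pos_pos)
    finally show "dist (- 1 / f y) (- 1 / f z) \<le> L / m\<^sup>2 * dist y z"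
      by (simp add: power2_eq_square)
  qed (use lipschitz_on_nonneg[OF lip] in simp)
  with V W show thesis by (intro that[of "V \<inter> W"]) (auto simp: m_def)
qed

lemma clarke_subdiff_neg_inverse:
  fixes f :: "real^'m \<Rightarrow> real"
  assumes lip: "L-lipschitz_on W f" and W: "open W" "x \<in> W" "W \<subseteq> U'" and fx: "f x \<noteq> 0"
    and g: "g \<in> clarke_subdiff U f x"
  shows "(1 / (f x)\<^sup>2) *\<^sub>R g \<in> clarke_subdiff U' (\<lambda>z. - 1 / f z) x"
proof (rule clarke_subdiff_transform[OF bounded_linear_scaleR_right _ g])
  fix \<epsilon> \<eta> :: real assume "\<epsilon> > 0" "\<eta> > 0"
  have "isCont f x"
    using lipschitz_on_continuous_on[OF lip] W by (simp add: continuous_on_eq_continuous_at)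
  then have f_lim: "(f \<longlongrightarrow> f x) (nhds x)"
    by (simp add: continuous_at tendsto_nhds_iff)
  have "((\<lambda>z. \<bar>1 / (f x)\<^sup>2 - 1 / (f z)\<^sup>2\<bar> * L) \<longlongrightarrow> \<bar>1 / (f x)\<^sup>2 - 1 / (f x)\<^sup>2\<bar> * L) (nhds x)"
    using fx by (intro tendsto_intros f_lim) auto
  then have 1: "\<forall>\<^sub>F z in nhds x. \<bar>1 / (f x)\<^sup>2 - 1 / (f z)\<^sup>2\<bar> * L < \<eta>"
    using \<open>\<eta> > 0\<close> by (intro order_tendstoD(2)) auto
  have 2: "\<forall>\<^sub>F z in nhds x. f z \<noteq> 0"
    using tendsto_imp_eventually_ne[OF f_lim fx] .
  have 3: "\<forall>\<^sub>F z in nhds x. z \<in> W" using W(1,2) by (rule eventually_nhds_in_open)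
  from eventually_conj[OF 1 eventually_conj[OF 2 3]]
  obtain r where r: "r > 0" "\<And>z. dist z x < r \<Longrightarrow> \<bar>1 / (f x)\<^sup>2 - 1 / (f z)\<^sup>2\<bar> * L < \<eta> \<and> f z \<noteq> 0 \<and> z \<in> W"
    by (auto simp: eventually_nhds_metric)
  define \<delta> where "\<delta> = min (r / 2) \<epsilon>"
  have "\<exists>h\<in>near_gradients U' (\<lambda>z. - 1 / f z) x \<epsilon>. norm ((1 / (f x)\<^sup>2) *\<^sub>R g - h) \<le> \<eta>"
    if g: "g \<in> near_gradients U f x \<delta>" for g
  proof -
    obtain z where z: "GDERIV f z :> g" "norm (z - x) \<le> \<delta>"
      using g by (rule near_gradientsE)
    have "dist z x < r" using z r(1) by (simp add: \<delta>_def dist_norm)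
    note rz = r(2)[OF this]
    have "norm g \<le> L" using gderiv_norm_le_lipschitz[OF lip W(1) _ z(1)] rz by blast
    then have "\<bar>1 / (f x)\<^sup>2 - 1 / (f z)\<^sup>2\<bar> * norm g \<le> \<eta>"
      using rz mult_left_mono[of "norm g" L "\<bar>1 / (f x)\<^sup>2 - 1 / (f z)\<^sup>2\<bar>"] by linarith
    then have "norm ((1 / (f x)\<^sup>2) *\<^sub>R g - (1 / (f z)\<^sup>2) *\<^sub>R g) \<le> \<eta>"
      unfolding scaleR_diff_left[symmetric] norm_scaleR .
    moreover have "(1 / (f z)\<^sup>2) *\<^sub>R g \<in> near_gradients U' (\<lambda>z. - 1 / f z) x \<epsilon>"
      using rz W(3) z by (intro near_gradientsI[OF gderiv_neg_inverse]) (auto simp: \<delta>_def)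
    ultimately show ?thesis by blast
  qed
  moreover have "\<delta> > 0" using r(1) \<open>\<epsilon> > 0\<close> by (simp add: \<delta>_def)
  ultimately show "\<exists>\<delta>>0. \<forall>g\<in>near_gradients U f x \<delta>.
      \<exists>h\<in>near_gradients U' (\<lambda>z. - 1 / f z) x \<epsilon>. norm ((1 / (f x)\<^sup>2) *\<^sub>R g - h) \<le> \<eta>"
    by blast
qed

lemma normal_cone_scale:
  assumes "v \<in> normal_cone B x" "0 \<le> c"
  shows "c *\<^sub>R v \<in> normal_cone B x"
  using assms by (auto simp: normal_cone_def mult_nonneg_nonpos)

text \<open>The same chain rule gives both directions, since \<open>- 1 / (- 1 / f) = f\<close>.\<close>

lemma stationary_neg_inverse_iff:
  fixes f :: "real^'m \<Rightarrow> real"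
  assumes lip: "L-lipschitz_on W f" and W: "open W" "x \<in> W" "W \<subseteq> U" and fx: "f x > 0"
  shows "0 \<in> clarke_subdiff U f x + normal_cone B x \<longleftrightarrow>
    0 \<in> clarke_subdiff {z \<in> U. f z > 0} (\<lambda>z. - 1 / f z) x + normal_cone B x"
proof -
  obtain W1 L1 where W1: "open W1" "x \<in> W1" "W1 \<subseteq> W" "L1-lipschitz_on W1 (\<lambda>z. - 1 / f z)"
    using lipschitz_neg_inverse[OF lip W(1,2)] fx by (metis less_irrefl)
  have cont: "continuous_on W f" using lip by (rule lipschitz_on_continuous_on)
  have pos: "open {z \<in> W. f z > 0}"
    using open_Collect_less_Int[of W]
      continuous_open_preimage[OF cont W(1), of "{0<..}"] by (simp add: vimage_def Int_def)
  show ?thesis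
    unfolding zero_in_set_plus_iff
  proof
    assume "\<exists>g\<in>clarke_subdiff U f x. - g \<in> normal_cone B x"
    then obtain g where g: "g \<in> clarke_subdiff U f x" "- g \<in> normal_cone B x" by blast
    have "(1 / (f x)\<^sup>2) *\<^sub>R g \<in> clarke_subdiff {z \<in> U. f z > 0} (\<lambda>z. - 1 / f z) x"
      using pos W fx
      by (intro clarke_subdiff_neg_inverse[OF lipschitz_on_subset[OF lip, of "{z \<in> W. f z > 0}"] _ _ _ _ g(1)]) auto
    moreover have "- ((1 / (f x)\<^sup>2) *\<^sub>R g) \<in> normal_cone B x"
      using normal_cone_scale[OF g(2), of "1 / (f x)\<^sup>2"] by simp
    ultimately show "\<exists>g\<in>clarke_subdiff {z \<in> U. f z > 0} (\<lambda>z. - 1 / f z) x. - g \<in> normal_cone B x" by blast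
  next
    assume "\<exists>g\<in>clarke_subdiff {z \<in> U. f z > 0} (\<lambda>z. - 1 / f z) x. - g \<in> normal_cone B x"
    then obtain g where g: "g \<in> clarke_subdiff {z \<in> U. f z > 0} (\<lambda>z. - 1 / f z) x"
      "- g \<in> normal_cone B x" by blast
    have "(1 / (- 1 / f x)\<^sup>2) *\<^sub>R g \<in> clarke_subdiff U (\<lambda>z. - 1 / (- 1 / f z)) x"
      using W1 W fx by (intro clarke_subdiff_neg_inverse[OF W1(4,1,2) _ _ g(1)]) auto
    then have "(f x)\<^sup>2 *\<^sub>R g \<in> clarke_subdiff U f x" by (simp add: power_divide)
    moreover have "- ((f x)\<^sup>2 *\<^sub>R g) \<in> normal_cone B x"
      using normal_cone_scale[OF g(2), of "(f x)\<^sup>2"] by simp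
    ultimately show "\<exists>g\<in>clarke_subdiff U f x. - g \<in> normal_cone B x" by blast
  qed
qed

lemma unscale_box_iff:
  assumes "\<And>i. lo $ i < hi $ i"
  shows "unscale lo hi \<theta> \<in> cbox lo hi \<longleftrightarrow> \<theta> \<in> unit_box"
proof -
  have "(lo $ i \<le> unscale lo hi \<theta> $ i \<and> unscale lo hi \<theta> $ i \<le> hi $ i) \<longleftrightarrow> (0 \<le> \<theta> $ i \<and> \<theta> $ i \<le> 1)" for i
  proof -
    have pos: "hi $ i - lo $ i > 0" using assms[of i] by simp
    have "unscale lo hi \<theta> $ i = lo $ i + (hi $ i - lo $ i) * \<theta> $ i"
      by (simp add: unscale_def diag_mat_mult)
    moreover have "0 \<le> (hi $ i - lo $ i) * \<theta> $ i \<longleftrightarrow> 0 \<le> \<theta> $ i"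
      using pos by (simp add: zero_le_mult_iff)
    moreover have "(hi $ i - lo $ i) * \<theta> $ i \<le> (hi $ i - lo $ i) * 1 \<longleftrightarrow> \<theta> $ i \<le> 1"
      using pos by (rule mult_le_cancel_left_pos)
    ultimately show ?thesis by auto
  qed
  then show ?thesis by (simp add: mem_box_cart in_unit_box)
qed

lemma unscale_inverse:
  assumes "\<And>i. lo $ i < hi $ i"
  shows "unscale lo hi (diag_mat (vec_inverse (hi - lo)) *v (\<Lambda> - lo)) = \<Lambda>"
proof -
  have "(hi - lo) $ i \<noteq> 0" for i using assms[of i] by simp
  then show ?thesis by (simp add: unscale_def diag_mat_inverse)
qed

lemma normal_cone_unscale:
  assumes lohi: "\<And>i. lo $ i < hi $ i"
  shows "diag_mat (hi - lo) *v g \<in> normal_cone unit_box \<theta> \<longleftrightarrow> g \<in> normal_cone (cbox lo hi) (unscale lo hi \<theta>)"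
proof -
  have "(diag_mat (hi - lo) *v g) \<bullet> (y - \<theta>) = g \<bullet> (unscale lo hi y - unscale lo hi \<theta>)" for y
    by (simp add: inner_diag_mat unscale_def matrix_vector_mult_diff_distrib)
  moreover have "unscale lo hi ` unit_box = cbox lo hi"
  proof
    show "unscale lo hi ` unit_box \<subseteq> cbox lo hi" using unscale_box_iff[OF lohi] by auto
    show "cbox lo hi \<subseteq> unscale lo hi ` unit_box"
    proof
      fix \<Lambda> assume "\<Lambda> \<in> cbox lo hi"
      then show "\<Lambda> \<in> unscale lo hi ` unit_box"
        using unscale_box_iff[OF lohi] unscale_inverse[OF lohi, of \<Lambda>] by (metis imageI)
    qed
  qed
  ultimately show ?thesis
    unfolding normal_cone_def by (simp flip: \<open>unscale lo hi ` unit_box = cbox lo hi\<close>)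
qed

lemma continuous_on_unscale: "continuous_on A (unscale lo hi)"
  unfolding unscale_def
  by (intro continuous_intros linear_continuous_on matrix_vector_mul_bounded_linear)

lemma open_scaled_domain: "open U \<Longrightarrow> open (scaled_domain lo hi U)"
  using open_vimage[OF _ continuous_on_unscale[of UNIV lo hi], of U]
  by (simp add: scaled_domain_def vimage_def)

text \<open>Both the subdifferential and the normal cone at \<open>\<theta>\<close> are the images under \<open>D\<^sub>B\<close> of those at the unscaled point.\<close>

lemma stationary_unscale_iff:
  fixes f :: "real^'m \<Rightarrow> real"
  assumes lohi: "\<And>i. lo $ i < hi $ i" and U: "open U" "unscale lo hi \<theta> \<in> U" "U \<subseteq> V"
  shows "0 \<in> clarke_subdiff (scaled_domain lo hi U) (\<lambda>\<theta>. f (unscale lo hi \<theta>)) \<theta> + normal_cone unit_box \<theta>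
    \<longleftrightarrow> 0 \<in> clarke_subdiff V f (unscale lo hi \<theta>) + normal_cone (cbox lo hi) (unscale lo hi \<theta>)"
proof -
  define v where "v = hi - lo"
  define w where "w = vec_inverse v"
  have v: "v $ i \<noteq> 0" for i using lohi[of i] by (simp add: v_def)
  then have w: "w $ i \<noteq> 0" for i by (simp add: w_def vec_inverse_def)
  define h where "h = (\<lambda>\<theta>. f (unscale lo hi \<theta>))"
  have h: "h = (\<lambda>\<theta>. f (lo + diag_mat v *v \<theta>))" by (simp add: h_def unscale_def v_def)
  define \<Lambda> where "\<Lambda> = unscale lo hi \<theta>"
  define c where "c = - (diag_mat w *v lo)"
  have unsc: "c + diag_mat w *v unscale lo hi y = y" for y
    by (simp add: c_def unscale_def w_def v_def[symmetric] matrix_vector_right_distrib diag_mat_inverse[OF v])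
  have f: "f = (\<lambda>\<Lambda>. h (c + diag_mat w *v \<Lambda>))"
    by (simp add: fun_eq_iff h_def unscale_def c_def matrix_vector_right_distrib w_def v_def[symmetric]
        diag_mat_inverse[OF v] matrix_vector_mult_diff_distrib
        flip: matrix_vector_mult_diff_distrib) 
  show ?thesis
    unfolding zero_in_set_plus_iff h_def[symmetric] \<Lambda>_def[symmetric]
  proof
    assume "\<exists>g\<in>clarke_subdiff (scaled_domain lo hi U) h \<theta>. - g \<in> normal_cone unit_box \<theta>"
    then obtain g where g: "g \<in> clarke_subdiff (scaled_domain lo hi U) h \<theta>" "- g \<in> normal_cone unit_box \<theta>"
      by blast
    have "g \<in> clarke_subdiff (scaled_domain lo hi U) h (c + diag_mat w *v \<Lambda>)"
      using g(1) by (simp add: \<Lambda>_def unsc)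
    then have "diag_mat w *v g \<in> clarke_subdiff V f \<Lambda>"
      unfolding f using U by (intro clarke_subdiff_diag_affine[OF w, of U]) (auto simp: \<Lambda>_def)
    moreover have "diag_mat v *v (- (diag_mat w *v g)) = - g"
      using diag_mat_inverse(2)[OF v, of "- g"]
      by (metis matrix_vector_mult_diff_distrib diff_0 matrix_vector_mult_0_right w_def)
    then have "- (diag_mat w *v g) \<in> normal_cone (cbox lo hi) \<Lambda>"
      using g(2) normal_cone_unscale[OF lohi, of "- (diag_mat w *v g)" \<theta>] by (simp add: \<Lambda>_def v_def)
    ultimately show "\<exists>g\<in>clarke_subdiff V f \<Lambda>. - g \<in> normal_cone (cbox lo hi) \<Lambda>" by blast
  next
    assume "\<exists>g\<in>clarke_subdiff V f \<Lambda>. - g \<in> normal_cone (cbox lo hi) \<Lambda>"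
    then obtain g where g: "g \<in> clarke_subdiff V f \<Lambda>" "- g \<in> normal_cone (cbox lo hi) \<Lambda>" by blast
    have "g \<in> clarke_subdiff V f (lo + diag_mat v *v \<theta>)"
      using g(1) by (simp add: \<Lambda>_def unscale_def v_def)
    then have "diag_mat v *v g \<in> clarke_subdiff (scaled_domain lo hi U) h \<theta>"
      unfolding h using open_scaled_domain[OF U(1)] U(2)
      by (intro clarke_subdiff_diag_affine[OF v, of "scaled_domain lo hi U"]) (auto simp: scaled_domain_def)
    moreover have "diag_mat v *v (- g) = - (diag_mat v *v g)"
      by (metis matrix_vector_mult_diff_distrib diff_0 matrix_vector_mult_0_right)
    then have "- (diag_mat v *v g) \<in> normal_cone unit_box \<theta>"
      using g(2) normal_cone_unscale[OF lohi, of "- g" \<theta>] by (simp add: \<Lambda>_def v_def)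
    ultimately show "\<exists>g\<in>clarke_subdiff (scaled_domain lo hi U) h \<theta>. - g \<in> normal_cone unit_box \<theta>" by blast
  qed
qed

lemma lipschitz_unscale: "\<exists>K. K-lipschitz_on A (unscale lo hi)"
proof -
  obtain K where K: "K > 0" "\<And>y. norm (diag_mat (hi - lo) *v y) \<le> norm y * K"
    using bounded_linear.pos_bounded[OF matrix_vector_mul_bounded_linear] by blast
  have "K-lipschitz_on A (unscale lo hi)"
    using K by (intro lipschitz_onI)
      (auto simp: unscale_def dist_norm mult.commute simp flip: matrix_vector_mult_diff_distrib)
  then show ?thesis ..
qed

lemma psi_locally_lipschitz:
  fixes S :: "('n::finite, 'm::{finite,linorder}, 'd::finite) lifted_system"
  assumes S: "lifted_system_ok S" and U: "open U" "U \<subseteq> feasible S" "unscale lo hi \<theta> \<in> U"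
  shows "\<exists>W L. open W \<and> \<theta> \<in> W \<and> W \<subseteq> scaled_domain lo hi U \<and> L-lipschitz_on W (psi S lo hi)"
proof -
  obtain \<rho> L where \<rho>: "\<rho> > 0" "ball (unscale lo hi \<theta>) \<rho> \<subseteq> U" "L-lipschitz_on (ball (unscale lo hi \<theta>) \<rho>) (phi S)"
    using phi_locally_lipschitz[OF S U] by blast
  define W where "W = scaled_domain lo hi (ball (unscale lo hi \<theta>) \<rho>)"
  obtain K where "K-lipschitz_on W (unscale lo hi)" using lipschitz_unscale by blast
  moreover have "L-lipschitz_on (unscale lo hi ` W) (phi S)"
    by (rule lipschitz_on_subset[OF \<rho>(3)]) (auto simp: W_def scaled_domain_def)
  ultimately have "(L * K)-lipschitz_on W (phi S \<circ> unscale lo hi)" by (rule lipschitz_on_compose)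
  then have "(L * K)-lipschitz_on W (psi S lo hi)" by (simp add: psi_def o_def)
  moreover have "open W" unfolding W_def by (intro open_scaled_domain open_ball)
  moreover have "\<theta> \<in> W" "W \<subseteq> scaled_domain lo hi U" using \<rho> by (auto simp: W_def scaled_domain_def)
  ultimately show ?thesis by blast
qed

section \<open>Convergence of the box-constrained algorithm\<close>

theorem theorem4p5:
  fixes S :: "('n::finite, 'm::{finite,linorder}, 'd::finite) lifted_system"
    and lo hi :: "real^'m::{finite,linorder}" and U :: "(real^'m::{finite,linorder}) set"
    and I :: "'m gs_input" and R :: "'m gs_trace"
  assumes "lifted_system_ok S"
    and "\<And>i. lo $ i < hi $ i" and "cbox lo hi \<subseteq> feasible S"
    and "open U" and "cbox lo hi \<subseteq> U" and "compact (closure U)" and "closure U \<subseteq> feasible S"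
    and "gs_input_ok I"
    and "gs_run (psi S lo hi) (scaled_domain lo hi U) I R"
    and "decseq (radius I)" and "radius I \<longlonglongrightarrow> 0"
    and "decseq (tol I)" and "tol I \<longlonglongrightarrow> 0"
    and "filterlim (ls_cap I) at_top sequentially"
    and "\<And>k. reached R (Suc k) \<Longrightarrow>
           loewner_le (metric_lo I *\<^sub>R mat 1) (metric R k) \<and>
           loewner_le (metric R k) (metric_hi I *\<^sub>R mat 1)"
    and "(\<forall>k. reached R k) \<Longrightarrow>
           gradient_consistent (psi S lo hi) (scaled_domain lo hi U) I R"
  shows "(\<forall>k. reached R k \<longrightarrow> iterate R k \<in> unit_box) \<and>
    (\<forall>j k. j \<le> k \<and> reached R k \<longrightarrow> psi S lo hi (iterate R k) \<le> psi S lo hi (iterate R j)) \<and>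
    (\<forall>\<theta>. (\<forall>k. reached R k) \<and> accumulation_point (iterate R) \<theta> \<longrightarrow>
       0 \<in> clarke_subdiff (scaled_domain lo hi U) (psi S lo hi) \<theta> + normal_cone unit_box \<theta> \<and>
       0 \<in> clarke_subdiff (feasible S) (phi S) (unscale lo hi \<theta>)
             + normal_cone (cbox lo hi) (unscale lo hi \<theta>) \<and>
       ((INF \<Lambda>\<in>cbox lo hi. phi S \<Lambda>) > 0 \<longrightarrow>
         0 \<in> clarke_subdiff {\<Lambda> \<in> feasible S. phi S \<Lambda> > 0} (\<lambda>\<Lambda>. - rho_star S \<Lambda>) (unscale lo hi \<theta>)
               + normal_cone (cbox lo hi) (unscale lo hi \<theta>))) \<and>
    (\<forall>\<theta>\<in>unit_box.
       (0 \<in> clarke_subdiff (scaled_domain lo hi U) (psi S lo hi) \<theta> + normal_cone unit_box \<theta> \<longleftrightarrow>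
        0 \<in> clarke_subdiff (feasible S) (phi S) (unscale lo hi \<theta>)
              + normal_cone (cbox lo hi) (unscale lo hi \<theta>)) \<and>
       ((INF \<Lambda>\<in>cbox lo hi. phi S \<Lambda>) > 0 \<longrightarrow>
        (0 \<in> clarke_subdiff (feasible S) (phi S) (unscale lo hi \<theta>)
               + normal_cone (cbox lo hi) (unscale lo hi \<theta>) \<longleftrightarrow>
         0 \<in> clarke_subdiff {\<Lambda> \<in> feasible S. phi S \<Lambda> > 0} (\<lambda>\<Lambda>. - rho_star S \<Lambda>) (unscale lo hi \<theta>)
               + normal_cone (cbox lo hi) (unscale lo hi \<theta>))))"
proof -
  define X where "X = scaled_domain lo hi U"
  define f where "f = psi S lo hi"
  note S = assms(1) and lohi = assms(2)
  have U_feas: "U \<subseteq> feasible S" using assms(7) closure_subset by blast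
  have in_U: "unscale lo hi \<theta> \<in> U" if "\<theta> \<in> unit_box" for \<theta>
    using that unscale_box_iff[OF lohi] assms(5) by blast
  have f: "f = (\<lambda>\<theta>. phi S (unscale lo hi \<theta>))" by (simp add: f_def psi_def fun_eq_iff)
  interpret gs_execution f X I R
    using assms(8,9) by unfold_locales (simp_all add: f_def X_def)
  have psi_phi: "0 \<in> clarke_subdiff X f \<theta> + normal_cone unit_box \<theta> \<longleftrightarrow>
      0 \<in> clarke_subdiff (feasible S) (phi S) (unscale lo hi \<theta>) + normal_cone (cbox lo hi) (unscale lo hi \<theta>)"
    if "\<theta> \<in> unit_box" for \<theta>
    unfolding f X_def using in_U[OF that] U_feas assms(4)
    by (intro stationary_unscale_iff[OF lohi]) auto
  have phi_rho: "0 \<in> clarke_subdiff (feasible S) (phi S) (unscale lo hi \<theta>)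
        + normal_cone (cbox lo hi) (unscale lo hi \<theta>) \<longleftrightarrow>
      0 \<in> clarke_subdiff {\<Lambda> \<in> feasible S. phi S \<Lambda> > 0} (\<lambda>\<Lambda>. - rho_star S \<Lambda>) (unscale lo hi \<theta>)
        + normal_cone (cbox lo hi) (unscale lo hi \<theta>)"
    if \<theta>: "\<theta> \<in> unit_box" and pos: "(INF \<Lambda>\<in>cbox lo hi. phi S \<Lambda>) > 0" for \<theta>
  proof -
    have "unscale lo hi \<theta> \<in> cbox lo hi" using unscale_box_iff[OF lohi] \<theta> by blast
    then have "(INF \<Lambda>\<in>cbox lo hi. phi S \<Lambda>) \<le> phi S (unscale lo hi \<theta>)"
      by (intro cINF_lower bdd_belowI2[of _ 0] phi_nonneg)
    then have "phi S (unscale lo hi \<theta>) > 0" using pos by linarith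
    moreover obtain \<rho> L where "\<rho> > 0" "ball (unscale lo hi \<theta>) \<rho> \<subseteq> U"
      "L-lipschitz_on (ball (unscale lo hi \<theta>) \<rho>) (phi S)"
      using phi_locally_lipschitz[OF S assms(4) U_feas in_U[OF \<theta>]] by blast
    moreover have "(\<lambda>\<Lambda>. - rho_star S \<Lambda>) = (\<lambda>\<Lambda>. - 1 / phi S \<Lambda>)"
      by (simp add: rho_star_def)
    ultimately show ?thesis
      using stationary_neg_inverse_iff[of L "ball (unscale lo hi \<theta>) \<rho>" "phi S"] U_feas by simp
  qed
  have accumulation: "\<theta> \<in> unit_box" "0 \<in> clarke_subdiff X f \<theta> + normal_cone unit_box \<theta>"
    if infinite: "\<forall>k. reached R k" and acc: "accumulation_point (iterate R) \<theta>" for \<theta>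
  proof -
    have "gs_infinite_execution f X I R"
    proof unfold_locales
      show "\<exists>W L. open W \<and> x \<in> W \<and> W \<subseteq> X \<and> L-lipschitz_on W f" if "x \<in> unit_box" for x
        unfolding f_def X_def by (rule psi_locally_lipschitz[OF S assms(4) U_feas in_U[OF that]])
      show "gradient_consistent f X I R" using assms(16) infinite by (simp add: f_def X_def)
    qed (use infinite assms(13-15) in blast)+
    then interpret gs_infinite_execution f X I R .
    show "\<theta> \<in> unit_box"
      using acc accumulation_in_box unfolding accumulation_point_def by blast
    show "0 \<in> clarke_subdiff X f \<theta> + normal_cone unit_box \<theta>"
      using acc by (rule accumulation_point_stationary)
  qed
  show ?thesis
    unfolding f_def[symmetric] X_def[symmetric]
    using iterate_in_box decreasing accumulation psi_phi phi_rho by blast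
qed

end
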